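(* Let $n\geq 2$, let $m\geq 1$ be an integer, and let $0<\alpha<2$. Suppose $u\in C^{2m+[\alpha],\{\alpha\}+\epsilon}_{loc}(\mathbb{R}^n)\cap\mathcal{L}_\alpha(\mathbb{R}^n)$ (for some arbitrarily small $\epsilon>0$) satisfies $u\geq 0$ in $\mathbb{R}^n$ and $$(-\Delta)^{m+\frac{\alpha}{2}}u(x)=0\qquad\text{for all } x\in\mathbb{R}^n.$$ Then there is a constant $C\geq 0$ such that $u\equiv C$ in $\mathbb{R}^n$.
   Context: $[\alpha]$ is the integer part of $\alpha$ and $\{\alpha\}=\alpha-[\alpha]$. $\mathcal{L}_\alpha(\mathbb{R}^n)=\{u:\mathbb{R}^n\to\mathbb{R} : \int_{\mathbb{R}^n}\frac{|u(x)|}{1+|x|^{n+\alpha}}dx<\infty\}$. For $0<\alpha<2$ and $u\in C^{[\alpha],\{\alpha\}+\epsilon}_{loc}(\mathbb{R}^n)\cap\mathcal{L}_\alpha(\mathbb{R}^n)$, the fractional Laplacian is $(-\Delta)^{\frac{\alpha}{2}}u(x)=C_{n,\alpha}\lim_{\varepsilon\to0}\int_{|y-x|\geq\varepsilon}\frac{u(x)-u(y)}{|x-y|^{n+\alpha}}dy$, where $C_{n,\alpha}>0$ is the usual normalization constant (Fourier multiplier $|\xi|^\alpha$). For $u\in C^{2m+[\alpha],\{\alpha\}+\epsilon}_{loc}(\mathbb{R}^n)\cap\mathcal{L}_\alpha(\mathbb{R}^n)$ one has $(-\Delta)^{\frac{\alpha}{2}}u\in C^{2m}(\mathbb{R}^n)$,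 and $(-\Delta)^{m+\frac{\alpha}{2}}u:=(-\Delta)^m\big((-\Delta)^{\frac{\alpha}{2}}u\big)$. *)

theory Defs
  imports "HOL-Analysis.Analysis"
begin

definition partial_deriv :: "'a::euclidean_space \<Rightarrow> ('a \<Rightarrow> real) \<Rightarrow> 'a \<Rightarrow> real" where
  "partial_deriv b f x = frechet_derivative f (at x) b"

primrec C_k :: "nat \<Rightarrow> ('a::euclidean_space \<Rightarrow> real) \<Rightarrow> bool" where
  "C_k 0 f \<longleftrightarrow> continuous_on UNIV f"
| "C_k (Suc k) f \<longleftrightarrow> (\<forall>x. f differentiable (at x)) \<and> (\<forall>b\<in>Basis. C_k k (partial_deriv b f))"

definition holder_loc :: "real \<Rightarrow> ('a::euclidean_space \<Rightarrow> real) \<Rightarrow> bool" where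
  "holder_loc \<gamma> f \<longleftrightarrow>
     (\<forall>K. compact K \<longrightarrow> (\<exists>B. \<forall>x\<in>K. \<forall>y\<in>K. \<bar>f x - f y\<bar> \<le> B * dist x y powr \<gamma>))"

text \<open>The class \<open>C\<^sup>k\<^sup>,\<^sup>\<gamma>\<^sub>l\<^sub>o\<^sub>c\<close>. A list of basis vectors of length \<open>k\<close> encodes an iterated
  partial derivative of order \<open>k\<close>.\<close>

definition C_k_holder_loc :: "nat \<Rightarrow> real \<Rightarrow> ('a::euclidean_space \<Rightarrow> real) \<Rightarrow> bool" where
  "C_k_holder_loc k \<gamma> f \<longleftrightarrow>
     C_k k f \<and>
     (\<forall>bs. length bs = k \<and> set bs \<subseteq> Basis \<longrightarrow> holder_loc \<gamma> (foldr partial_deriv bs f))"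

definition L_space :: "real \<Rightarrow> ('a::euclidean_space \<Rightarrow> real) set" where
  "L_space \<alpha> = {u. u \<in> borel_measurable lebesgue \<and>
     integrable lebesgue (\<lambda>x. \<bar>u x\<bar> / (1 + norm x powr (real DIM('a) + \<alpha>)))}"

text \<open>The constant \<open>C\<^sub>n\<^sub>,\<^sub>\<alpha>\<close>, for \<open>0 < \<alpha> < 2\<close>: the reciprocal of the integral over \<open>\<real>\<^sup>n\<close> of
  \<open>(1 - cos y\<^sub>1) / |y|\<^sup>n\<^sup>+\<^sup>\<alpha>\<close>, in closed form. With it the singular integral below has Fourier
  multiplier \<open>|\<xi>|\<^sup>\<alpha>\<close>.\<close>

definition frac_lap_const :: "nat \<Rightarrow> real \<Rightarrow> real" where
  "frac_lap_const n \<alpha> =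
     2 powr \<alpha> * Gamma ((real n + \<alpha>) / 2) / (pi powr (real n / 2) * \<bar>Gamma (- \<alpha> / 2)\<bar>)"

text \<open>The operator \<open>(-\<Delta>)\<^sup>\<alpha>\<^sup>/\<^sup>2\<close>. \<^const>\<open>Lim\<close> is a total function; the limit exists for the functions
  \<open>u\<close> on which the operator is used.\<close>

definition frac_laplacian :: "real \<Rightarrow> ('a::euclidean_space \<Rightarrow> real) \<Rightarrow> 'a \<Rightarrow> real" where
  "frac_laplacian \<alpha> u x = frac_lap_const DIM('a) \<alpha> *
     Lim (at_right 0) (\<lambda>\<epsilon>.
       set_lebesgue_integral lebesgue {y. norm (y - x) \<ge> \<epsilon>}
         (\<lambda>y. (u x - u y) / norm (x - y) powr (real DIM('a) + \<alpha>)))"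

definition laplacian :: "('a::euclidean_space \<Rightarrow> real) \<Rightarrow> 'a \<Rightarrow> real" where
  "laplacian f x = (\<Sum>b\<in>Basis. partial_deriv b (partial_deriv b f) x)"

definition neg_laplacian :: "('a::euclidean_space \<Rightarrow> real) \<Rightarrow> 'a \<Rightarrow> real" where
  "neg_laplacian f x = - laplacian f x"

text \<open>The operator \<open>(-\<Delta>)\<^sup>m\<^sup>+\<^sup>\<alpha>\<^sup>/\<^sup>2\<close>.\<close>

definition higher_frac_laplacian :: "nat \<Rightarrow> real \<Rightarrow> ('a::euclidean_space \<Rightarrow> real) \<Rightarrow> 'a \<Rightarrow> real" where
  "higher_frac_laplacian m \<alpha> u = (neg_laplacian ^^ m) (frac_laplacian \<alpha> u)"

end

theory Submission
  imports Defs
begin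

text \<open>Write \<open>v = (-\<Delta>)\<^sup>\<alpha>\<^sup>/\<^sup>2 u\<close>. Being polyharmonic, \<open>v\<close> has weighted means over the balls of radius \<open>R\<close>
  around a point that are polynomial in \<open>R\<close> (Pizzetti). Moving the fractional Laplacian onto the
  weight bounds these means by a multiple of \<open>\<integral>|u(y)| (R + |x - y|)\<^sup>-\<^sup>n\<^sup>-\<^sup>\<alpha> dy\<close>, which tends to \<open>0\<close> as
  \<open>R\<close> grows. So the polynomial vanishes, and with it its value at \<open>R = 0\<close>, a multiple of \<open>v(x)\<close>.
  A nonnegative solution of \<open>(-\<Delta>)\<^sup>\<alpha>\<^sup>/\<^sup>2 u = 0\<close> satisfies a global Harnack inequality: touching \<open>u\<close> from
  below by a paraboloid bounds its mass on every ball and its tail by a value of \<open>u\<close>, and touching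
  it from above bounds \<open>u\<close> pointwise by the mass and the tail. The Harnack inequality for \<open>u - inf u\<close>
  shows that \<open>u\<close> is constant.\<close>

section \<open>Integrals over Euclidean space\<close>

text \<open>The obstacle is that v has no known growth: u is only integrable against a weight, so no
  Liouville theorem for polyharmonic functions applies to v directly. Testing v against (1 -
  |z|^2)_+^2 removes it. This weight is C^{1,1}, so its fractional Laplacian of order \<alpha> < 2
  is an absolutely convergent integral decaying like |z|^(-n-\<alpha>), which is exactly the weight
  under which u is integrable. At the same time the powers (1 - |z|^2)_+^N are linked by
  differentiation, so Pizzetti's formula follows from integration by parts on the whole space,
  without surface integrals. The singular integral is handled throughout as an integral of second
  differences. It then converges absolutely for every 0 < \<alpha> < 2, and Fubini's theorem and
  dominated convergence become available. The Harnack inequality is elementary because u is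
  nonnegative on the whole space: the equation at a single touching point already bounds an integral
  of u over everything. Its constant does not depend on the points compared or on their distance,
  hence it can be applied along a sequence approaching the infimum.\<close>

lemma nn_integral_lborel_affine:
  fixes f :: "'a::euclidean_space \<Rightarrow> ennreal"
  assumes [measurable]: "f \<in> borel_measurable borel" and "c \<noteq> 0"
  shows "(\<integral>\<^sup>+x. f x \<partial>lborel) = ennreal (\<bar>c\<bar> ^ DIM('a)) * (\<integral>\<^sup>+x. f (t + c *\<^sub>R x) \<partial>lborel)"
  by (subst lborel_affine[OF assms(2), of t])
     (simp add: nn_integral_density nn_integral_distr nn_integral_cmult)

lemma integrable_lborel_affine_iff:
  fixes f :: "'a::euclidean_space \<Rightarrow> real"
  assumes [measurable]: "f \<in> borel_measurable borel" and "c \<noteq> 0"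
  shows "integrable lborel (\<lambda>x. f (t + c *\<^sub>R x)) \<longleftrightarrow> integrable lborel f"
  using assms(2) unfolding integrable_iff_bounded
  by (subst (2) nn_integral_lborel_affine[where c=c and t=t])
     (auto simp: ennreal_mult_less_top ennreal_mult_eq_top_iff less_top)

lemma integral_lborel_affine:
  fixes f :: "'a::euclidean_space \<Rightarrow> real"
  assumes [measurable]: "f \<in> borel_measurable borel" and "c \<noteq> 0"
  shows "(LBINT x. f x) = \<bar>c\<bar> ^ DIM('a) * (LBINT x. f (t + c *\<^sub>R x))"
  by (subst lborel_affine[OF assms(2), of t])
     (simp add: integral_density integral_distr)

lemma integrable_lborel_shift_iff:
  fixes f :: "'a::euclidean_space \<Rightarrow> real"
  assumes "f \<in> borel_measurable borel"
  shows "integrable lborel (\<lambda>x. f (t + x)) \<longleftrightarrow> integrable lborel f"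
  using integrable_lborel_affine_iff[OF assms, of 1 t] by simp

lemma integral_lborel_shift:
  fixes f :: "'a::euclidean_space \<Rightarrow> real"
  assumes "f \<in> borel_measurable borel"
  shows "(LBINT x. f (t + x)) = (LBINT x. f x)"
  using integral_lborel_affine[OF assms, of 1 t] by simp

lemma integrable_lborel_reflect_iff:
  fixes f :: "'a::euclidean_space \<Rightarrow> real"
  assumes "f \<in> borel_measurable borel"
  shows "integrable lborel (\<lambda>x. f (t - x)) \<longleftrightarrow> integrable lborel f"
  using integrable_lborel_affine_iff[OF assms, of "-1" t] by simp

lemma integral_lborel_reflect:
  fixes f :: "'a::euclidean_space \<Rightarrow> real"
  assumes "f \<in> borel_measurable borel"
  shows "(LBINT x. f (t - x)) = (LBINT x. f x)"
  using integral_lborel_affine[OF assms, of "-1" t] by simp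

text \<open>The function is dominated by the series of \<open>c k\<close> times the indicator of the
  ball of radius \<open>\<rho> k\<close>, whose integral is the given sum times the volume of the
  unit ball. With dyadic radii this replaces polar coordinates.\<close>

lemma integrable_lborel_ball_cover:
  fixes f :: "'a::euclidean_space \<Rightarrow> real"
  assumes [measurable]: "f \<in> borel_measurable borel"
    and nn: "\<And>h. 0 \<le> f h" "\<And>k. 0 \<le> c k" "\<And>k. 0 \<le> \<rho> k"
    and cover: "\<And>h. f h = 0 \<or> (\<exists>k::nat. f h \<le> c k \<and> norm h \<le> \<rho> k)"
    and summ: "summable (\<lambda>k. c k * \<rho> k ^ DIM('a))"
  shows "integrable lborel f"
proof (rule integrableI_bounded)
  let ?g = "\<lambda>k h. ennreal (c k) * indicator (cball (0::'a) (\<rho> k)) h"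
  have [measurable]: "cball (0::'a) (\<rho> k) \<in> sets borel" for k
    by (simp add: borel_closed)
  have "ennreal (norm (f h)) \<le> (\<Sum>k. ?g k h)" for h
  proof (cases "f h = 0")
    case False
    then obtain k where k: "f h \<le> c k" "norm h \<le> \<rho> k" using cover by blast
    have "ennreal (norm (f h)) \<le> ?g k h"
      using k nn by (auto simp: indicator_def intro: ennreal_leI)
    also have "\<dots> \<le> (\<Sum>k. ?g k h)"
      using sum_le_suminf[OF summableI, where I="{k}" and f="\<lambda>k. ?g k h"]
      by (simp only: sum.insert finite.emptyI empty_iff not_False_eq_True sum.empty add_0_right finite.insertI zero_le simp_thms)
    finally show ?thesis .
  qed simp
  then have "(\<integral>\<^sup>+h. ennreal (norm (f h)) \<partial>lborel) \<le> (\<integral>\<^sup>+h. (\<Sum>k. ?g k h) \<partial>lborel)"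
    by (intro nn_integral_mono) auto
  also have "\<dots> = (\<Sum>k. \<integral>\<^sup>+h. ?g k h \<partial>lborel)"
    by (intro nn_integral_suminf) auto
  also have "\<dots> = (\<Sum>k. ennreal (unit_ball_vol (DIM('a)) * (c k * \<rho> k ^ DIM('a))))"
    using nn by (intro suminf_cong)
      (simp add: nn_integral_cmult_indicator emeasure_cball mult_ac flip: ennreal_mult)
  also have "\<dots> < \<infinity>"
    using nn summ by (subst suminf_ennreal2) (auto intro!: summable_mult mult_nonneg_nonneg)
  finally show "(\<integral>\<^sup>+h. ennreal (norm (f h)) \<partial>lborel) < \<infinity>" .
qed simp

lemma dyadic_bracket:
  fixes t :: real
  assumes "1 \<le> t"
  shows "\<exists>k::nat. 2 ^ k \<le> t \<and> t \<le> 2 ^ Suc k"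
proof -
  define k where "k = nat \<lfloor>log 2 t\<rfloor>"
  have l: "0 \<le> log 2 t" using assms by simp
  have "real k \<le> log 2 t" "log 2 t \<le> real k + 1"
    using l unfolding k_def by linarith+
  then have "2 powr real k \<le> 2 powr (log 2 t)" "2 powr (log 2 t) \<le> 2 powr (real (Suc k))"
    by auto
  then show ?thesis using assms by (auto simp: powr_realpow simp del: of_nat_Suc)
qed

text \<open>On the shell between the radii 2^k and 2^(k+1) the power is at most its value at 2^k, so
  the covering series is geometric with ratio 2^(-\<alpha>).\<close>

lemma integrable_norm_powr_outside:
  assumes "0 < \<alpha>"
  shows "integrable lborel (\<lambda>h::'a::euclidean_space.
           indicator {h. 1 \<le> norm h} h * norm h powr - (real DIM('a) + \<alpha>))"
proof (rule integrable_lborel_ball_cover[where c="\<lambda>k. (2^k) powr - (real DIM('a) + \<alpha>)" and \<rho>="\<lambda>k. 2 ^ Suc k"])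
  fix h :: 'a
  show "indicator {h. 1 \<le> norm h} h * norm h powr - (real DIM('a) + \<alpha>) = 0 \<or>
         (\<exists>k. indicator {h. 1 \<le> norm h} h * norm h powr - (real DIM('a) + \<alpha>)
             \<le> (2 ^ k) powr - (real DIM('a) + \<alpha>) \<and> norm h \<le> 2 ^ Suc k)"
  proof (cases "1 \<le> norm h")
    case True
    then obtain k :: nat where k: "2 ^ k \<le> norm h" "norm h \<le> 2 ^ Suc k"
      using dyadic_bracket by blast
    have "norm h powr - (real DIM('a) + \<alpha>) \<le> (2 ^ k) powr - (real DIM('a) + \<alpha>)"
      using k assms by (intro powr_mono2') auto
    then show ?thesis using k True by auto
  qed auto
next
  have "(2^k) powr - (real DIM('a) + \<alpha>) * (2 ^ Suc k) ^ DIM('a) = 2 ^ DIM('a) * (2 powr - \<alpha>) ^ k" for k :: nat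
  proof -
    have "(2 ^ Suc k) ^ DIM('a) = (2::real) ^ DIM('a) * (2^k) powr (real DIM('a))"
      by (simp add: powr_realpow power_mult_distrib)
    moreover have "(2^k) powr - (real DIM('a) + \<alpha>) * (2^k) powr (real DIM('a)) = (2^k) powr - \<alpha>"
      by (simp flip: powr_add)
    moreover have "(2^k) powr - \<alpha> = (2 powr - \<alpha>) ^ k"
      by (simp add: powr_powr powr_power mult.commute flip: powr_realpow)
    ultimately show ?thesis by (simp add: mult_ac)
  qed
  then show "summable (\<lambda>k. (2^k) powr - (real DIM('a) + \<alpha>) * (2 ^ Suc k) ^ DIM('a))"
    using assms by (simp only:) (auto intro!: summable_mult summable_geometric simp: powr_less_one)
qed auto

lemma integrable_norm_powr_inside:
  assumes "0 < \<beta>"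
  shows "integrable lborel (\<lambda>h::'a::euclidean_space.
           indicator {h. norm h < 1} h * norm h powr (\<beta> - real DIM('a)))"
proof (rule integrable_lborel_ball_cover[where
    c="\<lambda>k. 2 powr \<bar>\<beta> - real DIM('a)\<bar> * ((1/2)^k) powr (\<beta> - real DIM('a))" and \<rho>="\<lambda>k. (1/2) ^ k"])
  let ?p = "\<beta> - real DIM('a)"
  fix h :: 'a
  show "indicator {h. norm h < 1} h * norm h powr ?p = 0 \<or>
         (\<exists>k. indicator {h. norm h < 1} h * norm h powr ?p
             \<le> 2 powr \<bar>?p\<bar> * ((1/2)^k) powr ?p \<and> norm h \<le> (1/2) ^ k)"
  proof (cases "norm h < 1 \<and> h \<noteq> 0")
    case True
    then have "1 \<le> 1 / norm h" by simp
    then obtain k :: nat where k: "2 ^ k \<le> 1 / norm h" "1 / norm h \<le> 2 ^ Suc k"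
      using dyadic_bracket by blast
    \<comment> \<open>On the shell q lies in [1/2, 1]. The exponent \<beta> - n may have either
      sign, and in both cases the power of q is at most 2 to the absolute value of the exponent;
      this is the extra factor in the constants c.\<close>
    define q where "q = norm h * 2 ^ k"
    have q: "q \<le> 1" "1/2 \<le> q" "norm h = q * (1/2) ^ k" "norm h \<le> (1/2)^k"
      using k True by (auto simp: q_def field_simps)
    have "q powr ?p \<le> 2 powr \<bar>?p\<bar>"
    proof (cases "0 \<le> ?p")
      case True
      then have "q powr ?p \<le> 1 powr ?p" using q by (intro powr_mono2) auto
      also have "\<dots> \<le> 2 powr \<bar>?p\<bar>" by (simp add: ge_one_powr_ge_zero)
      finally show ?thesis .
    next
      case False
      then have "q powr ?p \<le> (1/2) powr ?p" using q by (intro powr_mono2') auto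
      also have "\<dots> = 2 powr \<bar>?p\<bar>" using False by (simp add: powr_divide powr_minus_divide[symmetric] flip: powr_minus)
      finally show ?thesis .
    qed
    then have "norm h powr ?p \<le> 2 powr \<bar>?p\<bar> * ((1/2)^k) powr ?p"
      using q by (simp add: powr_mult mult_right_mono)
    then show ?thesis using q True by auto
  qed auto
next
  have "2 powr \<bar>\<beta> - real DIM('a)\<bar> * ((1/2)^k) powr (\<beta> - real DIM('a)) * ((1/2) ^ k) ^ DIM('a)
       = 2 powr \<bar>\<beta> - real DIM('a)\<bar> * ((1/2) powr \<beta>) ^ k" for k :: nat
  proof -
    have "((1/2) ^ k) ^ DIM('a) = ((1/2::real)^k) powr (real DIM('a))"
      by (simp add: powr_realpow)
    moreover have "((1/2)^k) powr (\<beta> - real DIM('a)) * ((1/2::real)^k) powr (real DIM('a)) = ((1/2)^k) powr \<beta>"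
      by (simp flip: powr_add)
    moreover have "((1/2::real)^k) powr \<beta> = ((1/2) powr \<beta>) ^ k"
      using powr_realpow[of "1/2" k] by (simp add: powr_powr powr_power mult.commute flip: powr_realpow)
    ultimately show ?thesis by (simp only: mult.assoc)
  qed
  moreover have "(1/2) powr \<beta> < 1" using assms by (simp add: powr01_less_one)
  ultimately show "summable (\<lambda>k. 2 powr \<bar>\<beta> - real DIM('a)\<bar> * ((1/2)^k) powr (\<beta> - real DIM('a)) * ((1/2) ^ k) ^ DIM('a))"
    by (simp only:) (auto intro!: summable_mult summable_geometric)
qed auto

section \<open>Continuity and differentiability of parameter integrals\<close>

lemma linear_bound_Basis:
  fixes f :: "'a::euclidean_space \<Rightarrow> real"
  assumes "linear f" and B: "\<And>b. b \<in> Basis \<Longrightarrow> \<bar>f b\<bar> \<le> B b"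
  shows "\<bar>f v\<bar> \<le> norm v * (\<Sum>b\<in>Basis. B b)"
proof -
  have "f v = (\<Sum>b\<in>Basis. (v \<bullet> b) * f b)"
    by (subst euclidean_representation[of v, symmetric])
       (simp only: linear_sum[OF assms(1)] linear_cmul[OF assms(1)] real_scaleR_def)
  also have "\<bar>\<dots>\<bar> \<le> (\<Sum>b\<in>Basis. \<bar>(v \<bullet> b) * f b\<bar>)" by (rule sum_abs)
  also have "\<dots> \<le> (\<Sum>b\<in>Basis. norm v * B b)"
    using B by (intro sum_mono) (auto simp: abs_mult Basis_le_norm intro!: mult_mono)
  finally show ?thesis by (simp add: sum_distrib_left)
qed

lemma isCont_integral_dominated:
  fixes g :: "'a::metric_space \<Rightarrow> 'b \<Rightarrow> real"
  assumes r: "0 < r"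
    and meas: "\<And>x. x \<in> ball x0 r \<Longrightarrow> g x \<in> borel_measurable M"
    and cont: "\<And>h. h \<in> space M \<Longrightarrow> isCont (\<lambda>x. g x h) x0"
    and bound: "\<And>x h. x \<in> ball x0 r \<Longrightarrow> h \<in> space M \<Longrightarrow> \<bar>g x h\<bar> \<le> B h"
    and B: "integrable M B"
  shows "isCont (\<lambda>x. \<integral>h. g x h \<partial>M) x0"
  unfolding isCont_def
proof (subst tendsto_at_iff_sequentially, intro allI impI)
  fix X :: "nat \<Rightarrow> 'a"
  assume X: "\<forall>i. X i \<in> UNIV - {x0}" and lim: "X \<longlonglongrightarrow> x0"
  obtain N where N: "\<And>i. i \<ge> N \<Longrightarrow> X i \<in> ball x0 r"
    using lim r unfolding lim_sequentially by (metis dist_commute mem_ball)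
  have "(\<lambda>i. \<integral>h. g (X (i + N)) h \<partial>M) \<longlonglongrightarrow> (\<integral>h. g x0 h \<partial>M)"
  proof (rule integral_dominated_convergence[where w=B])
    show "AE h in M. (\<lambda>i. g (X (i + N)) h) \<longlonglongrightarrow> g x0 h"
      by (rule AE_I2, rule isCont_tendsto_compose[OF cont])
         (auto intro: LIMSEQ_ignore_initial_segment lim)
  qed (use r N meas bound B in auto)
  then have "(\<lambda>i. \<integral>h. g (X i) h \<partial>M) \<longlonglongrightarrow> (\<integral>h. g x0 h \<partial>M)"
    by (rule LIMSEQ_offset)
  then show "((\<lambda>x. \<integral>h. g x h \<partial>M) \<circ> X) \<longlonglongrightarrow> (\<integral>h. g x0 h \<partial>M)"
    by (simp add: o_def)
qed

lemma has_derivative_integral_dominated: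
  fixes g :: "'a::euclidean_space \<Rightarrow> 'b \<Rightarrow> real"
  assumes r: "0 < r"
    and int: "\<And>x. x \<in> ball x0 r \<Longrightarrow> integrable M (g x)"
    and der: "\<And>x h. x \<in> ball x0 r \<Longrightarrow> h \<in> space M \<Longrightarrow> ((\<lambda>x. g x h) has_derivative D x h) (at x)"
    and meas: "\<And>b. b \<in> Basis \<Longrightarrow> (\<lambda>h. D x0 h b) \<in> borel_measurable M"
    and bound: "\<And>x h b. x \<in> ball x0 r \<Longrightarrow> h \<in> space M \<Longrightarrow> b \<in> Basis \<Longrightarrow> \<bar>D x h b\<bar> \<le> B h"
    and B: "integrable M B"
  shows "((\<lambda>x. \<integral>h. g x h \<partial>M) has_derivative (\<lambda>v. \<integral>h. D x0 h v \<partial>M)) (at x0)"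
proof -
  let ?n = "real DIM('a)"
  have x0: "x0 \<in> ball x0 r" using r by simp
  have lin: "linear (D x h)" if "x \<in> ball x0 r" "h \<in> space M" for x h
    using der[OF that] has_derivative_linear by blast
  have expand: "D x0 h v = (\<Sum>b\<in>Basis. (v \<bullet> b) * D x0 h b)" if "h \<in> space M" for h v
    by (subst euclidean_representation[of v, symmetric])
       (simp only: linear_sum[OF lin[OF x0 that]] linear_cmul[OF lin[OF x0 that]] real_scaleR_def)
  have Dbound: "\<bar>D x h v\<bar> \<le> norm v * (?n * B h)" if "x \<in> ball x0 r" "h \<in> space M" for x h v
    using linear_bound_Basis[OF lin[OF that], of "\<lambda>_. B h" v] bound[OF that] by simp
  have intD: "integrable M (\<lambda>h. D x0 h b)" if "b \<in> Basis" for b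
    by (rule Bochner_Integration.integrable_bound[OF B])
       (use meas[OF that] bound[OF x0 _ that] in \<open>auto intro!: AE_I2 order_trans[OF bound[OF x0 _ that] abs_ge_self]\<close>)
  have intD': "integrable M (\<lambda>h. D x0 h v)" for v
    by (subst Bochner_Integration.integrable_cong[OF refl expand]) (auto intro!: intD)
  have D_eq: "(\<integral>h. D x0 h v \<partial>M) = (\<Sum>b\<in>Basis. (v \<bullet> b) * (\<integral>h. D x0 h b \<partial>M))" for v
    by (subst Bochner_Integration.integral_cong[OF refl expand])
       (auto simp: Bochner_Integration.integral_sum intD)
  have bl: "bounded_linear (\<lambda>v. \<integral>h. D x0 h v \<partial>M)"
  proof -
    have "bounded_linear (\<lambda>v. \<Sum>b\<in>Basis. (v \<bullet> b) * (\<integral>h. D x0 h b \<partial>M))"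
      by (rule bounded_linear_sum) (rule bounded_linear_mult_const[OF bounded_linear_inner_left])
    then show ?thesis by (simp only: D_eq[symmetric])
  qed
  \<comment> \<open>The mean value inequality bounds the difference quotients by n times B. Together
    with the derivative at x0 itself this yields the dominating function 2 n B used below.\<close>
  have diffb: "\<bar>g y h - g x0 h\<bar> \<le> norm (y - x0) * (?n * B h)" if y: "y \<in> ball x0 r" and h: "h \<in> space M" for y h
  proof -
    have "norm (g y h - g x0 h) \<le> ?n * B h * norm (y - x0)"
    proof (rule differentiable_bound[of "ball x0 r" "\<lambda>x. g x h" "\<lambda>x. D x h"])
      fix x assume x: "x \<in> ball x0 r"
      show "((\<lambda>x. g x h) has_derivative D x h) (at x within ball x0 r)"
        using der[OF x h] has_derivative_at_withinI by blast
      show "onorm (D x h) \<le> ?n * B h"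
        using Dbound[OF x h] by (intro onorm_le) (simp add: mult.commute)
    qed (use y x0 in auto)
    then show ?thesis by (simp add: mult_ac)
  qed
  show ?thesis
    unfolding has_derivative_def
  proof (intro conjI bl)
    \<comment> \<open>\<open>has_derivative_def\<close> names the base point as the limit of the
      filter at x0; \<open>netlimit_at\<close> turns it back into x0.\<close>
    show "((\<lambda>y. ((\<integral>h. g y h \<partial>M) - (\<integral>h. g (Lim (at x0) (\<lambda>x. x)) h \<partial>M) - (\<integral>h. D x0 h (y - Lim (at x0) (\<lambda>x. x)) \<partial>M)) /\<^sub>R norm (y - Lim (at x0) (\<lambda>x. x))) \<longlongrightarrow> 0) (at x0)"
      unfolding netlimit_at
    proof (subst tendsto_at_iff_sequentially, intro allI impI)
      fix X :: "nat \<Rightarrow> 'a"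
      assume X: "\<forall>i. X i \<in> UNIV - {x0}" and lim: "X \<longlonglongrightarrow> x0"
      obtain N where N: "\<And>i. i \<ge> N \<Longrightarrow> X i \<in> ball x0 r"
        using lim r unfolding lim_sequentially by (metis dist_commute mem_ball)
      define Y where "Y i = X (i + N)" for i
      have Y: "Y i \<in> ball x0 r" "Y i \<noteq> x0" for i using N X by (auto simp: Y_def)
      have Ylim: "Y \<longlonglongrightarrow> x0" unfolding Y_def using lim by (rule LIMSEQ_ignore_initial_segment)
      define q where "q i h = (g (Y i) h - g x0 h - D x0 h (Y i - x0)) /\<^sub>R norm (Y i - x0)" for i h
      have "(\<lambda>i. \<integral>h. q i h \<partial>M) \<longlonglongrightarrow> (\<integral>h. 0 \<partial>M)"
      proof (rule integral_dominated_convergence[where w="\<lambda>h. 2 * ?n * B h"])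
        show "(\<lambda>h. q i h) \<in> borel_measurable M" for i
          unfolding q_def using int[OF Y(1)] int[OF x0] intD'
          by (auto dest!: borel_measurable_integrable)
        show "AE h in M. (\<lambda>i. q i h) \<longlonglongrightarrow> 0"
        proof (rule AE_I2)
          fix h assume h: "h \<in> space M"
          have "((\<lambda>y. (g y h - g x0 h - D x0 h (y - x0)) /\<^sub>R norm (y - x0)) \<longlongrightarrow> 0) (at x0)"
            using der[OF x0 h] unfolding has_derivative_def netlimit_at by blast
          moreover have "filterlim Y (at x0) sequentially"
            unfolding filterlim_at using Ylim Y by auto
          ultimately show "(\<lambda>i. q i h) \<longlonglongrightarrow> 0"
            unfolding q_def by (rule filterlim_compose)
        qed
        show "AE h in M. norm (q i h) \<le> 2 * ?n * B h" for i
        proof (rule AE_I2)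
          fix h assume h: "h \<in> space M"
          have "\<bar>g (Y i) h - g x0 h - D x0 h (Y i - x0)\<bar> \<le> norm (Y i - x0) * (2 * ?n * B h)"
            using diffb[OF Y(1) h, of i] Dbound[OF x0 h, of "Y i - x0"] by (simp add: algebra_simps abs_le_iff)
          then show "norm (q i h) \<le> 2 * ?n * B h"
            using Y[of i] by (simp add: q_def divide_inverse[symmetric] field_simps)
        qed
      qed (use B in auto)
      moreover have "(\<integral>h. q i h \<partial>M) = ((\<integral>h. g (Y i) h \<partial>M) - (\<integral>h. g x0 h \<partial>M) - (\<integral>h. D x0 h (Y i - x0) \<partial>M)) /\<^sub>R norm (Y i - x0)" for i
        unfolding q_def using int[OF Y(1)] int[OF x0] intD' by simp
      ultimately have "(\<lambda>i. ((\<integral>h. g (X (i + N)) h \<partial>M) - (\<integral>h. g x0 h \<partial>M) - (\<integral>h. D x0 h (X (i + N) - x0) \<partial>M)) /\<^sub>R norm (X (i + N) - x0)) \<longlonglongrightarrow> 0"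
        by (simp add: Y_def)
      from LIMSEQ_offset[OF this]
      show "((\<lambda>y. ((\<integral>h. g y h \<partial>M) - (\<integral>h. g x0 h \<partial>M) - (\<integral>h. D x0 h (y - x0) \<partial>M)) /\<^sub>R norm (y - x0)) \<circ> X) \<longlonglongrightarrow> 0"
        by (simp add: o_def)
    qed
  qed
qed

section \<open>Hoelder regularity and second differences\<close>

lemma partial_deriv_eq:
  assumes "(f has_derivative D) (at x)"
  shows "partial_deriv b f x = D b"
  unfolding partial_deriv_def using frechet_derivative_at[OF assms] by simp

lemma has_derivative_partial_derivs:
  fixes f :: "'a::euclidean_space \<Rightarrow> real"
  assumes "f differentiable (at x)"
  shows "(f has_derivative (\<lambda>v. \<Sum>b\<in>Basis. (v \<bullet> b) * partial_deriv b f x)) (at x)"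
proof -
  obtain D where D: "(f has_derivative D) (at x)"
    using assms unfolding differentiable_def by blast
  then have lin: "linear D" using has_derivative_linear by blast
  have "D v = (\<Sum>b\<in>Basis. (v \<bullet> b) * partial_deriv b f x)" for v
    unfolding partial_deriv_eq[OF D]
    by (subst euclidean_representation[of v, symmetric])
       (simp only: linear_sum[OF lin] linear_cmul[OF lin] real_scaleR_def)
  then have "D = (\<lambda>v. \<Sum>b\<in>Basis. (v \<bullet> b) * partial_deriv b f x)" by blast
  with D show ?thesis by simp
qed

lemma has_field_derivative_along_line:
  fixes f :: "'a::euclidean_space \<Rightarrow> real"
  assumes "f differentiable (at (x + t *\<^sub>R h))"
  shows "((\<lambda>t. f (x + t *\<^sub>R h)) has_real_derivative
           (\<Sum>b\<in>Basis. (h \<bullet> b) * partial_deriv b f (x + t *\<^sub>R h))) (at t)"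
proof -
  have "((\<lambda>t. f (x + t *\<^sub>R h)) has_derivative
          (\<lambda>v. \<Sum>b\<in>Basis. ((v *\<^sub>R h) \<bullet> b) * partial_deriv b f (x + t *\<^sub>R h))) (at t)"
    by (rule has_derivative_compose[where f="\<lambda>t. x + t *\<^sub>R h" and g=f,
          OF _ has_derivative_partial_derivs[OF assms]])
       (auto intro!: derivative_eq_intros)
  then show ?thesis
    by (rule has_derivative_imp_has_field_derivative) (simp add: sum_distrib_left sum_distrib_right mult_ac)
qed

lemma C_k_continuous: "C_k k f \<Longrightarrow> continuous_on UNIV f"
  by (cases k) (auto intro!: continuous_at_imp_continuous_on differentiable_imp_continuous_within)

lemma C_k_Suc_imp: "C_k (Suc k) f \<Longrightarrow> C_k k f"
proof (induction k arbitrary: f)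
  case 0
  then show ?case using C_k_continuous by (auto simp del: C_k.simps(2))
next
  case (Suc k)
  then show ?case unfolding C_k.simps(2)[of "Suc k" f] C_k.simps(2)[of k f] by blast
qed

lemma partial_deriv_add:
  "f differentiable (at x) \<Longrightarrow> g differentiable (at x) \<Longrightarrow>
    partial_deriv b (\<lambda>x. f x + g x) x = partial_deriv b f x + partial_deriv b g x"
  unfolding differentiable_def by (metis has_derivative_add partial_deriv_eq)

lemma partial_deriv_cmult:
  "f differentiable (at x) \<Longrightarrow> partial_deriv b (\<lambda>x. c * f x) x = c * partial_deriv b f x"
  unfolding differentiable_def by (metis has_derivative_mult_right partial_deriv_eq)

lemma C_k_add: "C_k k f \<Longrightarrow> C_k k g \<Longrightarrow> C_k k (\<lambda>x. f x + g x)"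
proof (induction k arbitrary: f g)
  case (Suc k)
  then have "partial_deriv b (\<lambda>x. f x + g x) = (\<lambda>x. partial_deriv b f x + partial_deriv b g x)" for b
    by (auto simp: partial_deriv_add)
  with Suc show ?case by auto
qed (auto intro: continuous_on_add)

lemma C_k_cmult: "C_k k f \<Longrightarrow> C_k k (\<lambda>x. c * f x)"
proof (induction k arbitrary: f)
  case (Suc k)
  then have "partial_deriv b (\<lambda>x. c * f x) = (\<lambda>x. c * partial_deriv b f x)" for b
    by (auto simp: partial_deriv_cmult)
  with Suc show ?case by (auto intro!: derivative_intros)
qed (auto intro!: continuous_intros)

lemma C_k_holder_loc_Suc_partial:
  assumes "C_k_holder_loc (Suc k) \<gamma> f" "b \<in> Basis"
  shows "C_k_holder_loc k \<gamma> (partial_deriv b f)"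
  unfolding C_k_holder_loc_def
proof (intro conjI allI impI)
  show "C_k k (partial_deriv b f)" using assms by (auto simp: C_k_holder_loc_def)
  fix bs :: "'a list" assume "length bs = k \<and> set bs \<subseteq> Basis"
  \<comment> \<open>\<open>foldr\<close> applies the last entry of the list first, so the derivative
    already taken goes to the end.\<close>
  then have "length (bs @ [b]) = Suc k \<and> set (bs @ [b]) \<subseteq> Basis" using assms(2) by auto
  then have "holder_loc \<gamma> (foldr partial_deriv (bs @ [b]) f)"
    using assms(1) unfolding C_k_holder_loc_def by blast
  then show "holder_loc \<gamma> (foldr partial_deriv bs (partial_deriv b f))" by simp
qed

section \<open>Local bounds and second differences\<close>

lemma continuous_bounded_cball:
  fixes f :: "'a::euclidean_space \<Rightarrow> real"
  assumes "continuous_on UNIV f"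
  obtains B where "0 \<le> B" "\<And>x. norm x \<le> r \<Longrightarrow> \<bar>f x\<bar> \<le> B"
proof -
  have "bounded (f ` cball 0 r)"
    by (intro compact_imp_bounded compact_continuous_image)
       (auto intro: continuous_on_subset[OF assms])
  then obtain B where "\<forall>x\<in>cball 0 r. \<bar>f x\<bar> \<le> B" by (auto simp: bounded_iff)
  then have "\<And>x. norm x \<le> r \<Longrightarrow> \<bar>f x\<bar> \<le> \<bar>B\<bar>"
    by (metis abs_ge_self mem_cball_0 order_trans)
  then show ?thesis using that[of "\<bar>B\<bar>"] by auto
qed

lemma C1_lipschitz_cball:
  fixes f :: "'a::euclidean_space \<Rightarrow> real"
  assumes f: "C_k (Suc k) f"
  obtains L where "0 \<le> L" "\<And>x y. norm x \<le> r \<Longrightarrow> norm y \<le> r \<Longrightarrow> \<bar>f x - f y\<bar> \<le> L * dist x y"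
proof -
  have "\<forall>b\<in>Basis. \<exists>B. \<forall>x. norm x \<le> r \<longrightarrow> \<bar>partial_deriv b f x\<bar> \<le> B"
  proof
    fix b :: 'a assume "b \<in> Basis"
    then have "continuous_on UNIV (partial_deriv b f)" using f C_k_continuous by auto
    then show "\<exists>B. \<forall>x. norm x \<le> r \<longrightarrow> \<bar>partial_deriv b f x\<bar> \<le> B"
      using continuous_bounded_cball by metis
  qed
  then obtain B where B: "\<And>b x. b \<in> Basis \<Longrightarrow> norm x \<le> r \<Longrightarrow> \<bar>partial_deriv b f x\<bar> \<le> B b"
    by (metis bchoice)
  let ?L = "\<bar>\<Sum>b\<in>Basis. B b\<bar>"
  have "\<bar>f x - f y\<bar> \<le> ?L * dist x y" if "norm x \<le> r" "norm y \<le> r" for x y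
  proof -
    have "norm (f x - f y) \<le> ?L * norm (x - y)"
    proof (rule differentiable_bound[of "cball 0 r" f "\<lambda>x v. \<Sum>b\<in>Basis. (v \<bullet> b) * partial_deriv b f x"])
      fix z :: 'a assume z: "z \<in> cball 0 r"
      have D: "(f has_derivative (\<lambda>v. \<Sum>b\<in>Basis. (v \<bullet> b) * partial_deriv b f z)) (at z)"
        using f by (intro has_derivative_partial_derivs) auto
      then show "(f has_derivative (\<lambda>v. \<Sum>b\<in>Basis. (v \<bullet> b) * partial_deriv b f z)) (at z within cball 0 r)"
        using has_derivative_at_withinI by blast
      show "onorm (\<lambda>v. \<Sum>b\<in>Basis. (v \<bullet> b) * partial_deriv b f z) \<le> ?L"
      proof (rule onorm_le)
        fix v
        have "\<bar>\<Sum>b\<in>Basis. (v \<bullet> b) * partial_deriv b f z\<bar> \<le> norm v * (\<Sum>b\<in>Basis. B b)"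
        proof (rule linear_bound_Basis[OF has_derivative_linear[OF D]])
          fix c :: 'a assume c: "c \<in> Basis"
          have "(\<Sum>b\<in>Basis. (c \<bullet> b) * partial_deriv b f z) = partial_deriv c f z"
            using partial_deriv_eq[OF D, of c] by simp
          then show "\<bar>\<Sum>b\<in>Basis. (c \<bullet> b) * partial_deriv b f z\<bar> \<le> B c" using B c z by simp
        qed
        also have "\<dots> \<le> norm v * ?L" by (intro mult_left_mono) auto
        finally show "norm (\<Sum>b\<in>Basis. (v \<bullet> b) * partial_deriv b f z) \<le> ?L * norm v"
          by (simp add: mult.commute)
      qed
    qed (use that in auto)
    then show ?thesis by (simp add: dist_norm)
  qed
  then show ?thesis using that[of ?L] by auto
qed

lemma C1_imp_holder_loc_1:
  fixes f :: "'a::euclidean_space \<Rightarrow> real"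
  assumes "C_k (Suc k) f"
  shows "holder_loc 1 f"
  unfolding holder_loc_def
proof (intro allI impI)
  fix K :: "'a set" assume "compact K"
  then obtain r where r: "\<And>x. x \<in> K \<Longrightarrow> norm x \<le> r"
    using compact_imp_bounded bounded_iff by metis
  obtain L where "\<And>x y. norm x \<le> r \<Longrightarrow> norm y \<le> r \<Longrightarrow> \<bar>f x - f y\<bar> \<le> L * dist x y"
    using C1_lipschitz_cball[OF assms] by metis
  then show "\<exists>B. \<forall>x\<in>K. \<forall>y\<in>K. \<bar>f x - f y\<bar> \<le> B * dist x y powr 1"
    using r by (intro exI[of _ L]) auto
qed

lemma holder_loc_cball:
  fixes f :: "'a::euclidean_space \<Rightarrow> real"
  assumes "holder_loc \<gamma> f"
  obtains B where "0 \<le> B" "\<And>x y. norm x \<le> r \<Longrightarrow> norm y \<le> r \<Longrightarrow> \<bar>f x - f y\<bar> \<le> B * norm (x - y) powr \<gamma>"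
proof -
  obtain B where B: "\<forall>x\<in>cball 0 r. \<forall>y\<in>cball 0 r. \<bar>f x - f y\<bar> \<le> B * dist x y powr \<gamma>"
    using assms compact_cball unfolding holder_loc_def by blast
  have "\<bar>f x - f y\<bar> \<le> \<bar>B\<bar> * norm (x - y) powr \<gamma>" if "norm x \<le> r" "norm y \<le> r" for x y
  proof -
    have "\<bar>f x - f y\<bar> \<le> B * norm (x - y) powr \<gamma>" using B that by (auto simp: dist_norm)
    also have "\<dots> \<le> \<bar>B\<bar> * norm (x - y) powr \<gamma>" by (intro mult_right_mono) auto
    finally show ?thesis .
  qed
  then show ?thesis using that[of "\<bar>B\<bar>"] by auto
qed

text \<open>The sign is that of the fractional Laplacian: nonnegative at a global maximum.
  Symmetrizing in h cancels the first order term, which is what makes the integral against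
  |h|^(-n-\<alpha>) absolutely convergent also for \<alpha> \<ge> 1.\<close>

definition second_diff :: "('a::euclidean_space \<Rightarrow> real) \<Rightarrow> 'a \<Rightarrow> 'a \<Rightarrow> real" where
  "second_diff f x h = 2 * f x - f (x + h) - f (x - h)"

text \<open>With \<beta> > \<alpha> this is the only trace of the Hoelder hypothesis that the
  singular integral needs, and it treats \<alpha> < 1 and \<alpha> \<ge> 1 alike.\<close>

definition second_diff_loc :: "real \<Rightarrow> ('a::euclidean_space \<Rightarrow> real) \<Rightarrow> bool" where
  "second_diff_loc \<beta> f \<longleftrightarrow>
     (\<forall>r. \<exists>C\<ge>0. \<forall>x h. norm x \<le> r \<longrightarrow> norm h \<le> 1 \<longrightarrow> \<bar>second_diff f x h\<bar> \<le> C * norm h powr \<beta>)"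

lemma holder_imp_second_diff_loc:
  fixes f :: "'a::euclidean_space \<Rightarrow> real"
  assumes "holder_loc \<gamma> f"
  shows "second_diff_loc \<gamma> f"
  unfolding second_diff_loc_def
proof
  fix r :: real
  obtain B where B: "0 \<le> B" "\<And>x y. norm x \<le> r + 1 \<Longrightarrow> norm y \<le> r + 1 \<Longrightarrow> \<bar>f x - f y\<bar> \<le> B * norm (x - y) powr \<gamma>"
    using holder_loc_cball[OF assms] by metis
  have "\<bar>second_diff f x h\<bar> \<le> 2 * B * norm h powr \<gamma>" if "norm x \<le> r" "norm h \<le> 1" for x h
  proof -
    have "norm (x + h) \<le> r + 1" "norm (x - h) \<le> r + 1"
      using that norm_triangle_ineq[of x h] norm_triangle_ineq4[of x h] by auto
    then have "\<bar>f x - f (x + h)\<bar> \<le> B * norm h powr \<gamma>" "\<bar>f x - f (x - h)\<bar> \<le> B * norm h powr \<gamma>"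
      using B(2)[of x "x + h"] B(2)[of x "x - h"] that by (auto simp: norm_minus_commute)
    then show ?thesis by (simp add: second_diff_def abs_le_iff)
  qed
  then show "\<exists>C\<ge>0. \<forall>x h. norm x \<le> r \<longrightarrow> norm h \<le> 1 \<longrightarrow> \<bar>second_diff f x h\<bar> \<le> C * norm h powr \<gamma>"
    using B(1) by (intro exI[of _ "2 * B"]) auto
qed

text \<open>The mean value theorem for t \<mapsto> f (x + t h) + f (x - t h) writes the second
  difference as h paired with a difference of gradients at two points at distance at most 2 |h|.
  This gains one power of |h| and produces the factor 2^\<gamma>.\<close>

lemma holder_gradient_imp_second_diff_loc:
  fixes f :: "'a::euclidean_space \<Rightarrow> real"
  assumes diff: "\<And>x. f differentiable (at x)"
    and hol: "\<And>b. b \<in> Basis \<Longrightarrow> holder_loc \<gamma> (partial_deriv b f)" and "0 \<le> \<gamma>"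
  shows "second_diff_loc (1 + \<gamma>) f"
  unfolding second_diff_loc_def
proof
  fix r :: real
  have "\<forall>b\<in>Basis. \<exists>B\<ge>0. \<forall>x y. norm x \<le> r + 1 \<longrightarrow> norm y \<le> r + 1 \<longrightarrow>
     \<bar>partial_deriv b f x - partial_deriv b f y\<bar> \<le> B * norm (x - y) powr \<gamma>"
    using holder_loc_cball[OF hol] by metis
  then obtain B where B: "\<And>b. b \<in> Basis \<Longrightarrow> 0 \<le> B b"
    "\<And>b x y. b \<in> Basis \<Longrightarrow> norm x \<le> r + 1 \<Longrightarrow> norm y \<le> r + 1 \<Longrightarrow>
     \<bar>partial_deriv b f x - partial_deriv b f y\<bar> \<le> B b * norm (x - y) powr \<gamma>"
    by (metis bchoice)
  let ?C = "2 powr \<gamma> * (\<Sum>b\<in>Basis. B b)"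
  have "\<bar>second_diff f x h\<bar> \<le> ?C * norm h powr (1 + \<gamma>)" if xh: "norm x \<le> r" "norm h \<le> 1" for x h
  proof -
    define \<phi> where "\<phi> t = f (x + t *\<^sub>R h) + f (x + t *\<^sub>R (- h))" for t
    define \<phi>' where "\<phi>' t = (\<Sum>b\<in>Basis. (h \<bullet> b) * partial_deriv b f (x + t *\<^sub>R h))
        + (\<Sum>b\<in>Basis. (- h \<bullet> b) * partial_deriv b f (x + t *\<^sub>R (- h)))" for t
    have "(\<phi> has_real_derivative \<phi>' t) (at t)" for t
      unfolding \<phi>_def \<phi>'_def by (intro DERIV_add has_field_derivative_along_line diff)
    then obtain t where t: "0 < t" "t < 1" "\<phi> 1 - \<phi> 0 = (1 - 0) * \<phi>' t"
      using MVT2[of 0 1 \<phi> \<phi>'] by auto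
    have sd: "second_diff f x h = - \<phi>' t"
      using t(3) by (simp add: second_diff_def \<phi>_def)
    have eq: "\<phi>' t = (\<Sum>b\<in>Basis. (h \<bullet> b) * (partial_deriv b f (x + t *\<^sub>R h) - partial_deriv b f (x + t *\<^sub>R (- h))))"
      by (simp add: \<phi>'_def sum_subtractf sum_negf algebra_simps)
    have "\<bar>\<phi>' t\<bar> \<le> (\<Sum>b\<in>Basis. \<bar>(h \<bullet> b) * (partial_deriv b f (x + t *\<^sub>R h) - partial_deriv b f (x + t *\<^sub>R (- h)))\<bar>)"
      unfolding eq by (rule sum_abs)
    also have "\<dots> \<le> (\<Sum>b\<in>Basis. norm h * (B b * (2 * norm h) powr \<gamma>))"
    proof (rule sum_mono)
      fix b :: 'a assume b: "b \<in> Basis"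
      have nt: "norm (t *\<^sub>R h) \<le> norm h" using t(1,2) mult_right_mono[of t 1 "norm h"] by simp
      have "norm (x + t *\<^sub>R h) \<le> r + 1" "norm (x - t *\<^sub>R h) \<le> r + 1"
        using xh nt norm_triangle_ineq[of x "t *\<^sub>R h"] norm_triangle_ineq4[of x "t *\<^sub>R h"] by linarith+
      then have "\<bar>partial_deriv b f (x + t *\<^sub>R h) - partial_deriv b f (x + t *\<^sub>R (- h))\<bar>
          \<le> B b * norm ((x + t *\<^sub>R h) - (x - t *\<^sub>R h)) powr \<gamma>"
        using B(2)[OF b, of "x + t *\<^sub>R h" "x - t *\<^sub>R h"] by simp
      also have "(x + t *\<^sub>R h) - (x - t *\<^sub>R h) = 2 *\<^sub>R (t *\<^sub>R h)"
        by (simp flip: scaleR_left_distrib)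
      also have "B b * norm (2 *\<^sub>R (t *\<^sub>R h)) powr \<gamma> \<le> B b * (2 * norm h) powr \<gamma>"
        using B(1)[OF b] nt \<open>0 \<le> \<gamma>\<close> by (intro mult_left_mono powr_mono2) auto
      finally show "\<bar>(h \<bullet> b) * (partial_deriv b f (x + t *\<^sub>R h) - partial_deriv b f (x + t *\<^sub>R (- h)))\<bar>
          \<le> norm h * (B b * (2 * norm h) powr \<gamma>)"
        unfolding abs_mult by (intro mult_mono) (auto simp: Basis_le_norm b)
    qed
    also have "\<dots> = ?C * norm h powr (1 + \<gamma>)"
      by (simp add: powr_add powr_mult mult_ac flip: sum_distrib_left sum_distrib_right)
    finally show ?thesis unfolding sd by simp
  qed
  then show "\<exists>C\<ge>0. \<forall>x h. norm x \<le> r \<longrightarrow> norm h \<le> 1 \<longrightarrow> \<bar>second_diff f x h\<bar> \<le> C * norm h powr (1 + \<gamma>)"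
    using B(1) by (intro exI[of _ ?C]) (auto intro!: mult_nonneg_nonneg sum_nonneg)
qed

text \<open>The Hoelder condition concerns derivatives of top order only, so it is used directly
  just for j = 0. For j > 0 the additional derivative makes f (if \<alpha> < 1) or its gradient (if
  \<alpha> \<ge> 1) locally Lipschitz, which gives \<beta> = 1 or \<beta> = 2, larger than \<alpha>
  in each case.\<close>

lemma C_k_holder_imp_second_diff_loc:
  fixes f :: "'a::euclidean_space \<Rightarrow> real"
  assumes f: "C_k_holder_loc (j + nat \<lfloor>\<alpha>\<rfloor>) (frac \<alpha> + \<epsilon>) f"
    and \<alpha>: "0 < \<alpha>" "\<alpha> < 2" "0 < \<epsilon>"
  shows "\<exists>\<beta>>\<alpha>. second_diff_loc \<beta> f"
proof (cases "\<alpha> < 1")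
  case True
  then have fl: "\<lfloor>\<alpha>\<rfloor> = 0" using \<alpha> by linarith
  have fr: "frac \<alpha> = \<alpha>" using fl by (simp add: frac_def)
  show ?thesis
  proof (cases j)
    case 0
    then have "holder_loc (\<alpha> + \<epsilon>) (foldr partial_deriv [] f)"
      using f fl fr unfolding C_k_holder_loc_def by auto
    then show ?thesis using holder_imp_second_diff_loc \<alpha> by (intro exI[of _ "\<alpha> + \<epsilon>"]) auto
  next
    case (Suc k)
    then have "C_k (Suc k) f" using f fl by (simp add: C_k_holder_loc_def)
    then show ?thesis using holder_imp_second_diff_loc[OF C1_imp_holder_loc_1] True by blast
  qed
next
  case False
  then have fl: "\<lfloor>\<alpha>\<rfloor> = 1" using \<alpha> by linarith
  have fr: "frac \<alpha> = \<alpha> - 1" using fl by (simp add: frac_def)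
  have C: "C_k (Suc j) f" using f fl by (simp add: C_k_holder_loc_def)
  then have diff: "\<And>x. f differentiable (at x)" by simp
  show ?thesis
  proof (cases j)
    case 0
    have "holder_loc (\<alpha> - 1 + \<epsilon>) (partial_deriv b f)" if "b \<in> Basis" for b
    proof -
      have "holder_loc (\<alpha> - 1 + \<epsilon>) (foldr partial_deriv [b] f)"
        using f fl fr 0 that unfolding C_k_holder_loc_def by (auto simp del: foldr.simps)
      then show ?thesis by simp
    qed
    from holder_gradient_imp_second_diff_loc[OF diff this]
    have "second_diff_loc (1 + (\<alpha> - 1 + \<epsilon>)) f" using False \<alpha> by auto
    then show ?thesis using \<alpha> by (intro exI[of _ "1 + (\<alpha> - 1 + \<epsilon>)"]) auto
  next
    case (Suc k)
    have "holder_loc 1 (partial_deriv b f)" if "b \<in> Basis" for b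
      using C unfolding Suc C_k.simps(2)[of "Suc k"] using that C1_imp_holder_loc_1 by blast
    from holder_gradient_imp_second_diff_loc[OF diff this]
    have "second_diff_loc (1 + 1) f" by auto
    then show ?thesis using \<alpha> by (intro exI[of _ "1 + 1"]) auto
  qed
qed

section \<open>Regularity of singular and smooth convolutions\<close>

lemma sum_inner_Basis:
  fixes b :: "'a::euclidean_space"
  assumes "b \<in> Basis"
  shows "(\<Sum>c\<in>Basis. (b \<bullet> c) * F c) = (F b :: real)"
proof -
  have "(\<Sum>c\<in>Basis. (b \<bullet> c) * F c) = (\<Sum>c\<in>Basis. if b = c then F c else 0)"
    using assms by (intro sum.cong) (auto simp: inner_Basis)
  then show ?thesis using assms by simp
qed

lemma borel_measurable_second_diff:
  assumes "continuous_on UNIV f"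
  shows "second_diff f x \<in> borel_measurable borel"
  unfolding second_diff_def[abs_def]
  by (intro borel_measurable_continuous_onI continuous_intros continuous_on_compose2[OF assms]) auto

text \<open>A kernel as singular as |h|^(-n-\<alpha>) is integrable near 0 only against functions of
  order |h|^\<beta> with \<beta> > \<alpha>, so it acts on second differences and not by
  convolution.\<close>

definition near_op :: "('a::euclidean_space \<Rightarrow> real) \<Rightarrow> ('a \<Rightarrow> real) \<Rightarrow> 'a \<Rightarrow> real" where
  "near_op K f x = (LBINT h. second_diff f x h * K h)"

text \<open>Since \<open>0 powr a = 0\<close>, the size bound at h = 0 forces
  \<open>K 0 = 0\<close>.\<close>

definition near_kernel :: "real \<Rightarrow> ('a::euclidean_space \<Rightarrow> real) \<Rightarrow> bool" where
  "near_kernel \<alpha> K \<longleftrightarrow> K \<in> borel_measurable borel \<and> (\<forall>h. 1 \<le> norm h \<longrightarrow> K h = 0) \<and>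
     (\<exists>C\<ge>0. \<forall>h. \<bar>K h\<bar> \<le> C * norm h powr - (real DIM('a) + \<alpha>))"

lemma near_kernel_integrable:
  fixes K :: "'a::euclidean_space \<Rightarrow> real"
  assumes K: "near_kernel \<alpha> K" and "\<alpha> < \<beta>"
  shows "integrable lborel (\<lambda>h. norm h powr \<beta> * \<bar>K h\<bar>)"
proof -
  obtain C where C: "0 \<le> C" "\<And>h. \<bar>K h\<bar> \<le> C * norm h powr - (real DIM('a) + \<alpha>)"
    using K unfolding near_kernel_def by blast
  have [measurable]: "K \<in> borel_measurable borel" using K by (simp add: near_kernel_def)
  show ?thesis
  proof (rule Bochner_Integration.integrable_bound)
    show "integrable lborel (\<lambda>h::'a. C * (indicator {h. norm h < 1} h * norm h powr ((\<beta> - \<alpha>) - real DIM('a))))"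
      using assms(2) by (intro integrable_mult_right integrable_norm_powr_inside) auto
    have "norm (norm h powr \<beta> * \<bar>K h\<bar>)
        \<le> norm (C * (indicator {h. norm h < 1} h * norm h powr ((\<beta> - \<alpha>) - real DIM('a))))" for h
    proof (cases "1 \<le> norm h")
      case True
      then show ?thesis using K C(1) by (auto simp: near_kernel_def)
    next
      case False
      have "norm h powr \<beta> * \<bar>K h\<bar> \<le> norm h powr \<beta> * (C * norm h powr - (real DIM('a) + \<alpha>))"
        by (intro mult_left_mono C) auto
      also have "\<dots> = C * norm h powr ((\<beta> - \<alpha>) - real DIM('a))"
        by (simp add: algebra_simps flip: powr_add)
      finally show ?thesis using False C(1) by simp
    qed
    then show "AE h in lborel. norm (norm h powr \<beta> * \<bar>K h\<bar>)
        \<le> norm (C * (indicator {h. norm h < 1} h * norm h powr ((\<beta> - \<alpha>) - real DIM('a))))"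
      by blast
  qed simp
qed

lemma near_bound:
  assumes K: "near_kernel \<alpha> K"
    and C: "\<And>h. norm h \<le> 1 \<Longrightarrow> \<bar>second_diff f x h\<bar> \<le> C * norm h powr \<beta>"
  shows "\<bar>second_diff f x h * K h\<bar> \<le> C * (norm h powr \<beta> * \<bar>K h\<bar>)"
proof (cases "1 \<le> norm h")
  case False
  then show ?thesis using C[of h] by (simp add: abs_mult mult_right_mono flip: mult.assoc)
qed (use K in \<open>auto simp: near_kernel_def\<close>)

lemma near_integrable:
  fixes f :: "'a::euclidean_space \<Rightarrow> real"
  assumes K: "near_kernel \<alpha> K" and f: "continuous_on UNIV f" "second_diff_loc \<beta> f" and "\<alpha> < \<beta>"
  shows "integrable lborel (\<lambda>h. second_diff f x h * K h)"
proof -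
  obtain C where C: "0 \<le> C" "\<And>h. norm h \<le> 1 \<Longrightarrow> \<bar>second_diff f x h\<bar> \<le> C * norm h powr \<beta>"
    using f(2) unfolding second_diff_loc_def by blast
  have [measurable]: "K \<in> borel_measurable borel" "second_diff f x \<in> borel_measurable borel"
    using K borel_measurable_second_diff[OF f(1)] by (simp_all add: near_kernel_def)
  show ?thesis
  proof (rule Bochner_Integration.integrable_bound)
    show "integrable lborel (\<lambda>h. C * (norm h powr \<beta> * \<bar>K h\<bar>))"
      by (intro integrable_mult_right near_kernel_integrable[OF K assms(4)])
    show "AE h in lborel. norm (second_diff f x h * K h) \<le> norm (C * (norm h powr \<beta> * \<bar>K h\<bar>))"
      using near_bound[OF K C(2)] C(1) by (auto simp: abs_mult)
  qed simp
qed

lemma near_op_continuous: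
  fixes f :: "'a::euclidean_space \<Rightarrow> real"
  assumes K: "near_kernel \<alpha> K" and f: "continuous_on UNIV f" "second_diff_loc \<beta> f" and "\<alpha> < \<beta>"
  shows "continuous_on UNIV (near_op K f)"
proof (rule continuous_at_imp_continuous_on, rule ballI)
  fix x0 :: 'a
  obtain C where C: "\<And>x h. norm x \<le> norm x0 + 1 \<Longrightarrow> norm h \<le> 1 \<Longrightarrow> \<bar>second_diff f x h\<bar> \<le> C * norm h powr \<beta>"
    using f(2) unfolding second_diff_loc_def by metis
  show "isCont (near_op K f) x0"
    unfolding near_op_def[abs_def]
  proof (rule isCont_integral_dominated[where r=1 and B="\<lambda>h. C * (norm h powr \<beta> * \<bar>K h\<bar>)"])
    show "integrable lborel (\<lambda>h. C * (norm h powr \<beta> * \<bar>K h\<bar>))"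
      by (intro integrable_mult_right near_kernel_integrable[OF K assms(4)])
    show "(\<lambda>h. second_diff f x h * K h) \<in> borel_measurable lborel" for x
      using borel_measurable_integrable[OF near_integrable[OF assms]] .
    show "isCont (\<lambda>x. second_diff f x h * K h) x0" for h
    proof -
      have c: "isCont (\<lambda>x. f (x + c)) x0" for c
      proof (rule isCont_o2[where g=f])
        show "isCont f (x0 + c)" using f(1) by (simp add: continuous_on_eq_continuous_at)
      qed (intro continuous_intros)
      have "isCont (\<lambda>x. (2 * f (x + 0) - f (x + h) - f (x + (- h))) * K h) x0"
        by (intro continuous_mult_right continuous_diff continuous_mult_left c)
      then show ?thesis by (simp add: second_diff_def)
    qed
    show "\<bar>second_diff f x h * K h\<bar> \<le> C * (norm h powr \<beta> * \<bar>K h\<bar>)" if "x \<in> ball x0 1" for x h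
    proof (rule near_bound[OF K C])
      show "norm x \<le> norm x0 + 1"
        using that norm_triangle_sub[of x x0] by (simp add: dist_norm norm_minus_commute)
    qed
  qed simp
qed

text \<open>The operator commutes with translations, so differentiation in x passes to f. Each
  partial derivative may come with its own exponent \<beta>' b > \<alpha>; the dominating function
  is the sum of the resulting bounds.\<close>

lemma near_op_has_derivative:
  fixes f :: "'a::euclidean_space \<Rightarrow> real"
  assumes K: "near_kernel \<alpha> K" and f: "C_k (Suc k) f" "second_diff_loc \<beta> f" "\<alpha> < \<beta>"
    and Df: "\<And>b. b \<in> Basis \<Longrightarrow> \<exists>\<beta>>\<alpha>. second_diff_loc \<beta> (partial_deriv b f)"
  shows "(near_op K f has_derivative
           (\<lambda>v. LBINT h. (\<Sum>b\<in>Basis. (v \<bullet> b) * second_diff (partial_deriv b f) x0 h) * K h)) (at x0)"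
proof -
  have cont: "continuous_on UNIV (partial_deriv b f)" if "b \<in> Basis" for b
    using f(1) that C_k_continuous by auto
  obtain \<beta>' where \<beta>': "\<And>b. b \<in> Basis \<Longrightarrow> \<alpha> < \<beta>' b \<and> second_diff_loc (\<beta>' b) (partial_deriv b f)"
    using Df by metis
  have "\<forall>b\<in>Basis. \<exists>C\<ge>0. \<forall>x h. norm x \<le> norm x0 + 1 \<longrightarrow> norm h \<le> 1 \<longrightarrow>
      \<bar>second_diff (partial_deriv b f) x h\<bar> \<le> C * norm h powr \<beta>' b"
    using \<beta>' unfolding second_diff_loc_def by blast
  then obtain C where C: "\<And>b. b \<in> Basis \<Longrightarrow> 0 \<le> C b"
    "\<And>b x h. b \<in> Basis \<Longrightarrow> norm x \<le> norm x0 + 1 \<Longrightarrow> norm h \<le> 1 \<Longrightarrow>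
      \<bar>second_diff (partial_deriv b f) x h\<bar> \<le> C b * norm h powr \<beta>' b"
    by metis
  show ?thesis
    unfolding near_op_def[abs_def]
  proof (rule has_derivative_integral_dominated[where r=1 and
        D="\<lambda>x h v. (\<Sum>b\<in>Basis. (v \<bullet> b) * second_diff (partial_deriv b f) x h) * K h" and
        B="\<lambda>h. \<Sum>b\<in>Basis. C b * (norm h powr \<beta>' b * \<bar>K h\<bar>)"])
    show "integrable lborel (\<lambda>h. \<Sum>b\<in>Basis. C b * (norm h powr \<beta>' b * \<bar>K h\<bar>))"
      using \<beta>' by (intro Bochner_Integration.integrable_sum integrable_mult_right near_kernel_integrable[OF K]) auto
    show "integrable lborel (\<lambda>h. second_diff f x h * K h)" for x
      by (rule near_integrable[OF K C_k_continuous[OF f(1)] f(2,3)])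
    show "((\<lambda>x. second_diff f x h * K h) has_derivative
        (\<lambda>v. (\<Sum>b\<in>Basis. (v \<bullet> b) * second_diff (partial_deriv b f) x h) * K h)) (at x)" for x h
    proof -
      have df: "(f has_derivative (\<lambda>v. \<Sum>b\<in>Basis. (v \<bullet> b) * partial_deriv b f y)) (at y)" for y
        using f(1) by (intro has_derivative_partial_derivs) auto
      have d: "((\<lambda>x. f (x + c)) has_derivative (\<lambda>v. \<Sum>b\<in>Basis. (v \<bullet> b) * partial_deriv b f (x + c))) (at x)" for c
        by (rule has_derivative_compose[where f="\<lambda>x. x + c" and g=f, OF _ df])
           (auto intro!: derivative_eq_intros)
      have "((\<lambda>x. 2 * f x - f (x + h) - f (x + (- h))) has_derivative
        (\<lambda>v. 2 * (\<Sum>b\<in>Basis. (v \<bullet> b) * partial_deriv b f x)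
            - (\<Sum>b\<in>Basis. (v \<bullet> b) * partial_deriv b f (x + h))
            - (\<Sum>b\<in>Basis. (v \<bullet> b) * partial_deriv b f (x + (- h))))) (at x)"
        by (intro has_derivative_diff has_derivative_mult_right df d)
      moreover have "(\<lambda>v. 2 * (\<Sum>b\<in>Basis. (v \<bullet> b) * partial_deriv b f x)
            - (\<Sum>b\<in>Basis. (v \<bullet> b) * partial_deriv b f (x + h))
            - (\<Sum>b\<in>Basis. (v \<bullet> b) * partial_deriv b f (x + (- h))))
         = (\<lambda>v. \<Sum>b\<in>Basis. (v \<bullet> b) * second_diff (partial_deriv b f) x h)"
        by (simp add: second_diff_def sum_subtractf sum_distrib_left right_diff_distrib mult_ac)
      ultimately show ?thesis
        by (auto simp: second_diff_def[of f] intro: has_derivative_mult_left)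
    qed
    fix b :: 'a assume b: "b \<in> Basis"
    have [measurable]: "second_diff (partial_deriv b f) x0 \<in> borel_measurable borel"
      "K \<in> borel_measurable borel"
      using borel_measurable_second_diff[OF cont[OF b]] K by (simp_all add: near_kernel_def)
    show "(\<lambda>h. (\<Sum>c\<in>Basis. (b \<bullet> c) * second_diff (partial_deriv c f) x0 h) * K h) \<in> borel_measurable lborel"
      unfolding sum_inner_Basis[OF b] by simp
    fix x h assume x: "x \<in> ball x0 1"
    have nx: "norm x \<le> norm x0 + 1"
      using x norm_triangle_sub[of x x0] by (simp add: dist_norm norm_minus_commute)
    have "\<bar>second_diff (partial_deriv b f) x h * K h\<bar> \<le> C b * (norm h powr \<beta>' b * \<bar>K h\<bar>)"
      by (rule near_bound[OF K C(2)[OF b nx]])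
    also have "\<dots> \<le> (\<Sum>b\<in>Basis. C b * (norm h powr \<beta>' b * \<bar>K h\<bar>))"
      using C(1) by (intro member_le_sum b) auto
    finally show "\<bar>(\<Sum>c\<in>Basis. (b \<bullet> c) * second_diff (partial_deriv c f) x h) * K h\<bar>
        \<le> (\<Sum>b\<in>Basis. C b * (norm h powr \<beta>' b * \<bar>K h\<bar>))"
      unfolding sum_inner_Basis[OF b] .
  qed simp
qed

text \<open>Each derivative commutes with \<open>near_op K\<close> and uses up one order of the
  Hoelder class. The induction ends at the class with j = 0, where second differences still beat the
  singularity and give continuity.\<close>

lemma C_k_near_op:
  fixes f :: "'a::euclidean_space \<Rightarrow> real"
  assumes K: "near_kernel \<alpha> K" and \<alpha>: "0 < \<alpha>" "\<alpha> < 2" "0 < \<epsilon>"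
    and f: "C_k_holder_loc (j + nat \<lfloor>\<alpha>\<rfloor>) (frac \<alpha> + \<epsilon>) f"
  shows "C_k j (near_op K f)"
  using f
proof (induction j arbitrary: f)
  case 0
  then obtain \<beta> where "\<alpha> < \<beta>" "second_diff_loc \<beta> f"
    using C_k_holder_imp_second_diff_loc \<alpha> by blast
  moreover have "continuous_on UNIV f"
    using 0 C_k_continuous by (auto simp: C_k_holder_loc_def)
  ultimately show ?case using near_op_continuous[OF K] by simp
next
  case (Suc j)
  obtain \<beta> where \<beta>: "\<alpha> < \<beta>" "second_diff_loc \<beta> f"
    using C_k_holder_imp_second_diff_loc[OF Suc.prems \<alpha>] by blast
  have P: "C_k_holder_loc (j + nat \<lfloor>\<alpha>\<rfloor>) (frac \<alpha> + \<epsilon>) (partial_deriv b f)" if "b \<in> Basis" for b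
    using C_k_holder_loc_Suc_partial[OF _ that] Suc.prems by simp
  have C: "C_k (Suc (j + nat \<lfloor>\<alpha>\<rfloor>)) f" using Suc.prems by (simp add: C_k_holder_loc_def)
  note D = near_op_has_derivative[OF K C \<beta>(2,1) C_k_holder_imp_second_diff_loc[OF P \<alpha>]]
  have "partial_deriv b (near_op K f) = near_op K (partial_deriv b f)" if "b \<in> Basis" for b
  proof
    fix x
    show "partial_deriv b (near_op K f) x = near_op K (partial_deriv b f) x"
      using partial_deriv_eq[OF D, of b x]
      by (simp only: sum_inner_Basis[OF that] near_op_def[of K "partial_deriv b f"])
  qed
  moreover have "near_op K f differentiable (at x)" for x
    using D differentiableI by blast
  ultimately show ?case using Suc.IH[OF P] by simp
qed

section \<open>Convolution with smooth kernels of prescribed decay\<close>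

primrec smooth_kernel :: "nat \<Rightarrow> real \<Rightarrow> ('a::euclidean_space \<Rightarrow> real) \<Rightarrow> bool" where
  "smooth_kernel 0 s k \<longleftrightarrow> continuous_on UNIV k \<and> (\<exists>C\<ge>0. \<forall>h. \<bar>k h\<bar> \<le> C * (1 + norm h) powr - s)"
| "smooth_kernel (Suc j) s k \<longleftrightarrow> (\<exists>C\<ge>0. \<forall>h. \<bar>k h\<bar> \<le> C * (1 + norm h) powr - s) \<and>
     (\<forall>x. k differentiable (at x)) \<and> (\<forall>b\<in>Basis. smooth_kernel j s (partial_deriv b k))"

lemma smooth_kernel_bound:
  assumes "smooth_kernel j s k"
  obtains C where "0 \<le> C" "\<And>h. \<bar>k h\<bar> \<le> C * (1 + norm h) powr - s"
  using assms by (cases j) auto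

lemma smooth_kernel_continuous: "smooth_kernel j s k \<Longrightarrow> continuous_on UNIV k"
  by (cases j) (auto intro!: continuous_at_imp_continuous_on differentiable_imp_continuous_within)

lemma smooth_kernel_Suc_imp: "smooth_kernel (Suc j) s k \<Longrightarrow> smooth_kernel j s k"
proof (induction j arbitrary: k)
  case 0
  then show ?case using smooth_kernel_continuous[of "Suc 0"] by (auto simp del: smooth_kernel.simps(2) elim: smooth_kernel_bound)
next
  case (Suc j)
  then show ?case unfolding smooth_kernel.simps(2)[of "Suc j"] smooth_kernel.simps(2)[of j] by blast
qed

lemma smooth_kernel_add:
  fixes k l :: "'a::euclidean_space \<Rightarrow> real"
  assumes "smooth_kernel j s k" "smooth_kernel j s l"
  shows "smooth_kernel j s (\<lambda>x. k x + l x)"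
  using assms
proof (induction j arbitrary: k l)
  have B: "\<exists>C\<ge>0. \<forall>h. \<bar>k h + l h\<bar> \<le> C * (1 + norm h) powr - s"
    if k: "smooth_kernel j s k" and l: "smooth_kernel j s l" for j and k l :: "'a \<Rightarrow> real"
  proof -
    obtain C D where "0 \<le> C" "0 \<le> D" "\<And>h. \<bar>k h\<bar> \<le> C * (1 + norm h) powr - s" "\<And>h. \<bar>l h\<bar> \<le> D * (1 + norm h) powr - s"
      using k l by (metis smooth_kernel_bound)
    then show ?thesis
      by (intro exI[of _ "C + D"]) (auto simp: distrib_right intro: order_trans[OF abs_triangle_ineq add_mono])
  qed
  { case (0 k l)
    then show ?case using B[OF 0] by (auto intro: continuous_on_add) }
  { case (Suc j k l)
    have "partial_deriv b (\<lambda>x. k x + l x) = (\<lambda>x. partial_deriv b k x + partial_deriv b l x)" for b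
      using Suc.prems by (auto simp: partial_deriv_add)
    with Suc B[OF Suc.prems] show ?case by auto }
qed

lemma smooth_kernel_cmult:
  fixes k :: "'a::euclidean_space \<Rightarrow> real"
  assumes "smooth_kernel j s k"
  shows "smooth_kernel j s (\<lambda>x. c * k x)"
  using assms
proof (induction j arbitrary: k)
  have B: "\<exists>C\<ge>0. \<forall>h. \<bar>c * k h\<bar> \<le> C * (1 + norm h) powr - s"
    if k: "smooth_kernel j s k" for j and k :: "'a \<Rightarrow> real"
  proof -
    obtain C where "0 \<le> C" "\<And>h. \<bar>k h\<bar> \<le> C * (1 + norm h) powr - s"
      using k by (metis smooth_kernel_bound)
    then show ?thesis
      by (intro exI[of _ "\<bar>c\<bar> * C"]) (auto simp: abs_mult mult.assoc intro: mult_left_mono)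
  qed
  { case (0 k)
    then show ?case using B[OF 0] by (auto intro!: continuous_intros) }
  { case (Suc j k)
    have "partial_deriv b (\<lambda>x. c * k x) = (\<lambda>x. c * partial_deriv b k x)" for b
      using Suc.prems by (auto simp: partial_deriv_cmult)
    with Suc B[OF Suc.prems] show ?case by (auto intro!: derivative_intros) }
qed

lemma kernel_bound_mono:
  fixes k :: "'a::euclidean_space \<Rightarrow> real"
  assumes "0 \<le> C" "\<And>h. \<bar>k h\<bar> \<le> C * (1 + norm h) powr - s'" "s \<le> s'"
  shows "\<bar>k h\<bar> \<le> C * (1 + norm h) powr - s"
  using assms(2)[of h] by (rule order_trans) (use assms in \<open>auto intro!: mult_left_mono powr_mono\<close>)

lemma smooth_kernel_mono:
  assumes "smooth_kernel j s' k" "s \<le> s'"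
  shows "smooth_kernel j s k"
  using assms(1)
proof (induction j arbitrary: k)
  case 0
  then show ?case using kernel_bound_mono[OF _ _ assms(2)] by (auto elim!: smooth_kernel_bound)
next
  case (Suc j)
  then show ?case using kernel_bound_mono[OF _ _ assms(2)] unfolding smooth_kernel.simps(2) by blast
qed

text \<open>The factor |x| costs one power of decay. In the product rule the term without a
  coordinate factor has decay s + 1 and is weakened to s.\<close>

lemma smooth_kernel_coordinate:
  fixes k :: "'a::euclidean_space \<Rightarrow> real"
  assumes "smooth_kernel j (s + 1) k" "b \<in> Basis"
  shows "smooth_kernel j s (\<lambda>x. (x \<bullet> b) * k x)"
  using assms(1)
proof (induction j arbitrary: k)
  have B: "\<exists>C\<ge>0. \<forall>h. \<bar>(h \<bullet> b) * k h\<bar> \<le> C * (1 + norm h) powr - s" if k: "smooth_kernel j (s + 1) k" for j k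
  proof -
    obtain C where C: "0 \<le> C" "\<And>h. \<bar>k h\<bar> \<le> C * (1 + norm h) powr - (s + 1)"
      using smooth_kernel_bound[OF k] by metis
    have "\<bar>(h \<bullet> b) * k h\<bar> \<le> C * (1 + norm h) powr - s" for h
    proof -
      have "\<bar>h \<bullet> b\<bar> \<le> 1 + norm h" using Basis_le_norm[OF assms(2), of h] by simp
      then have "\<bar>(h \<bullet> b) * k h\<bar> \<le> (1 + norm h) * (C * (1 + norm h) powr - (s + 1))"
        unfolding abs_mult using C by (intro mult_mono) auto
      also have "\<dots> = C * ((1 + norm h) powr 1 * (1 + norm h) powr - (s + 1))"
        by simp
      also have "\<dots> = C * (1 + norm h) powr - s"
        unfolding powr_add[symmetric] by simp
      finally show ?thesis .
    qed
    then show ?thesis using C(1) by blast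
  qed
  { case (0 k)
    then show ?case using B[OF 0] by (auto intro!: continuous_intros) }
  { case (Suc j k)
    have k: "k differentiable (at x)" for x using Suc.prems by simp
    have D: "((\<lambda>x. (x \<bullet> b) * k x) has_derivative
       (\<lambda>v. (x \<bullet> b) * (\<Sum>c\<in>Basis. (v \<bullet> c) * partial_deriv c k x) + (v \<bullet> b) * k x)) (at x)" for x
      by (rule has_derivative_mult[OF has_derivative_inner_left[OF has_derivative_ident] has_derivative_partial_derivs[OF k]])
    have pd: "partial_deriv c (\<lambda>x. (x \<bullet> b) * k x) = (\<lambda>x. (x \<bullet> b) * partial_deriv c k x + (c \<bullet> b) * k x)"
      if "c \<in> Basis" for c
      by (rule ext) (simp add: partial_deriv_eq[OF D] sum_inner_Basis[OF that])
    have "smooth_kernel j s (\<lambda>x. (x \<bullet> b) * partial_deriv c k x + (c \<bullet> b) * k x)" if "c \<in> Basis" for c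
      using Suc that smooth_kernel_mono[OF smooth_kernel_Suc_imp[OF Suc.prems]]
      by (intro smooth_kernel_add smooth_kernel_cmult Suc.IH) auto
    moreover have "(\<lambda>x. (x \<bullet> b) * k x) differentiable (at x)" for x
      using D differentiableI by blast
    ultimately show ?case using B[OF Suc.prems] by (simp add: pd) }
qed

text \<open>Peetre's inequality, from 1 + |y| \<le> (1 + |x|) (1 + |x - y|). It makes the translated
  weight comparable to the weight at the origin, uniformly for x in a ball, and so provides the
  dominating functions for convolutions.\<close>

lemma peetre_powr:
  fixes x y :: "'a::euclidean_space"
  assumes "0 \<le> s"
  shows "(1 + norm (x - y)) powr - s \<le> (1 + norm x) powr s * (1 + norm y) powr - s"
proof -
  have "1 + norm y \<le> 1 + norm x + norm (x - y)" using norm_triangle_sub[of y x] by (simp add: norm_minus_commute)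
  also have "\<dots> \<le> (1 + norm x) * (1 + norm (x - y))" by (simp add: algebra_simps)
  finally have "(1 + norm y) powr s \<le> ((1 + norm x) * (1 + norm (x - y))) powr s"
    using assms by (intro powr_mono2) auto
  also have "\<dots> = (1 + norm x) powr s * (1 + norm (x - y)) powr s"
    by (simp add: powr_mult)
  finally have *: "(1 + norm y) powr s \<le> (1 + norm x) powr s * (1 + norm (x - y)) powr s" .
  have "0 < 1 + norm (x - y)" "0 < 1 + norm y" by (simp_all add: add_pos_nonneg)
  then have "0 < (1 + norm (x - y)) powr s" "0 < (1 + norm y) powr s" by simp_all
  with * show ?thesis by (simp add: powr_minus divide_simps mult.commute)
qed

lemma far_integrable:
  fixes u k :: "'a::euclidean_space \<Rightarrow> real"
  assumes u: "u \<in> borel_measurable borel" "integrable lborel (\<lambda>y. \<bar>u y\<bar> * (1 + norm y) powr - s)" and s: "0 \<le> s"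
    and k: "continuous_on UNIV k" "\<And>h. \<bar>k h\<bar> \<le> C * (1 + norm h) powr - s" "0 \<le> C"
  shows "integrable lborel (\<lambda>y. u y * k (x - y))"
    and "norm x \<le> r \<Longrightarrow> \<bar>u y * k (x - y)\<bar> \<le> C * (1 + r) powr s * (\<bar>u y\<bar> * (1 + norm y) powr - s)"
proof -
  have bound: "\<bar>u y * k (x - y)\<bar> \<le> C * (1 + r) powr s * (\<bar>u y\<bar> * (1 + norm y) powr - s)" if "norm x \<le> r" for y r
  proof -
    have "\<bar>k (x - y)\<bar> \<le> C * ((1 + norm x) powr s * (1 + norm y) powr - s)"
      using k(2)[of "x - y"] by (rule order_trans) (intro mult_left_mono peetre_powr s k)
    also have "\<dots> \<le> C * ((1 + r) powr s * (1 + norm y) powr - s)"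
      using that s k(3) by (intro mult_left_mono mult_right_mono powr_mono2) auto
    finally have "\<bar>k (x - y)\<bar> \<le> C * ((1 + r) powr s * (1 + norm y) powr - s)" .
    then have "\<bar>u y\<bar> * \<bar>k (x - y)\<bar> \<le> \<bar>u y\<bar> * (C * ((1 + r) powr s * (1 + norm y) powr - s))"
      by (intro mult_left_mono) auto
    then show ?thesis by (simp add: abs_mult mult_ac)
  qed
  then show "norm x \<le> r \<Longrightarrow> \<bar>u y * k (x - y)\<bar> \<le> C * (1 + r) powr s * (\<bar>u y\<bar> * (1 + norm y) powr - s)" .
  have [measurable]: "(\<lambda>y. k (x - y)) \<in> borel_measurable borel"
    by (intro borel_measurable_continuous_onI continuous_on_compose2[OF k(1)] continuous_intros) auto
  show "integrable lborel (\<lambda>y. u y * k (x - y))"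
    by (rule Bochner_Integration.integrable_bound[OF integrable_mult_right[OF u(2), of "C * (1 + norm x) powr s"]])
       (use bound[OF order_refl] k(3) u(1) in \<open>auto simp: abs_mult\<close>)
qed

text \<open>All derivatives fall on the kernel, since u itself need not be differentiable here. This
  is why \<open>smooth_kernel\<close> asks for the same decay s at every order: s is the order of
  the weight under which u is integrable.\<close>

lemma C_k_convolution:
  fixes u k :: "'a::euclidean_space \<Rightarrow> real"
  assumes u: "u \<in> borel_measurable borel" "integrable lborel (\<lambda>y. \<bar>u y\<bar> * (1 + norm y) powr - s)" and s: "0 \<le> s"
    and k: "smooth_kernel j s k"
  shows "C_k j (\<lambda>x. LBINT y. u y * k (x - y))"
  using k
proof (induction j arbitrary: k)
  case (0 k)
  obtain C where C: "0 \<le> C" "\<And>h. \<bar>k h\<bar> \<le> C * (1 + norm h) powr - s"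
    using smooth_kernel_bound[OF 0] by metis
  note fi = far_integrable[OF u s smooth_kernel_continuous[OF 0] C(2,1)]
  have "isCont (\<lambda>x. LBINT y. u y * k (x - y)) x0" for x0
  proof (rule isCont_integral_dominated[where r=1 and B="\<lambda>y. C * (1 + (norm x0 + 1)) powr s * (\<bar>u y\<bar> * (1 + norm y) powr - s)"])
    show "integrable lborel (\<lambda>y. C * (1 + (norm x0 + 1)) powr s * (\<bar>u y\<bar> * (1 + norm y) powr - s))"
      by (intro integrable_mult_right u)
    show "(\<lambda>y. u y * k (x - y)) \<in> borel_measurable lborel" for x
      using borel_measurable_integrable[OF fi(1)] .
    show "isCont (\<lambda>x. u y * k (x - y)) x0" for y
    proof (rule continuous_mult_left, rule isCont_o2[where g=k])
      show "isCont k (x0 - y)"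
        using smooth_kernel_continuous[OF 0] by (simp add: continuous_on_eq_continuous_at)
    qed (intro continuous_intros)
    show "\<bar>u y * k (x - y)\<bar> \<le> C * (1 + (norm x0 + 1)) powr s * (\<bar>u y\<bar> * (1 + norm y) powr - s)"
      if "x \<in> ball x0 1" for x y
    proof (rule fi(2))
      show "norm x \<le> norm x0 + 1"
        using that norm_triangle_sub[of x x0] by (simp add: dist_norm norm_minus_commute)
    qed
  qed simp
  then show ?case by (simp add: continuous_at_imp_continuous_on)
next
  case (Suc j k)
  obtain C where C: "0 \<le> C" "\<And>h. \<bar>k h\<bar> \<le> C * (1 + norm h) powr - s"
    using smooth_kernel_bound[OF Suc.prems] by metis
  have kb: "smooth_kernel j s (partial_deriv b k)" if "b \<in> Basis" for b
    using Suc.prems that by simp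
  have "\<forall>b\<in>Basis. \<exists>C\<ge>0. \<forall>h. \<bar>partial_deriv b k h\<bar> \<le> C * (1 + norm h) powr - s"
    using kb smooth_kernel_bound by metis
  then obtain C' where C': "\<And>b. b \<in> Basis \<Longrightarrow> 0 \<le> C' b"
    "\<And>b h. b \<in> Basis \<Longrightarrow> \<bar>partial_deriv b k h\<bar> \<le> C' b * (1 + norm h) powr - s"
    by metis
  note fi = far_integrable[OF u s smooth_kernel_continuous[OF Suc.prems] C(2,1)]
  note fi' = far_integrable[OF u s smooth_kernel_continuous[OF kb] C'(2,1)]
  have D: "((\<lambda>x. LBINT y. u y * k (x - y)) has_derivative
      (\<lambda>v. LBINT y. u y * (\<Sum>b\<in>Basis. (v \<bullet> b) * partial_deriv b k (x0 - y)))) (at x0)" for x0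
  proof (rule has_derivative_integral_dominated[where r=1 and
        D="\<lambda>x y v. u y * (\<Sum>b\<in>Basis. (v \<bullet> b) * partial_deriv b k (x - y))" and
        B="\<lambda>y. \<Sum>b\<in>Basis. C' b * (1 + (norm x0 + 1)) powr s * (\<bar>u y\<bar> * (1 + norm y) powr - s)"])
    show "integrable lborel (\<lambda>y. \<Sum>b\<in>Basis. C' b * (1 + (norm x0 + 1)) powr s * (\<bar>u y\<bar> * (1 + norm y) powr - s))"
      by (intro Bochner_Integration.integrable_sum integrable_mult_right u)
    show "integrable lborel (\<lambda>y. u y * k (x - y))" for x by (rule fi(1))
    show "((\<lambda>x. u y * k (x - y)) has_derivative
        (\<lambda>v. u y * (\<Sum>b\<in>Basis. (v \<bullet> b) * partial_deriv b k (x - y)))) (at x)" for x y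
    proof (rule has_derivative_mult_right)
      have kd: "k differentiable (at (x - y))" using Suc.prems by simp
      show "((\<lambda>x. k (x - y)) has_derivative (\<lambda>v. \<Sum>b\<in>Basis. (v \<bullet> b) * partial_deriv b k (x - y))) (at x)"
        by (rule has_derivative_compose[where f="\<lambda>x. x - y" and g=k, OF _ has_derivative_partial_derivs[OF kd]])
           (auto intro!: derivative_eq_intros)
    qed
    fix b :: 'a assume b: "b \<in> Basis"
    show "(\<lambda>y. u y * (\<Sum>c\<in>Basis. (b \<bullet> c) * partial_deriv c k (x0 - y))) \<in> borel_measurable lborel"
      unfolding sum_inner_Basis[OF b] using borel_measurable_integrable[OF fi'(1)[OF b b b]] .
    fix x y assume x: "x \<in> ball x0 1"
    have nx: "norm x \<le> norm x0 + 1"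
      using x norm_triangle_sub[of x x0] by (simp add: dist_norm norm_minus_commute)
    have "\<bar>u y * partial_deriv b k (x - y)\<bar> \<le> C' b * (1 + (norm x0 + 1)) powr s * (\<bar>u y\<bar> * (1 + norm y) powr - s)"
      by (rule fi'(2)[OF b b b nx])
    also have "\<dots> \<le> (\<Sum>b\<in>Basis. C' b * (1 + (norm x0 + 1)) powr s * (\<bar>u y\<bar> * (1 + norm y) powr - s))"
      using C'(1) by (intro member_le_sum b) auto
    finally show "\<bar>u y * (\<Sum>c\<in>Basis. (b \<bullet> c) * partial_deriv c k (x - y))\<bar>
        \<le> (\<Sum>b\<in>Basis. C' b * (1 + (norm x0 + 1)) powr s * (\<bar>u y\<bar> * (1 + norm y) powr - s))"
      unfolding sum_inner_Basis[OF b] .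
  qed simp
  have "partial_deriv b (\<lambda>x. LBINT y. u y * k (x - y)) = (\<lambda>x. LBINT y. u y * partial_deriv b k (x - y))"
    if "b \<in> Basis" for b
    by (rule ext) (simp only: partial_deriv_eq[OF D] sum_inner_Basis[OF that])
  moreover have "(\<lambda>x. LBINT y. u y * k (x - y)) differentiable (at x)" for x
    using D differentiableI by blast
  ultimately show ?case using Suc.IH[OF kb] by simp
qed

section \<open>The fractional Laplacian as an integral of second differences\<close>

text \<open>Both difference quotients tend to D, however the points near x are distributed between
  the two branches, so \<open>P\<close> may be arbitrary. It serves at the junction of two
  formulas.\<close>

lemma has_field_derivative_If_eq:
  fixes f g :: "real \<Rightarrow> real"
  assumes "(f has_real_derivative D) (at x)" "(g has_real_derivative D) (at x)" "f x = g x"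
  shows "((\<lambda>t. if P t then f t else g t) has_real_derivative D) (at x)"
proof -
  have "((\<lambda>y. if P y then (f y - f x) / (y - x) else (g y - g x) / (y - x)) \<longlongrightarrow> D) (at x)"
    using assms(1,2) unfolding has_field_derivative_iff
    by (intro filterlim_If) (auto intro: tendsto_mono[OF inf_le1])
  then show ?thesis
    unfolding has_field_derivative_iff
    by (rule tendsto_cong[THEN iffD1, rotated]) (use assms(3) in \<open>auto intro!: always_eventually\<close>)
qed

text \<open>Below \<open>1\<close> the power \<open>t\<^sup>-\<^sup>p\<close> is replaced by its Taylor polynomial at \<open>1\<close>, so that the family is closed
  under differentiation and \<open>glued_powr p N (|h|\<^sup>2)\<close> is a \<open>C\<^sup>N\<close> kernel on \<open>\<real>\<^sup>n\<close> equal to \<open>|h|\<^sup>-\<^sup>2\<^sup>p\<close> off the unit ball.\<close>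

definition glued_powr :: "real \<Rightarrow> nat \<Rightarrow> real \<Rightarrow> real" where
  "glued_powr p N t = (if 1 \<le> t then t powr - p else (\<Sum>i\<le>N. (- p gchoose i) * (t - 1) ^ i))"

text \<open>The absorption identity (i + 1) (-p gchoose i + 1) = -p (-p - 1 gchoose i) carries over
  to Taylor polynomials the rule that t^(-p) has derivative -p t^(-p-1).\<close>

lemma DERIV_taylor_powr:
  "((\<lambda>t. \<Sum>i\<le>Suc N. (- p gchoose i) * (t - 1) ^ i) has_real_derivative
     - p * (\<Sum>i\<le>N. (- (p + 1) gchoose i) * (t - 1) ^ i)) (at t)"
proof -
  have "((\<lambda>t. \<Sum>i\<le>Suc N. (- p gchoose i) * (t - 1) ^ i) has_real_derivative
     (\<Sum>i\<le>Suc N. (- p gchoose i) * (real i * (t - 1) ^ (i - 1)))) (at t)"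
    by (rule derivative_eq_intros refl | simp add: mult_ac)+
  moreover have "(\<Sum>i\<le>Suc N. (- p gchoose i) * (real i * (t - 1) ^ (i - 1)))
      = (\<Sum>i\<le>N. (- p gchoose Suc i) * (real (Suc i) * (t - 1) ^ i))"
    by (simp add: sum.atMost_Suc_shift del: sum.atMost_Suc of_nat_Suc)
  moreover have "(- p gchoose Suc i) * (real (Suc i) * (t - 1) ^ i) = - p * ((- (p + 1) gchoose i) * (t - 1) ^ i)" for i
    using arg_cong[OF gbinomial_absorption[of i "- p"], of "\<lambda>z. z * (t - 1) ^ i"]
    by (simp add: mult_ac del: of_nat_Suc)
  ultimately show ?thesis by (simp add: sum_distrib_left)
qed

text \<open>The power and its Taylor polynomial obey the same rule: differentiation raises p by one,
  lowers the degree by one and contributes the factor -p. At t = 1 both branches have value 1 and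
  slope -p, so they fit together.\<close>

lemma DERIV_glued_powr:
  "(glued_powr p (Suc N) has_real_derivative - p * glued_powr (p + 1) N t) (at t)"
proof -
  let ?T = "\<lambda>t. \<Sum>i\<le>Suc N. (- p gchoose i) * (t - 1) ^ i"
  have P: "((\<lambda>t. t powr - p) has_real_derivative - p * t powr - (p + 1)) (at t)" if "0 < t"
    using that by (auto intro!: derivative_eq_intros)
  consider "t < 1" | "t = 1" | "1 < t" by linarith
  then show ?thesis
  proof cases
    case 1
    then have "((\<lambda>t. ?T t) has_real_derivative - p * glued_powr (p + 1) N t) (at t)"
      using DERIV_taylor_powr by (simp add: glued_powr_def del: sum.atMost_Suc)
    then show ?thesis
      by (rule has_field_derivative_transform_within_open[of _ _ _ "{..<1}"])
         (use 1 in \<open>auto simp: glued_powr_def simp del: sum.atMost_Suc\<close>)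
  next
    case 2
    have s: "(\<Sum>i\<le>M. (q gchoose i) * (1 - 1) ^ i) = (1::real)" for M q
      by (simp add: power_0_left if_distrib cong: if_cong)
    have "((\<lambda>t. if 1 \<le> t then t powr - p else ?T t) has_real_derivative - p) (at t)"
    proof (rule has_field_derivative_If_eq)
      show "((\<lambda>t. t powr - p) has_real_derivative - p) (at t)" using P 2 by simp
      show "(?T has_real_derivative - p) (at t)"
        using DERIV_taylor_powr[where N=N and p=p and t=1] unfolding 2 s by simp
      show "t powr - p = ?T t" unfolding 2 s by simp
    qed
    moreover have "- p * glued_powr (p + 1) N t = - p" using 2 by (simp add: glued_powr_def)
    moreover have "glued_powr p (Suc N) = (\<lambda>t. if 1 \<le> t then t powr - p else ?T t)"
      by (rule ext) (simp add: glued_powr_def)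
    ultimately show ?thesis by (simp only:)
  next
    case 3
    then have "((\<lambda>t. t powr - p) has_real_derivative - p * glued_powr (p + 1) N t) (at t)"
      using P by (simp add: glued_powr_def)
    then show ?thesis
      by (rule has_field_derivative_transform_within_open[of _ _ _ "{1<..}"])
         (use 3 in \<open>auto simp: glued_powr_def\<close>)
  qed
qed

lemma norm_sq_powr: "(h \<bullet> h) powr - p = norm h powr - (2 * p)" for h :: "'a::euclidean_space"
  by (cases "h = 0") (simp_all add: powr_powr flip: power2_norm_eq_inner powr_numeral)

lemma one_le_inner_self_iff: "1 \<le> h \<bullet> h \<longleftrightarrow> 1 \<le> norm h" for h :: "'a::euclidean_space"
  using abs_square_le_1[of "norm h"] abs_square_eq_1[of "norm h"] power2_norm_eq_inner[of h]
  by (smt (verit) norm_ge_zero one_le_power power_le_one)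

lemma powr_minus_le_weight:
  fixes h :: "'a::real_normed_vector"
  assumes "0 < \<epsilon>" "\<epsilon> \<le> norm h" "0 \<le> s"
  shows "norm h powr - s \<le> (1 + 1 / \<epsilon>) powr s * (1 + norm h) powr - s"
proof -
  have "1 + norm h \<le> (1 + 1 / \<epsilon>) * norm h" using assms by (simp add: field_simps)
  then have "((1 + 1 / \<epsilon>) * norm h) powr - s \<le> (1 + norm h) powr - s"
    using assms by (intro powr_mono2') (auto intro: add_pos_nonneg)
  then have "(1 + 1 / \<epsilon>) powr - s * norm h powr - s \<le> (1 + norm h) powr - s"
    using assms by (subst (asm) powr_mult) auto
  moreover have "inverse a \<le> b * inverse c" if "inverse b * inverse a \<le> inverse c" "0 < a" "0 < b" "0 < c" for a b c :: real
    using that by (simp add: field_simps)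
  moreover have "0 < norm h" "0 < 1 + norm h" "0 < 1 + 1 / \<epsilon>" using assms by (auto intro: add_pos_pos)
  then have "0 < norm h powr s" "0 < (1 + norm h) powr s" "0 < (1 + 1 / \<epsilon>) powr s" by auto
  ultimately show ?thesis unfolding powr_minus by blast
qed

lemma glued_powr_radial_bound:
  assumes "0 < p"
  shows "\<exists>C\<ge>0. \<forall>h::'a::euclidean_space. \<bar>glued_powr p N (h \<bullet> h)\<bar> \<le> C * (1 + norm h) powr - (2 * p)"
proof -
  define A where "A = (\<Sum>i\<le>N. \<bar>- p gchoose i\<bar>)"
  have A: "0 \<le> A" by (simp add: A_def sum_nonneg)
  have "\<bar>glued_powr p N (h \<bullet> h)\<bar> \<le> (1 + A) * 2 powr (2 * p) * (1 + norm h) powr - (2 * p)" for h :: 'a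
  proof (cases "1 \<le> norm h")
    case True
    then have "\<bar>glued_powr p N (h \<bullet> h)\<bar> = norm h powr - (2 * p)"
      by (simp add: glued_powr_def one_le_inner_self_iff norm_sq_powr)
    also have "\<dots> \<le> 2 powr (2 * p) * (1 + norm h) powr - (2 * p)"
      using powr_minus_le_weight[of 1 h "2 * p"] True assms by simp
    also have "\<dots> \<le> (1 + A) * (2 powr (2 * p) * (1 + norm h) powr - (2 * p))"
      using A by (simp add: distrib_right)
    finally show ?thesis by (simp only: mult.assoc)
  next
    case False
    then have hh: "\<not> 1 \<le> h \<bullet> h" by (simp add: one_le_inner_self_iff)
    then have g: "glued_powr p N (h \<bullet> h) = (\<Sum>i\<le>N. (- p gchoose i) * (h \<bullet> h - 1) ^ i)"
      by (simp add: glued_powr_def)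
    have "\<bar>glued_powr p N (h \<bullet> h)\<bar> \<le> (\<Sum>i\<le>N. \<bar>(- p gchoose i) * (h \<bullet> h - 1) ^ i\<bar>)"
      unfolding g by (rule sum_abs)
    also have "\<dots> \<le> A"
      unfolding A_def
    proof (rule sum_mono)
      fix i
      have "\<bar>(h \<bullet> h - 1) ^ i\<bar> \<le> 1"
        unfolding power_abs using hh by (intro power_le_one) (auto simp: abs_le_iff)
      then show "\<bar>(- p gchoose i) * (h \<bullet> h - 1) ^ i\<bar> \<le> \<bar>- p gchoose i\<bar>"
        by (simp add: abs_mult mult_left_le)
    qed
    finally have "\<bar>glued_powr p N (h \<bullet> h)\<bar> \<le> (1 + A) * 1" by simp
    also have "2 powr - (2 * p) \<le> (1 + norm h) powr - (2 * p)"
      using False assms by (intro powr_mono2') (auto intro: add_pos_nonneg)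
    then have "1 \<le> 2 powr (2 * p) * (1 + norm h) powr - (2 * p)"
      by (simp add: powr_minus field_simps)
    then have "(1 + A) * 1 \<le> (1 + A) * (2 powr (2 * p) * (1 + norm h) powr - (2 * p))"
      using A by (intro mult_left_mono) auto
    finally show ?thesis by (simp only: mult.assoc)
  qed
  then show ?thesis using A by (intro exI[of _ "(1 + A) * 2 powr (2 * p)"]) auto
qed

text \<open>A partial derivative is a coordinate times the kernel for p + 1. Raising p gains two
  powers of decay and the coordinate loses one, so the decay 2 p is kept, while one of the N
  available derivatives is spent.\<close>

lemma smooth_kernel_glued_powr:
  assumes "0 < p" "j < N"
  shows "smooth_kernel j (2 * p) (\<lambda>h::'a::euclidean_space. glued_powr p N (h \<bullet> h))"
  using assms
proof (induction j arbitrary: p N)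
  have D: "((\<lambda>h::'a. glued_powr p (Suc N) (h \<bullet> h)) has_derivative
      (\<lambda>v. - p * glued_powr (p + 1) N (x \<bullet> x) * (2 * (x \<bullet> v)))) (at x)" for p N and x :: 'a
  proof -
    have "((\<lambda>h::'a. h \<bullet> h) has_derivative (\<lambda>v. 2 * (x \<bullet> v))) (at x)"
      by (auto intro!: derivative_eq_intros simp: inner_commute)
    from has_derivative_compose[OF this DERIV_glued_powr[of p N, unfolded has_field_derivative_def]]
    show ?thesis .
  qed
  { case (0 p N)
    then obtain M where N: "N = Suc M" by (cases N) auto
    have "continuous_on UNIV (\<lambda>h::'a. glued_powr p N (h \<bullet> h))"
      unfolding N by (intro continuous_at_imp_continuous_on ballI has_derivative_continuous[OF D])
    then show ?case using glued_powr_radial_bound[OF 0(1)] by simp }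
  { case (Suc j p N)
    then obtain M where N: "N = Suc M" and M: "j < M" by (cases N) auto
    have pd: "partial_deriv b (\<lambda>h::'a. glued_powr p N (h \<bullet> h)) =
        (\<lambda>h. - 2 * p * ((h \<bullet> b) * glued_powr (p + 1) M (h \<bullet> h)))" for b
      unfolding N by (rule ext) (simp only: partial_deriv_eq[OF D] mult_ac mult_minus_left mult_minus_right)
    have "smooth_kernel j (2 * p) (\<lambda>h::'a. - 2 * p * ((h \<bullet> b) * glued_powr (p + 1) M (h \<bullet> h)))" if "b \<in> Basis" for b
    proof (intro smooth_kernel_cmult smooth_kernel_coordinate[OF _ that])
      have "smooth_kernel j (2 * (p + 1)) (\<lambda>h::'a. glued_powr (p + 1) M (h \<bullet> h))"
        using Suc.IH[of "p + 1" M] Suc.prems M by simp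
      then show "smooth_kernel j (2 * p + 1) (\<lambda>h::'a. glued_powr (p + 1) M (h \<bullet> h))"
        by (rule smooth_kernel_mono) simp
    qed
    moreover have "(\<lambda>h::'a. glued_powr p N (h \<bullet> h)) differentiable (at x)" for x
      unfolding N using D differentiableI by blast
    ultimately show ?case using glued_powr_radial_bound[OF Suc.prems(1)] by (simp add: pd) }
qed

text \<open>Off the unit ball the two powers coincide, which gives the compact support. The value at
  the origin is set to 0 by hand: there \<open>norm h powr\<close> is 0 but the glued power is
  not.\<close>

lemma near_kernel_glued_powr:
  assumes "0 < \<alpha>"
  shows "near_kernel \<alpha> (\<lambda>h::'a::euclidean_space. if h = 0 then 0
     else norm h powr - (real DIM('a) + \<alpha>) - glued_powr ((real DIM('a) + \<alpha>) / 2) (Suc N) (h \<bullet> h))"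
    (is "near_kernel \<alpha> (\<lambda>h. if h = 0 then 0 else _ h - ?k h)")
  unfolding near_kernel_def
proof (intro conjI allI impI)
  let ?s = "real DIM('a) + \<alpha>"
  have s: "0 < ?s" using assms by (simp add: add_nonneg_pos)
  have half: "2 * (?s / 2) = ?s" by simp
  have k: "smooth_kernel 0 (2 * (?s / 2)) ?k"
    using s by (intro smooth_kernel_glued_powr) auto
  have [measurable]: "?k \<in> borel_measurable borel"
    using smooth_kernel_continuous[OF k] by (rule borel_measurable_continuous_onI)
  show "(\<lambda>h. if h = 0 then 0 else norm h powr - ?s - ?k h) \<in> borel_measurable borel"
    by measurable
  show "(if h = 0 then 0 else norm h powr - ?s - ?k h) = 0" if "1 \<le> norm h" for h
  proof -
    have "(h \<bullet> h) powr - (?s / 2) = norm h powr - ?s"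
      using norm_sq_powr[of h "?s / 2"] by (simp only: half)
    then show ?thesis using that unfolding glued_powr_def one_le_inner_self_iff by simp
  qed
  obtain C where C: "0 \<le> C" "\<And>h. \<bar>?k h\<bar> \<le> C * (1 + norm h) powr - (2 * (?s / 2))"
    using smooth_kernel_bound[OF k] by metis
  have "\<bar>if h = 0 then 0 else norm h powr - ?s - ?k h\<bar> \<le> (1 + C) * norm h powr - ?s" for h
  proof (cases "h = 0")
    case False
    have "(1 + norm h) powr - ?s \<le> norm h powr - ?s"
      using False s by (intro powr_mono2') auto
    then have "C * (1 + norm h) powr - ?s \<le> C * norm h powr - ?s"
      using C(1) by (rule mult_left_mono)
    moreover have "\<bar>?k h\<bar> \<le> C * (1 + norm h) powr - ?s" using C(2)[of h] unfolding half .
    ultimately have "\<bar>?k h\<bar> \<le> C * norm h powr - ?s" by linarith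
    then have "\<bar>norm h powr - ?s - ?k h\<bar> \<le> norm h powr - ?s + C * norm h powr - ?s"
      using abs_triangle_ineq4[of "norm h powr - ?s" "?k h"] by simp
    then show ?thesis using False by (simp add: distrib_right)
  qed simp
  then show "\<exists>C\<ge>0. \<forall>h. \<bar>if h = 0 then 0 else norm h powr - ?s - ?k h\<bar> \<le> C * norm h powr - ?s"
    using C(1) by (intro exI[of _ "1 + C"]) auto
qed

lemma integrable_weight:
  assumes "0 < \<alpha>"
  shows "integrable lborel (\<lambda>h::'a::euclidean_space. (1 + norm h) powr - (real DIM('a) + \<alpha>))"
proof (rule Bochner_Integration.integrable_bound)
  let ?s = "real DIM('a) + \<alpha>"
  show "integrable lborel (\<lambda>h::'a. indicator (ball 0 1) h + indicator {h. 1 \<le> norm h} h * norm h powr - ?s)"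
  proof (rule Bochner_Integration.integrable_add[OF _ integrable_norm_powr_outside[OF assms]])
    show "integrable lborel (indicator (ball (0::'a) 1) :: 'a \<Rightarrow> real)"
      by (rule integrable_real_indicator) (use emeasure_bounded_finite[OF bounded_ball] in simp_all)
  qed
  have "(1 + norm h) powr - ?s \<le> indicator (ball 0 1) h + indicator {h. 1 \<le> norm h} h * norm h powr - ?s" for h :: 'a
  proof (cases "1 \<le> norm h")
    case True
    then show ?thesis using assms by (auto intro!: powr_mono2')
  next
    case False
    have "(1 + norm h) powr - ?s \<le> 1 powr - ?s" using assms by (intro powr_mono2') auto
    then show ?thesis using False by simp
  qed
  then show "AE h in lborel. norm ((1 + norm (h::'a)) powr - ?s)
      \<le> norm (indicator (ball 0 1) h + indicator {h. 1 \<le> norm h} h * norm h powr - ?s :: real)"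
    by (auto intro: order_trans[OF _ abs_ge_self])
qed simp

text \<open>The singular integral splits into a compactly supported singular kernel, acting on second
  differences, and a smooth kernel with the decay of \<open>|h|\<^sup>-\<^sup>n\<^sup>-\<^sup>\<alpha>\<close>, acting by convolution.\<close>

lemma second_diff_integral_split:
  fixes u :: "'a::euclidean_space \<Rightarrow> real" and \<alpha> :: real and N :: nat
  defines "s \<equiv> real DIM('a) + \<alpha>"
  defines "k \<equiv> (\<lambda>h::'a. glued_powr (s / 2) (Suc N) (h \<bullet> h))"
  assumes \<alpha>: "0 < \<alpha>" and u: "continuous_on UNIV u" "integrable lborel (\<lambda>y. \<bar>u y\<bar> * (1 + norm y) powr - s)"
    and sd: "second_diff_loc \<beta> u" "\<alpha> < \<beta>"
  shows "has_bochner_integral lborel (\<lambda>h. second_diff u x h * norm h powr - s)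
    (near_op (\<lambda>h. if h = 0 then 0 else norm h powr - s - k h) u x
      + 2 * u x * (LBINT h. k h) - 2 * (LBINT y. u y * k (x - y)))"
proof -
  let ?K = "\<lambda>h::'a. if h = 0 then 0 else norm h powr - s - k h"
  have s: "0 < s" using \<alpha> by (simp add: s_def add_nonneg_pos)
  have K: "near_kernel \<alpha> ?K"
    unfolding s_def k_def by (rule near_kernel_glued_powr[OF \<alpha>])
  have sk: "smooth_kernel 0 s k"
    using smooth_kernel_glued_powr[of "s / 2" 0 "Suc N"] s unfolding k_def by simp
  obtain C where C: "0 \<le> C" "\<And>h. \<bar>k h\<bar> \<le> C * (1 + norm h) powr - s"
    using smooth_kernel_bound[OF sk] by metis
  note kc = smooth_kernel_continuous[OF sk]
  have [measurable]: "u \<in> borel_measurable borel" "k \<in> borel_measurable borel"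
    using u(1) kc borel_measurable_continuous_onI by blast+
  have even: "k (- h) = k h" for h by (simp add: k_def)
  have int_k: "integrable lborel k"
    by (rule Bochner_Integration.integrable_bound[OF integrable_mult_right[OF integrable_weight[OF \<alpha>], of C]])
       (use C in \<open>auto simp: s_def\<close>)
  have int_uk: "integrable lborel (\<lambda>y. u y * k (x - y))"
    by (rule far_integrable[OF _ u(2) _ kc C(2,1)]) (use s in auto)
  have m: "(\<lambda>y. u y * k (x - y)) \<in> borel_measurable borel" by measurable
  have hb: "has_bochner_integral lborel (\<lambda>y. u y * k (x - y)) (LBINT y. u y * k (x - y))"
    using int_uk by (simp add: has_bochner_integral_iff)
  have p: "has_bochner_integral lborel (\<lambda>h. u (x + h) * k h) (LBINT y. u y * k (x - y))"
    using integrable_lborel_shift_iff[OF m, of x] integral_lborel_shift[OF m, of x] int_uk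
    by (simp add: has_bochner_integral_iff even)
  have q: "has_bochner_integral lborel (\<lambda>h. u (x - h) * k h) (LBINT y. u y * k (x - y))"
    using integrable_lborel_reflect_iff[OF m, of x] integral_lborel_reflect[OF m, of x] int_uk
    by (simp add: has_bochner_integral_iff)
  have n: "has_bochner_integral lborel (\<lambda>h. second_diff u x h * ?K h) (near_op ?K u x)"
    unfolding near_op_def using near_integrable[OF K u(1) sd] by (simp only: has_bochner_integral_iff simp_thms)
  have r: "has_bochner_integral lborel (\<lambda>h. 2 * u x * k h) (2 * u x * (LBINT h. k h))"
    using int_k by (simp add: has_bochner_integral_iff)
  have "has_bochner_integral lborel
      (\<lambda>h. second_diff u x h * ?K h + 2 * u x * k h - (u (x + h) * k h + u (x - h) * k h))
      (near_op ?K u x + 2 * u x * (LBINT h. k h)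
        - ((LBINT y. u y * k (x - y)) + (LBINT y. u y * k (x - y))))"
    by (intro has_bochner_integral_add has_bochner_integral_diff n r p q)
  \<comment> \<open>At h = 0, where K is set to 0, the identity persists because both sides
    vanish.\<close>
  moreover have "second_diff u x h * ?K h + 2 * u x * k h - (u (x + h) * k h + u (x - h) * k h)
      = second_diff u x h * norm h powr - s" for h
    by (simp add: second_diff_def algebra_simps)
  ultimately show ?thesis by simp
qed

text \<open>For each truncation radius the integral is averaged with its reflection through x, which
  turns first differences into second differences and yields the factor 1/2. The truncation is then
  removed by dominated convergence; thus the limit in the definition of the operator exists and
  \<open>Lim\<close> returns it.\<close>

lemma frac_laplacian_eq_second_diff:
  fixes u :: "'a::euclidean_space \<Rightarrow> real" and \<alpha> :: real
  defines "s \<equiv> real DIM('a) + \<alpha>"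
  assumes \<alpha>: "0 < \<alpha>" and u: "continuous_on UNIV u" "integrable lborel (\<lambda>y. \<bar>u y\<bar> * (1 + norm y) powr - s)"
    and int: "integrable lborel (\<lambda>h. second_diff u x h * norm h powr - s)"
  shows "frac_laplacian \<alpha> u x =
    frac_lap_const DIM('a) \<alpha> * (1 / 2 * (LBINT h. second_diff u x h * norm h powr - s))"
proof -
  have s: "0 < s" using \<alpha> by (simp add: s_def add_nonneg_pos)
  have [measurable]: "u \<in> borel_measurable borel"
    using u(1) borel_measurable_continuous_onI by blast
  let ?w = "\<lambda>h::'a. (1 + norm h) powr - s"
  have w: "continuous_on UNIV ?w"
    by (intro continuous_intros) (auto simp: add_nonneg_eq_0_iff)
  have ix: "integrable lborel (\<lambda>y. 1 * ?w (x - y))"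
    by (rule far_integrable[where s=s and C=1])
       (use integrable_weight[OF \<alpha>, where 'a='a] s w in \<open>auto simp: s_def\<close>)
  have iu: "integrable lborel (\<lambda>y. \<bar>u y\<bar> * ?w (x - y))"
    by (rule far_integrable[where s=s and C=1]) (use u s w in auto)
  define F where "F \<epsilon> y = indicator {y. \<epsilon> \<le> norm (y - x)} y * ((u x - u y) / norm (x - y) powr s)" for \<epsilon> y
  have Fm [measurable]: "F \<epsilon> \<in> borel_measurable borel" for \<epsilon>
    unfolding F_def[abs_def] by measurable
  have Fint: "integrable lborel (F \<epsilon>)" if \<epsilon>: "0 < \<epsilon>" for \<epsilon>
  proof (rule Bochner_Integration.integrable_bound)
    let ?c = "(1 + 1 / \<epsilon>) powr s"
    show "integrable lborel (\<lambda>y. ?c * (\<bar>u x\<bar> * (1 * ?w (x - y)) + \<bar>u y\<bar> * ?w (x - y)))"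
      by (intro integrable_mult_right Bochner_Integration.integrable_add ix iu)
    have "\<bar>F \<epsilon> y\<bar> \<le> ?c * (\<bar>u x\<bar> * (1 * ?w (x - y)) + \<bar>u y\<bar> * ?w (x - y))" for y
    proof (cases "\<epsilon> \<le> norm (y - x)")
      case True
      have "\<bar>F \<epsilon> y\<bar> = \<bar>u x - u y\<bar> * norm (x - y) powr - s"
        using True by (simp add: F_def powr_minus divide_inverse abs_mult)
      also have "\<dots> \<le> (\<bar>u x\<bar> + \<bar>u y\<bar>) * (?c * ?w (x - y))"
        using True \<epsilon> s by (intro mult_mono powr_minus_le_weight) (auto simp: norm_minus_commute)
      finally show ?thesis by (simp add: algebra_simps)
    qed (simp add: F_def)
    then show "AE y in lborel. norm (F \<epsilon> y) \<le> norm (?c * (\<bar>u x\<bar> * (1 * ?w (x - y)) + \<bar>u y\<bar> * ?w (x - y)))"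
      by (auto intro: order_trans[OF _ abs_ge_self])
  qed simp
  define G where "G \<epsilon> h = indicator {h. \<epsilon> \<le> norm h} h * (second_diff u x h * norm h powr - s)" for \<epsilon> :: real and h
  have FG: "(LBINT y. F \<epsilon> y) = 1 / 2 * (LBINT h. G \<epsilon> h)" if \<epsilon>: "0 < \<epsilon>" for \<epsilon>
  proof -
    have "integrable lborel (\<lambda>h. F \<epsilon> (x + h))" "integrable lborel (\<lambda>h. F \<epsilon> (x - h))"
      using Fint[OF \<epsilon>] integrable_lborel_shift_iff[OF Fm] integrable_lborel_reflect_iff[OF Fm] by blast+
    then have "(LBINT h. F \<epsilon> (x + h) + F \<epsilon> (x - h)) = 2 * (LBINT y. F \<epsilon> y)"
      by (simp add: integral_lborel_shift[OF Fm] integral_lborel_reflect[OF Fm])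
    moreover have "F \<epsilon> (x + h) + F \<epsilon> (x - h) = G \<epsilon> h" for h
      by (simp add: F_def G_def second_diff_def indicator_def powr_minus divide_inverse algebra_simps)
    ultimately show ?thesis by simp
  qed
  \<comment> \<open>The definition integrates over the completed measure; the integrand is Borel, so
    the value is unchanged.\<close>
  have set_int: "set_lebesgue_integral lebesgue {y. norm (y - x) \<ge> \<epsilon>} (\<lambda>y. (u x - u y) / norm (x - y) powr s)
      = (LBINT y. F \<epsilon> y)" for \<epsilon>
  proof -
    have "set_lebesgue_integral lebesgue {y. norm (y - x) \<ge> \<epsilon>} (\<lambda>y. (u x - u y) / norm (x - y) powr s)
        = (\<integral>y. F \<epsilon> y \<partial>lebesgue)"
      by (simp add: set_lebesgue_integral_def F_def)
    also have "\<dots> = (LBINT y. F \<epsilon> y)"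
      by (rule integral_completion) simp
    finally show ?thesis .
  qed
  have "((\<lambda>\<epsilon>. LBINT h. G \<epsilon> h) \<longlongrightarrow> (LBINT h. second_diff u x h * norm h powr - s)) (at_right 0)"
  proof (subst tendsto_at_iff_sequentially, intro allI impI)
    fix X :: "nat \<Rightarrow> real"
    assume X: "\<forall>i. X i \<in> {0<..} - {0}" "X \<longlonglongrightarrow> 0"
    have [measurable]: "second_diff u x \<in> borel_measurable borel"
      using borel_measurable_second_diff[OF u(1)] .
    have "(\<lambda>i. LBINT h. G (X i) h) \<longlonglongrightarrow> (LBINT h. second_diff u x h * norm h powr - s)"
    proof (rule integral_dominated_convergence[where w="\<lambda>h. \<bar>second_diff u x h * norm h powr - s\<bar>"])
      show "AE h in lborel. (\<lambda>i. G (X i) h) \<longlonglongrightarrow> second_diff u x h * norm h powr - s"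
      proof (rule AE_I2)
        fix h :: 'a
        show "(\<lambda>i. G (X i) h) \<longlonglongrightarrow> second_diff u x h * norm h powr - s"
        proof (cases "h = 0")
          case False
          then have "\<forall>\<^sub>F i in sequentially. X i < norm h"
            using X(2) by (intro order_tendstoD(2)) auto
          then have "\<forall>\<^sub>F i in sequentially. G (X i) h = second_diff u x h * norm h powr - s"
            by eventually_elim (simp add: G_def)
          then show ?thesis by (rule tendsto_eventually)
        qed (simp add: G_def)
      qed
      show "AE h in lborel. norm (G (X i) h) \<le> \<bar>second_diff u x h * norm h powr - s\<bar>" for i
        by (auto simp: G_def indicator_def)
      show "G (X i) \<in> borel_measurable lborel" for i
        unfolding G_def[abs_def] by measurable
    qed (use int in auto)
    then show "((\<lambda>\<epsilon>. LBINT h. G \<epsilon> h) \<circ> X) \<longlonglongrightarrow> (LBINT h. second_diff u x h * norm h powr - s)"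
      by (simp add: o_def)
  qed
  then have "((\<lambda>\<epsilon>. 1 / 2 * (LBINT h. G \<epsilon> h)) \<longlongrightarrow> 1 / 2 * (LBINT h. second_diff u x h * norm h powr - s)) (at_right 0)"
    by (intro tendsto_mult_left)
  moreover have "\<forall>\<^sub>F \<epsilon> in at_right 0. 1 / 2 * (LBINT h. G \<epsilon> h) = (LBINT y. F \<epsilon> y)"
    using eventually_at_right_less[of 0] by eventually_elim (rule FG[symmetric])
  ultimately have "((\<lambda>\<epsilon>. LBINT y. F \<epsilon> y) \<longlongrightarrow> 1 / 2 * (LBINT h. second_diff u x h * norm h powr - s)) (at_right 0)"
    by (rule Lim_transform_eventually)
  then have "Lim (at_right 0) (\<lambda>\<epsilon>. LBINT y. F \<epsilon> y) = 1 / 2 * (LBINT h. second_diff u x h * norm h powr - s)"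
    by (rule tendsto_Lim[rotated]) simp
  then show ?thesis
    unfolding frac_laplacian_def set_int[unfolded s_def] s_def by simp
qed

text \<open>Passes from 1 + |y|^s to (1 + |y|)^s, which it exceeds by at most a factor 2. The latter
  weight is the one to which Peetre's inequality applies.\<close>

lemma L_space_integrable_weight:
  fixes u :: "'a::euclidean_space \<Rightarrow> real"
  assumes "u \<in> L_space \<alpha>" "continuous_on UNIV u" "0 < \<alpha>"
  shows "integrable lborel (\<lambda>y. \<bar>u y\<bar> * (1 + norm y) powr - (real DIM('a) + \<alpha>))"
proof (rule Bochner_Integration.integrable_bound)
  let ?s = "real DIM('a) + \<alpha>"
  have s: "0 < ?s" using assms(3) by (simp add: add_nonneg_pos)
  have [measurable]: "u \<in> borel_measurable borel"
    using assms(2) borel_measurable_continuous_onI by blast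
  have "integrable lborel (\<lambda>x. \<bar>u x\<bar> / (1 + norm x powr ?s))"
    using assms(1) unfolding L_space_def by (auto simp: integrable_completion)
  then show "integrable lborel (\<lambda>x. 2 * (\<bar>u x\<bar> / (1 + norm x powr ?s)))"
    by (rule integrable_mult_right)
  have "\<bar>u y\<bar> * (1 + norm y) powr - ?s \<le> 2 * (\<bar>u y\<bar> / (1 + norm y powr ?s))" for y
  proof -
    have "1 powr ?s \<le> (1 + norm y) powr ?s" "norm y powr ?s \<le> (1 + norm y) powr ?s"
      using s by (intro powr_mono2; simp)+
    then have "1 + norm y powr ?s \<le> 2 * (1 + norm y) powr ?s" by simp
    moreover have "0 < (1 + norm y) powr ?s" "0 < 1 + norm y powr ?s"
      by (simp_all add: add_pos_nonneg add_nonneg_eq_0_iff)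
    moreover have "inverse Z \<le> 2 / Y" if "Y \<le> 2 * Z" "0 < Z" "0 < Y" for Y Z :: real
      using that by (simp add: field_simps)
    ultimately have "(1 + norm y) powr - ?s \<le> 2 / (1 + norm y powr ?s)"
      unfolding powr_minus by blast
    from mult_left_mono[OF this abs_ge_zero[of "u y"]] show ?thesis by (simp add: mult_ac)
  qed
  then show "AE y in lborel. norm (\<bar>u y\<bar> * (1 + norm y) powr - ?s) \<le> norm (2 * (\<bar>u y\<bar> / (1 + norm y powr ?s)))"
    by (auto intro: order_trans[OF _ abs_ge_self])
  show "(\<lambda>y. \<bar>u y\<bar> * (1 + norm y) powr - ?s) \<in> borel_measurable lborel" by measurable
qed

text \<open>After splitting the kernel, the fractional Laplacian is a linear combination of the
  singular part, of u and of a smooth convolution. Each of the three is of class C^j, the first by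
  the Hoelder hypothesis and the last by decay alone.\<close>

lemma C_k_frac_laplacian:
  fixes u :: "'a::euclidean_space \<Rightarrow> real"
  assumes \<alpha>: "0 < \<alpha>" "\<alpha> < 2" "0 < \<epsilon>"
    and hol: "C_k_holder_loc (j + nat \<lfloor>\<alpha>\<rfloor>) (frac \<alpha> + \<epsilon>) u" and L: "u \<in> L_space \<alpha>"
  shows "C_k j (frac_laplacian \<alpha> u)"
    and "integrable lborel (\<lambda>h. second_diff u x h * norm h powr - (real DIM('a) + \<alpha>))"
    and "frac_laplacian \<alpha> u x = frac_lap_const DIM('a) \<alpha> *
       (1 / 2 * (LBINT h. second_diff u x h * norm h powr - (real DIM('a) + \<alpha>)))"
proof -
  let ?s = "real DIM('a) + \<alpha>"
  let ?k = "\<lambda>h::'a. glued_powr (?s / 2) (Suc j) (h \<bullet> h)"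
  let ?K = "\<lambda>h::'a. if h = 0 then 0 else norm h powr - ?s - ?k h"
  have s: "0 < ?s" using \<alpha> by (simp add: add_nonneg_pos)
  have Ck: "C_k (j + nat \<lfloor>\<alpha>\<rfloor>) u" using hol by (simp add: C_k_holder_loc_def)
  have uc: "continuous_on UNIV u" using Ck by (rule C_k_continuous)
  have um: "u \<in> borel_measurable borel" using uc by (rule borel_measurable_continuous_onI)
  note w = L_space_integrable_weight[OF L uc \<alpha>(1)]
  obtain \<beta> where \<beta>: "\<alpha> < \<beta>" "second_diff_loc \<beta> u"
    using C_k_holder_imp_second_diff_loc[OF hol \<alpha>] by blast
  \<comment> \<open>Taylor degree j + 1 in the glued power leaves a kernel with j derivatives of the
    required decay.\<close>
  note split = second_diff_integral_split[OF \<alpha>(1) uc w \<beta>(2,1), where N=j]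
  show int: "integrable lborel (\<lambda>h. second_diff u x h * norm h powr - ?s)" for x
    using split by (simp only: has_bochner_integral_iff)
  show rep: "frac_laplacian \<alpha> u x = frac_lap_const DIM('a) \<alpha> *
       (1 / 2 * (LBINT h. second_diff u x h * norm h powr - ?s))" for x
    by (rule frac_laplacian_eq_second_diff[OF \<alpha>(1) uc w int])
  have eq: "frac_laplacian \<alpha> u = (\<lambda>x. (frac_lap_const DIM('a) \<alpha> * (1 / 2)) *
      ((near_op ?K u x + (2 * (LBINT h. ?k h)) * u x) + (- 2) * (LBINT y. u y * ?k (x - y))))"
    unfolding rep has_bochner_integral_integral_eq[OF split] by (rule ext) (simp add: algebra_simps)
  have "C_k j' u" if "C_k (j' + i) u" for j' i
    using that by (induction i) (auto simp del: C_k.simps dest: C_k_Suc_imp)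
  then have "C_k j u" using Ck by blast
  moreover have "C_k j (near_op ?K u)"
    by (rule C_k_near_op[OF near_kernel_glued_powr[OF \<alpha>(1)] \<alpha> hol])
  moreover have "C_k j (\<lambda>x. LBINT y. u y * ?k (x - y))"
  proof (rule C_k_convolution[OF um w])
    show "smooth_kernel j ?s ?k"
    proof -
      have half: "2 * (?s / 2) = ?s" by simp
      show ?thesis
        using smooth_kernel_glued_powr[of "?s / 2" j "Suc j", where 'a='a] s unfolding half by simp
    qed
  qed (use s in simp)
  ultimately show "C_k j (frac_laplacian \<alpha> u)"
    unfolding eq by (intro C_k_cmult C_k_add)
qed

section \<open>Means of polyharmonic functions\<close>

text \<open>All powers N are kept because integration by parts raises N. The case N = 2 is of class
  C^{1,1}, which suffices for an operator of order \<alpha> < 2.\<close>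

definition bump :: "nat \<Rightarrow> 'a::euclidean_space \<Rightarrow> real" where
  "bump N z = max 0 (1 - z \<bullet> z) ^ N"

lemma bump_nonneg: "0 \<le> bump N z"
  by (simp add: bump_def)

lemma bump_le_1: "bump N z \<le> 1"
  unfolding bump_def by (rule power_le_one) auto

lemma bump_eq_0: "1 \<le> norm z \<Longrightarrow> 0 < N \<Longrightarrow> bump N z = 0"
  using one_le_inner_self_iff[of z] by (simp add: bump_def)

lemma continuous_bump: "continuous_on S (bump N)"
  unfolding bump_def[abs_def] by (intro continuous_intros)

lemma DERIV_max_power:
  assumes "0 < N"
  shows "((\<lambda>t::real. max 0 t ^ Suc N) has_real_derivative real (Suc N) * max 0 t ^ N) (at t)"
proof -
  have eq: "(\<lambda>t::real. max 0 t ^ Suc N) = (\<lambda>t. if 0 \<le> t then t ^ Suc N else 0)"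
    by (auto simp: max_def)
  have P: "((\<lambda>t::real. t ^ Suc N) has_real_derivative real (Suc N) * t ^ N) (at t)" for t
    using DERIV_pow[of "Suc N" t] by simp
  consider "t < 0" | "t = 0" | "0 < t" by linarith
  then show ?thesis
  proof cases
    case 1
    have "((\<lambda>t::real. 0) has_real_derivative real (Suc N) * max 0 t ^ N) (at t)"
      using 1 assms by (simp add: max_def power_0_left)
    then show ?thesis
      by (rule has_field_derivative_transform_within_open[of _ _ _ "{..<0}"])
         (use 1 in \<open>auto simp: max_def\<close>)
  next
    case 2
    then show ?thesis unfolding eq using P[of 0] assms
      by (intro has_field_derivative_If_eq) (auto simp: max_def power_0_left)
  next
    case 3
    have "((\<lambda>t::real. t ^ Suc N) has_real_derivative real (Suc N) * max 0 t ^ N) (at t)"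
      using 3 P[of t] by (simp add: max_def del: power_Suc of_nat_Suc)
    then show ?thesis
      by (rule has_field_derivative_transform_within_open[of _ _ _ "{0<..}"])
         (use 3 in \<open>auto simp: max_def\<close>)
  qed
qed

lemma bump_has_derivative:
  assumes "0 < N"
  shows "(bump (Suc N) has_derivative (\<lambda>v. real (Suc N) * bump N z * (- 2 * (z \<bullet> v)))) (at z)"
proof -
  have "((\<lambda>z. 1 - z \<bullet> z) has_derivative (\<lambda>v. - 2 * (z \<bullet> v))) (at z)"
    by (auto intro!: derivative_eq_intros simp: inner_commute)
  from has_derivative_compose[OF this DERIV_max_power[OF assms, unfolded has_field_derivative_def]]
  show ?thesis by (simp only: bump_def[abs_def])
qed

lemma integrable_continuous_compact_support:
  fixes f :: "'a::euclidean_space \<Rightarrow> real"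
  assumes "continuous_on UNIV f" "\<And>z. r \<le> norm z \<Longrightarrow> f z = 0"
  shows "integrable lborel f"
proof -
  have "integrable lborel (\<lambda>x. indicator (cball 0 r) x *\<^sub>R f x)"
    by (intro borel_integrable_compact compact_cball continuous_on_subset[OF assms(1)]) auto
  moreover have "indicator (cball 0 r) x *\<^sub>R f x = f x" for x
    using assms(2)[of x] by (auto simp: indicator_def)
  ultimately show ?thesis by (simp only:)
qed

lemma continuous_bounded_compact_support:
  fixes f :: "'a::euclidean_space \<Rightarrow> real"
  assumes "continuous_on UNIV f" "\<And>z. r \<le> norm z \<Longrightarrow> f z = 0"
  obtains B where "0 \<le> B" "\<And>z. \<bar>f z\<bar> \<le> B"
proof -
  obtain B where B: "0 \<le> B" "\<And>x. norm x \<le> r \<Longrightarrow> \<bar>f x\<bar> \<le> B"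
    using continuous_bounded_cball[OF assms(1)] by metis
  have "\<bar>f z\<bar> \<le> B" for z using B assms(2)[of z] by (cases "norm z \<le> r") auto
  with B(1) show ?thesis by (rule that)
qed

text \<open>The integral of z \<mapsto> G (z + t b) does not depend on t by translation invariance;
  differentiating under the integral at t = 0 gives the claim. For |t| < 1 all translates vanish
  outside the ball of radius 2, which provides the dominating function.\<close>

lemma integral_directional_derivative_eq_0:
  fixes G G' :: "'a::euclidean_space \<Rightarrow> real"
  assumes cont: "continuous_on UNIV G" "continuous_on UNIV G'"
    and supp: "\<And>z. 1 \<le> norm z \<Longrightarrow> G z = 0" "\<And>z. 1 \<le> norm z \<Longrightarrow> G' z = 0"
    and der: "\<And>z t. ((\<lambda>t. G (z + t *\<^sub>R b)) has_real_derivative G' (z + t *\<^sub>R b)) (at t)"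
    and b: "norm b \<le> 1"
  shows "(LBINT z. G' z) = 0"
proof -
  obtain B where B: "0 \<le> B" "\<And>z. \<bar>G' z\<bar> \<le> B"
    using continuous_bounded_compact_support[OF cont(2) supp(2)] by metis
  have m [measurable]: "G \<in> borel_measurable borel" "G' \<in> borel_measurable borel"
    using cont borel_measurable_continuous_onI by blast+
  have "((\<lambda>t. LBINT z. G (z + t *\<^sub>R b)) has_derivative (\<lambda>v. LBINT z. v * G' (z + 0 *\<^sub>R b))) (at (0::real))"
  proof (rule has_derivative_integral_dominated[where r=1 and D="\<lambda>t z v. v * G' (z + t *\<^sub>R b)"
        and B="\<lambda>z. B * indicator (cball 0 2) z"])
    show "integrable lborel (\<lambda>z. G (z + t *\<^sub>R b))" for t
      using integrable_lborel_shift_iff[OF m(1), of "t *\<^sub>R b"]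
        integrable_continuous_compact_support[OF cont(1) supp(1)] by (simp add: add.commute)
    show "((\<lambda>t. G (z + t *\<^sub>R b)) has_derivative (\<lambda>v. v * G' (z + t *\<^sub>R b))) (at t)" for t z
      using der[where z=z and t=t] by (simp add: has_field_derivative_def mult_commute_abs)
    show "integrable lborel (\<lambda>z. B * indicator (cball (0::'a) 2) z)"
      by (intro integrable_mult_right integrable_real_indicator)
         (use emeasure_bounded_finite[OF bounded_cball] in simp_all)
    show "\<bar>c * G' (z + t *\<^sub>R b)\<bar> \<le> B * indicator (cball 0 2) z" if t: "t \<in> ball 0 1" and c: "c \<in> Basis" for t c z
    proof (cases "z \<in> cball 0 2")
      case True
      then show ?thesis using c B by simp
    next
      case False
      have "norm (t *\<^sub>R b) \<le> 1"
        using t b mult_mono[of "\<bar>t\<bar>" 1 "norm b" 1] by simp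
      then have "1 \<le> norm (z + t *\<^sub>R b)"
        using False norm_triangle_ineq4[of "z + t *\<^sub>R b" "t *\<^sub>R b"] by simp
      then show ?thesis using supp(2) B by simp
    qed
  qed simp_all
  moreover have "(LBINT z. G (z + t *\<^sub>R b)) = (LBINT z. G z)" for t
    using integral_lborel_shift[OF m(1), of "t *\<^sub>R b"] by (simp add: add.commute)
  ultimately have "((\<lambda>t::real. LBINT z. G z) has_derivative (\<lambda>v. v * (LBINT z. G' z))) (at 0)"
    by simp
  then have "(\<lambda>v::real. v * (LBINT z. G' z)) = (\<lambda>v. 0)"
    by (rule has_derivative_unique) (rule has_derivative_const)
  from fun_cong[OF this, of 1] show ?thesis by simp
qed

section \<open>Weighted means as functions of the radius\<close>

lemma C_k_sum:
  assumes "finite I" "I \<noteq> {}" "\<And>i. i \<in> I \<Longrightarrow> C_k k (f i)"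
  shows "C_k k (\<lambda>x. \<Sum>i\<in>I. f i x)"
  using assms by (induction I rule: finite_ne_induct) (auto intro: C_k_add)

lemma C_k_neg_laplacian:
  fixes f :: "'a::euclidean_space \<Rightarrow> real"
  assumes "C_k (Suc (Suc k)) f"
  shows "C_k k (neg_laplacian f)"
proof -
  have "C_k k (\<lambda>x. (- 1) * (\<Sum>b\<in>Basis. partial_deriv b (partial_deriv b f) x))"
    using assms by (intro C_k_cmult C_k_sum) auto
  then show ?thesis by (simp add: neg_laplacian_def[abs_def] laplacian_def)
qed

text \<open>The mean is not normalized, and R ranges over all reals, so that it is differentiable at
  R = 0, where its value is f x times the integral of the weight.\<close>

definition bump_mean :: "nat \<Rightarrow> ('a::euclidean_space \<Rightarrow> real) \<Rightarrow> 'a \<Rightarrow> real \<Rightarrow> real" where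
  "bump_mean N f x R = (LBINT z. bump N z * f (x + R *\<^sub>R z))"

lemma continuous_affine_compose:
  fixes f :: "'a::euclidean_space \<Rightarrow> real"
  assumes "continuous_on UNIV f"
  shows "continuous_on UNIV (\<lambda>z. f (x + R *\<^sub>R z))"
  by (rule continuous_on_compose2[OF assms]) (auto intro!: continuous_intros)

text \<open>Integration by parts, using \<open>z bump\<^sub>N(z) = - \<nabla> bump\<^sub>N\<^sub>+\<^sub>1(z) / (2 (N + 1))\<close>.\<close>

lemma bump_mean_DERIV:
  fixes f :: "'a::euclidean_space \<Rightarrow> real"
  assumes f: "C_k (Suc (Suc k)) f" and N: "0 < N"
  shows "(bump_mean N f x has_real_derivative
           - R / (2 * real (Suc N)) * bump_mean (Suc N) (neg_laplacian f) x R) (at R)"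
proof -
  have cp: "continuous_on UNIV (partial_deriv b f)"
    and cpp: "continuous_on UNIV (partial_deriv b (partial_deriv b f))" if "b \<in> Basis" for b
    using f that C_k_continuous[of "Suc k" "partial_deriv b f"] C_k_continuous[of k "partial_deriv b (partial_deriv b f)"] by auto
  have fd: "f differentiable (at y)" for y using f by simp
  have "\<forall>b\<in>Basis. \<exists>B\<ge>0. \<forall>y. norm y \<le> norm x + \<bar>R\<bar> + 1 \<longrightarrow> \<bar>partial_deriv b f y\<bar> \<le> B"
    using continuous_bounded_cball[OF cp] by metis
  then obtain B where B: "\<And>b. b \<in> Basis \<Longrightarrow> 0 \<le> B b"
    "\<And>b y. b \<in> Basis \<Longrightarrow> norm y \<le> norm x + \<bar>R\<bar> + 1 \<Longrightarrow> \<bar>partial_deriv b f y\<bar> \<le> B b"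
    by metis
  define I where "I b = (LBINT z. bump N z * ((z \<bullet> b) * partial_deriv b f (x + R *\<^sub>R z)))" for b
  have int: "integrable lborel (\<lambda>z. bump N z * ((z \<bullet> b) * partial_deriv b f (x + R *\<^sub>R z)))" if "b \<in> Basis" for b
    by (rule integrable_continuous_compact_support[where r=1])
       (auto simp: bump_eq_0[OF _ N] intro!: continuous_intros continuous_bump continuous_affine_compose cp that)
  have "((\<lambda>R. LBINT z. bump N z * f (x + R *\<^sub>R z)) has_derivative
      (\<lambda>v. LBINT z. bump N z * (v * (\<Sum>b\<in>Basis. (z \<bullet> b) * partial_deriv b f (x + R *\<^sub>R z))))) (at R)"
  proof (rule has_derivative_integral_dominated[where r=1 and
        D="\<lambda>R z v. bump N z * (v * (\<Sum>b\<in>Basis. (z \<bullet> b) * partial_deriv b f (x + R *\<^sub>R z)))" and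
        B="\<lambda>z. (\<Sum>b\<in>Basis. B b) * indicator (cball 0 1) z"])
    show "integrable lborel (\<lambda>z. bump N z * f (x + R *\<^sub>R z))" for R
      by (rule integrable_continuous_compact_support[where r=1])
         (auto simp: bump_eq_0[OF _ N] intro!: continuous_on_mult continuous_bump continuous_affine_compose C_k_continuous[OF f])
    show "((\<lambda>R. bump N z * f (x + R *\<^sub>R z)) has_derivative
        (\<lambda>v. bump N z * (v * (\<Sum>b\<in>Basis. (z \<bullet> b) * partial_deriv b f (x + R *\<^sub>R z))))) (at R)" for R z
      using has_field_derivative_along_line[OF fd, of x z R]
      by (intro has_derivative_mult_right) (simp add: has_field_derivative_def mult_commute_abs)
    show "integrable lborel (\<lambda>z. (\<Sum>b\<in>Basis. B b) * indicator (cball (0::'a) 1) z)"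
      by (intro integrable_mult_right integrable_real_indicator)
         (use emeasure_bounded_finite[OF bounded_cball] in simp_all)
    fix c :: real assume c: "c \<in> Basis"
    have "continuous_on UNIV (\<lambda>z. bump N z * (c * (\<Sum>b\<in>Basis. (z \<bullet> b) * partial_deriv b f (x + R *\<^sub>R z))))"
      by (intro continuous_intros continuous_bump continuous_affine_compose cp)
    from borel_measurable_continuous_onI[OF this]
    show "(\<lambda>z. bump N z * (c * (\<Sum>b\<in>Basis. (z \<bullet> b) * partial_deriv b f (x + R *\<^sub>R z)))) \<in> borel_measurable lborel"
      by simp
    fix R' z assume R': "R' \<in> ball R 1"
    show "\<bar>bump N z * (c * (\<Sum>b\<in>Basis. (z \<bullet> b) * partial_deriv b f (x + R' *\<^sub>R z)))\<bar>
        \<le> (\<Sum>b\<in>Basis. B b) * indicator (cball 0 1) z"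
    proof (cases "norm z \<le> 1")
      case True
      have "\<bar>R'\<bar> * norm z \<le> (\<bar>R\<bar> + 1) * 1"
        using R' True by (intro mult_mono) (auto simp: dist_real_def)
      then have nx: "norm (x + R' *\<^sub>R z) \<le> norm x + \<bar>R\<bar> + 1"
        using norm_triangle_ineq[of x "R' *\<^sub>R z"] by simp
      have "\<bar>\<Sum>b\<in>Basis. (z \<bullet> b) * partial_deriv b f (x + R' *\<^sub>R z)\<bar> \<le> (\<Sum>b\<in>Basis. \<bar>(z \<bullet> b) * partial_deriv b f (x + R' *\<^sub>R z)\<bar>)"
        by (rule sum_abs)
      moreover have "(\<Sum>b\<in>Basis. \<bar>(z \<bullet> b) * partial_deriv b f (x + R' *\<^sub>R z)\<bar>) \<le> (\<Sum>b\<in>Basis. B b)"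
      proof (rule sum_mono)
        fix b :: 'a assume b: "b \<in> Basis"
        have "\<bar>z \<bullet> b\<bar> \<le> 1" using Basis_le_norm[OF b, of z] True by linarith
        then have "\<bar>z \<bullet> b\<bar> * \<bar>partial_deriv b f (x + R' *\<^sub>R z)\<bar> \<le> 1 * B b"
          using B(2)[OF b nx] by (intro mult_mono) auto
        then show "\<bar>(z \<bullet> b) * partial_deriv b f (x + R' *\<^sub>R z)\<bar> \<le> B b" by (simp add: abs_mult)
      qed
      ultimately have "\<bar>\<Sum>b\<in>Basis. (z \<bullet> b) * partial_deriv b f (x + R' *\<^sub>R z)\<bar> \<le> (\<Sum>b\<in>Basis. B b)"
        by (rule order_trans)
      then have "bump N z * \<bar>\<Sum>b\<in>Basis. (z \<bullet> b) * partial_deriv b f (x + R' *\<^sub>R z)\<bar> \<le> 1 * (\<Sum>b\<in>Basis. B b)"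
        using bump_nonneg bump_le_1 by (intro mult_mono) auto
      then show ?thesis using True c bump_nonneg[of N z] by (simp add: abs_mult)
    next
      case False
      then show ?thesis by (simp add: bump_eq_0[OF _ N])
    qed
  qed simp
  then have "(bump_mean N f x has_derivative (\<lambda>v. v * (\<Sum>b\<in>Basis. I b))) (at R)"
    unfolding bump_mean_def[abs_def]
  proof (rule has_derivative_eq_rhs, intro ext)
    fix v :: real
    have "(LBINT z. bump N z * (v * (\<Sum>b\<in>Basis. (z \<bullet> b) * partial_deriv b f (x + R *\<^sub>R z))))
      = (LBINT z. v * (\<Sum>b\<in>Basis. bump N z * ((z \<bullet> b) * partial_deriv b f (x + R *\<^sub>R z))))"
      by (intro Bochner_Integration.integral_cong refl) (simp add: sum_distrib_left mult_ac)
    then show "(LBINT z. bump N z * (v * (\<Sum>b\<in>Basis. (z \<bullet> b) * partial_deriv b f (x + R *\<^sub>R z)))) = v * (\<Sum>b\<in>Basis. I b)"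
      using int by (simp add: I_def Bochner_Integration.integral_sum)
  qed
  then have D: "(bump_mean N f x has_real_derivative (\<Sum>b\<in>Basis. I b)) (at R)"
    by (rule has_derivative_imp_has_field_derivative) simp
  have I_eq: "2 * real (Suc N) * I b = R * (LBINT z. bump (Suc N) z * partial_deriv b (partial_deriv b f) (x + R *\<^sub>R z))"
    if b: "b \<in> Basis" for b
  proof -
    let ?g = "partial_deriv b f"
    let ?G = "\<lambda>z. bump (Suc N) z * ?g (x + R *\<^sub>R z)"
    let ?G' = "\<lambda>z. real (Suc N) * bump N z * (- 2 * (z \<bullet> b)) * ?g (x + R *\<^sub>R z)
       + R * partial_deriv b ?g (x + R *\<^sub>R z) * bump (Suc N) z"
    have gd: "?g differentiable (at y)" for y using f b by simp
    have "(LBINT z. ?G' z) = 0"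
    proof (rule integral_directional_derivative_eq_0[of ?G ?G' b])
      show "continuous_on UNIV ?G"
        by (intro continuous_intros continuous_bump continuous_affine_compose cp b)
      show "continuous_on UNIV ?G'"
        by (intro continuous_intros continuous_bump continuous_affine_compose cp cpp b)
      show "((\<lambda>t. ?G (z + t *\<^sub>R b)) has_real_derivative ?G' (z + t *\<^sub>R b)) (at t)" for z t
      proof (rule DERIV_mult)
        have "bump (Suc N) differentiable (at y)" for y :: 'a
          using bump_has_derivative[OF N] differentiableI by blast
        from has_field_derivative_along_line[OF this, of z b t]
        show "((\<lambda>t. bump (Suc N) (z + t *\<^sub>R b)) has_real_derivative
            real (Suc N) * bump N (z + t *\<^sub>R b) * (- 2 * ((z + t *\<^sub>R b) \<bullet> b))) (at t)"
          unfolding partial_deriv_eq[OF bump_has_derivative[OF N]] sum_inner_Basis[OF b] .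
        have "((\<lambda>t. ?g ((x + R *\<^sub>R z) + t *\<^sub>R (R *\<^sub>R b))) has_real_derivative
            (\<Sum>c\<in>Basis. ((R *\<^sub>R b) \<bullet> c) * partial_deriv c ?g ((x + R *\<^sub>R z) + t *\<^sub>R (R *\<^sub>R b)))) (at t)"
          by (rule has_field_derivative_along_line[OF gd])
        moreover have "(\<Sum>c\<in>Basis. ((R *\<^sub>R b) \<bullet> c) * partial_deriv c ?g y) = R * partial_deriv b ?g y" for y
          by (simp add: mult.assoc sum_inner_Basis[OF b] flip: sum_distrib_left)
        moreover have "(x + R *\<^sub>R z) + t *\<^sub>R (R *\<^sub>R b) = x + R *\<^sub>R (z + t *\<^sub>R b)" for t
          by (simp add: algebra_simps)
        ultimately show "((\<lambda>t. ?g (x + R *\<^sub>R (z + t *\<^sub>R b))) has_real_derivative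
            R * partial_deriv b ?g (x + R *\<^sub>R (z + t *\<^sub>R b))) (at t)"
          by (simp only:)
      qed
    qed (use N b in \<open>auto simp: bump_eq_0\<close>)
    moreover have "integrable lborel (\<lambda>z. bump (Suc N) z * partial_deriv b ?g (x + R *\<^sub>R z))"
      by (rule integrable_continuous_compact_support[where r=1])
         (auto simp: bump_eq_0 intro!: continuous_on_mult continuous_bump continuous_affine_compose cpp b)
    moreover have "?G' = (\<lambda>z. - (2 * real (Suc N)) * (bump N z * ((z \<bullet> b) * ?g (x + R *\<^sub>R z)))
        + R * (bump (Suc N) z * partial_deriv b ?g (x + R *\<^sub>R z)))"
      by (rule ext) (simp add: algebra_simps)
    ultimately have "- (2 * real (Suc N)) * I b + R * (LBINT z. bump (Suc N) z * partial_deriv b ?g (x + R *\<^sub>R z)) = 0"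
      using int[OF b] by (simp add: I_def)
    then show ?thesis by (simp add: algebra_simps)
  qed
  have "bump_mean (Suc N) (neg_laplacian f) x R
     = - (\<Sum>b\<in>Basis. LBINT z. bump (Suc N) z * partial_deriv b (partial_deriv b f) (x + R *\<^sub>R z))"
  proof -
    have "bump_mean (Suc N) (neg_laplacian f) x R
        = (LBINT z. - (\<Sum>b\<in>Basis. bump (Suc N) z * partial_deriv b (partial_deriv b f) (x + R *\<^sub>R z)))"
      unfolding bump_mean_def
      by (intro Bochner_Integration.integral_cong refl) (simp add: neg_laplacian_def laplacian_def sum_distrib_left)
    moreover have "integrable lborel (\<lambda>z. bump (Suc N) z * partial_deriv b (partial_deriv b f) (x + R *\<^sub>R z))" if "b \<in> Basis" for b
      by (rule integrable_continuous_compact_support[where r=1])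
         (auto simp: bump_eq_0 intro!: continuous_on_mult continuous_bump continuous_affine_compose cpp that)
    ultimately show ?thesis by (simp add: Bochner_Integration.integral_sum)
  qed
  then have "- R * bump_mean (Suc N) (neg_laplacian f) x R = (\<Sum>b\<in>Basis. 2 * real (Suc N) * I b)"
    by (simp add: I_eq sum_distrib_left sum_negf del: of_nat_Suc)
  then have "(\<Sum>b\<in>Basis. I b) = - R / (2 * real (Suc N)) * bump_mean (Suc N) (neg_laplacian f) x R"
    by (simp add: field_simps sum_distrib_right del: of_nat_Suc)
  with D show ?thesis by (simp del: of_nat_Suc)
qed

lemma polynomial_antiderivative_times_id:
  fixes F :: "real \<Rightarrow> real"
  assumes "\<And>R. (F has_real_derivative R * (\<Sum>i\<le>n. c i * R ^ i)) (at R)"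
  shows "\<exists>n c. \<forall>R. F R = (\<Sum>i\<le>(n::nat). c i * R ^ i)"
proof -
  define Q where "Q R = (\<Sum>i\<le>n. c i / real (i + 2) * R ^ (i + 2))" for R
  have "(Q has_real_derivative R * (\<Sum>i\<le>n. c i * R ^ i)) (at R)" for R
    unfolding Q_def[abs_def]
    by (rule derivative_eq_intros refl | simp)+ (simp add: sum_distrib_left mult_ac)
  then have "((\<lambda>R. F R - Q R) has_real_derivative 0) (at R)" for R
    using DERIV_diff[OF assms] by fastforce
  then have const: "F R - Q R = F 0 - Q 0" for R
    using DERIV_isconst_all[of "\<lambda>R. F R - Q R"] by blast
  \<comment> \<open>The derivative of F carries a factor R, so F has no linear term and the
    coefficients move up by two places.\<close>
  define c' where "c' i = (if i = 0 then F 0 else if i = 1 then 0 else c (i - 2) / real i)" for i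
  have "(\<Sum>i\<le>Suc (Suc n). c' i * R ^ i) = F 0 + Q R" for R
    by (simp only: sum.atMost_Suc_shift Q_def) (simp add: c'_def add.commute)
  moreover have "Q 0 = 0" by (simp add: Q_def)
  ultimately have "F R = (\<Sum>i\<le>Suc (Suc n). c' i * R ^ i)" for R
    using const[of R] by simp
  then show ?thesis by blast
qed

text \<open>Differentiation in R trades the mean of f with exponent N for the mean of the Laplacian
  of f with exponent N + 1, which is why the induction on m runs over all N. It stops at the zero
  function.\<close>

lemma bump_mean_polyharmonic:
  fixes f :: "'a::euclidean_space \<Rightarrow> real"
  assumes "C_k (2 * m) f" "\<And>x. (neg_laplacian ^^ m) f x = 0" "0 < N"
  shows "\<exists>n c. \<forall>R. bump_mean N f x R = (\<Sum>i\<le>(n::nat). c i * R ^ i)"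
  using assms
proof (induction m arbitrary: f N)
  case 0
  then show ?case by (intro exI[of _ 0] exI[of _ "\<lambda>_. 0"]) (simp add: bump_mean_def)
next
  case (Suc m)
  have C: "C_k (Suc (Suc (2 * m))) f" using Suc.prems(1) by (simp del: C_k.simps)
  have "\<exists>n c. \<forall>R. bump_mean (Suc N) (neg_laplacian f) x R = (\<Sum>i\<le>(n::nat). c i * R ^ i)"
    using Suc.prems by (intro Suc.IH C_k_neg_laplacian[OF C]) (simp_all add: funpow_swap1)
  then obtain n c where c: "\<And>R. bump_mean (Suc N) (neg_laplacian f) x R = (\<Sum>i\<le>(n::nat). c i * R ^ i)"
    by blast
  show ?case
  proof (rule polynomial_antiderivative_times_id)
    fix R
    show "(bump_mean N f x has_real_derivative R * (\<Sum>i\<le>n. (- c i / (2 * real (Suc N))) * R ^ i)) (at R)"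
      using bump_mean_DERIV[OF C Suc.prems(3), of x R] unfolding c
      by (simp add: sum_distrib_left sum_negf sum_divide_distrib mult_ac del: of_nat_Suc)
  qed
qed

lemma polyharmonic_eq_0:
  fixes f :: "'a::euclidean_space \<Rightarrow> real"
  assumes f: "C_k (2 * m) f" "\<And>x. (neg_laplacian ^^ m) f x = 0" and N: "0 < N"
    and lim: "(bump_mean N f x \<longlongrightarrow> 0) at_top"
  shows "f x = 0"
proof -
  obtain n c where c: "\<And>R. bump_mean N f x R = (\<Sum>i\<le>(n::nat). c i * R ^ i)"
    using bump_mean_polyharmonic[OF f N] by blast
  have c0: "c k = 0" if k: "k \<noteq> 0" "k \<le> n" for k
  proof (rule ccontr)
    assume "c k \<noteq> 0"
    then have "eventually (\<lambda>R. 1 \<le> norm (\<Sum>i\<le>n. c i * R ^ i)) at_infinity"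
      using k by (intro polyfun_extremal) blast
    then have "eventually (\<lambda>R. 1 \<le> norm (bump_mean N f x R)) at_top"
      unfolding c by (rule filter_leD[OF at_top_le_at_infinity])
    moreover have "eventually (\<lambda>R. norm (bump_mean N f x R) < 1) at_top"
      using lim by (intro order_tendstoD(2)[OF tendsto_norm]) auto
    ultimately have "eventually (\<lambda>R::real. False) at_top" by eventually_elim simp
    then show False by simp
  qed
  have const: "bump_mean N f x R = c 0" for R
  proof -
    have "(\<Sum>i\<le>n. c i * R ^ i) = (\<Sum>i\<in>{0}. c i * R ^ i)"
      using c0 by (intro sum.mono_neutral_right) auto
    then show ?thesis by (simp add: c)
  qed
  then have "bump_mean N f x = (\<lambda>_. c 0)" by blast
  with lim have "((\<lambda>_::real. c 0) \<longlongrightarrow> 0) at_top" by simp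
  then have "bump_mean N f x 0 = 0" unfolding const by (simp add: tendsto_const_iff)
  then have "f x * (\<integral>z. bump N z \<partial>(lborel :: 'a measure)) = 0"
    by (simp add: bump_mean_def mult.commute)
  moreover have "(\<integral>z. bump N z \<partial>(lborel :: 'a measure)) \<noteq> 0"
  proof
    assume "(\<integral>z. bump N z \<partial>(lborel :: 'a measure)) = 0"
    moreover have "integrable lborel (bump N :: 'a \<Rightarrow> real)"
      by (rule integrable_continuous_compact_support[where r=1]) (auto simp: bump_eq_0 N continuous_bump)
    ultimately have "AE z in lborel. bump N (z::'a) = 0"
      using integral_nonneg_eq_0_iff_AE[of lborel "bump N :: 'a \<Rightarrow> real"] bump_nonneg by auto
    then have "AE z in lborel. z \<notin> ball (0::'a) 1"
    proof eventually_elim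
      case (elim z)
      show ?case
      proof
        assume "z \<in> ball 0 1"
        then have "0 < 1 - z \<bullet> z" using one_le_inner_self_iff[of z] by simp
        then have "0 < bump N z" by (simp add: bump_def)
        with elim show False by simp
      qed
    qed
    then have "emeasure lborel (ball (0::'a) 1) = 0"
      by (subst (asm) AE_iff_measurable[of "ball 0 1"]) auto
    moreover have "emeasure lborel (ball (0::'a) 1) = ennreal (unit_ball_vol (real DIM('a)))"
      by (subst emeasure_ball) auto
    ultimately show False
      using unit_ball_vol_pos[of "real DIM('a)"] by (simp add: ennreal_eq_0_iff del: unit_ball_vol_pos)
  qed
  ultimately show ?thesis by simp
qed

section \<open>Decay of the means of a fractional Laplacian\<close>

text \<open>The derivative 2 max(0, t) of max(0, t)^2 is Lipschitz with constant 2, so the first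
  order Taylor remainder is at most the square of the increment, also across the kink.\<close>

lemma max_power2_taylor:
  fixes a c :: real
  shows "\<bar>max 0 a ^ 2 - max 0 c ^ 2 - 2 * max 0 c * (a - c)\<bar> \<le> (a - c) ^ 2"
proof -
  consider "0 \<le> a" "0 \<le> c" | "a < 0" "0 \<le> c" | "0 \<le> a" "c < 0" | "a < 0" "c < 0" by linarith
  then show ?thesis
  proof cases
    case 1
    have "a ^ 2 - c ^ 2 - 2 * c * (a - c) = (a - c) ^ 2" by (simp add: power2_eq_square algebra_simps)
    then show ?thesis using 1 by (simp add: max_def)
  next
    case 2
    have "a * c \<le> 0" using 2 by (simp add: mult_nonpos_nonneg)
    moreover have "max 0 a ^ 2 - max 0 c ^ 2 - 2 * max 0 c * (a - c) = c ^ 2 - 2 * (a * c)"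
      using 2 by (simp add: max_def) (simp add: power2_eq_square algebra_simps)
    moreover have "(a - c) ^ 2 = c ^ 2 - 2 * (a * c) + a ^ 2"
      by (simp add: power2_eq_square algebra_simps)
    ultimately show ?thesis
      using zero_le_power2[of a] zero_le_power2[of c] by linarith
  next
    case 3
    then have "a ^ 2 \<le> (a - c) ^ 2" by (intro power_mono) auto
    then show ?thesis using 3 by (simp add: max_def)
  qed (simp add: max_def)
qed

text \<open>The constant is 54 = 25 + 25 + 4. Since |z| \<le> 2, the argument 1 - |z|^2 changes by
  at most 5 |h| in either direction, so each of the two Taylor remainders is at most 25 |h|^2. The
  first order terms add up to 2 max(0, c) (a + b - 2 c) with c \<le> 1 and a + b - 2 c = -2
  |h|^2.\<close>

lemma bump_second_diff_bound:
  fixes z h :: "'a::euclidean_space"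
  assumes z: "norm z \<le> 2" and h: "norm h \<le> 1"
  shows "\<bar>second_diff (bump 2) z h\<bar> \<le> 54 * norm h ^ 2"
proof -
  define a where "a = 1 - (z + h) \<bullet> (z + h)"
  define b where "b = 1 - (z - h) \<bullet> (z - h)"
  define c where "c = 1 - z \<bullet> z"
  have ac: "a - c = - 2 * (z \<bullet> h) - h \<bullet> h" and bc: "b - c = 2 * (z \<bullet> h) - h \<bullet> h"
    by (simp_all add: a_def b_def c_def inner_add inner_diff inner_commute algebra_simps)
  have zh: "\<bar>z \<bullet> h\<bar> \<le> 2 * norm h"
    using Cauchy_Schwarz_ineq2[of z h] mult_right_mono[OF z, of "norm h"] by simp
  have hh: "h \<bullet> h \<le> norm h"
    using h by (simp add: power2_norm_eq_inner[symmetric] power2_eq_square mult_left_le)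
  have hh0: "0 \<le> h \<bullet> h" by simp
  have "\<bar>a - c\<bar> \<le> 5 * norm h" "\<bar>b - c\<bar> \<le> 5 * norm h"
    unfolding ac bc using zh hh hh0 by linarith+
  then have sq: "(a - c) ^ 2 \<le> (5 * norm h) ^ 2" "(b - c) ^ 2 \<le> (5 * norm h) ^ 2"
    by (metis abs_ge_zero power2_abs power_mono)+
  have "\<bar>2 * max 0 c * (a + b - 2 * c)\<bar> \<le> 2 * (2 * (h \<bullet> h))"
  proof -
    have "a + b - 2 * c = - 2 * (h \<bullet> h)" using ac bc by simp
    moreover have "0 \<le> max 0 c" "max 0 c \<le> 1" by (auto simp: c_def)
    ultimately show ?thesis using mult_right_mono[of "max 0 c" 1 "h \<bullet> h"] by (simp add: abs_mult)
  qed
  moreover have "second_diff (bump 2) z h = - (max 0 a ^ 2 - max 0 c ^ 2 - 2 * max 0 c * (a - c))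
     - (max 0 b ^ 2 - max 0 c ^ 2 - 2 * max 0 c * (b - c)) - 2 * max 0 c * (a + b - 2 * c)"
    by (simp add: second_diff_def bump_def a_def[symmetric] b_def[symmetric] c_def[symmetric]) (simp add: algebra_simps)
  ultimately have "\<bar>second_diff (bump 2) z h\<bar> \<le> (a - c) ^ 2 + (b - c) ^ 2 + 4 * (h \<bullet> h)"
    using max_power2_taylor[of a c] max_power2_taylor[of b c] by linarith
  then show ?thesis using sq by (simp add: power_mult_distrib power2_norm_eq_inner)
qed

lemma bump_second_diff_le_2: "\<bar>second_diff (bump N) z h\<bar> \<le> 2"
  using bump_nonneg[of N z] bump_nonneg[of N "z + h"] bump_nonneg[of N "z - h"]
    bump_le_1[of N z] bump_le_1[of N "z + h"] bump_le_1[of N "z - h"]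
  unfolding second_diff_def by linarith

lemma integrable_singular_kernel_near:
  assumes "\<alpha> < \<beta>"
  shows "integrable lborel (\<lambda>h::'a::euclidean_space. indicator {h. norm h < 1} h * (norm h powr \<beta> * norm h powr - (real DIM('a) + \<alpha>)))"
  using integrable_norm_powr_inside[of "\<beta> - \<alpha>", where 'a='a] assms
  by (simp add: powr_add[symmetric] algebra_simps)

text \<open>For |z| < 2 the quadratic bound near h = 0 and the bound 2 elsewhere give a constant.
  For |z| \<ge> 2 the second difference only sees the weight at z + h and z - h; these lie in the
  unit ball only if |h| \<ge> |z| - 1 \<ge> (1 + |z|) / 3, so the kernel is at most 3^s (1 +
  |z|)^(-s) there, with s = n + \<alpha>.\<close>

lemma bump_second_diff_kernel_bound:
  fixes \<alpha> :: real
  assumes \<alpha>: "0 < \<alpha>" "\<alpha> < 2"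
  shows "\<exists>C\<ge>0. \<forall>z::'a::euclidean_space.
    integrable lborel (\<lambda>h. \<bar>second_diff (bump 2) z h\<bar> * norm h powr - (real DIM('a) + \<alpha>)) \<and>
    (LBINT h. \<bar>second_diff (bump 2) z h\<bar> * norm h powr - (real DIM('a) + \<alpha>))
      \<le> C * (1 + norm z) powr - (real DIM('a) + \<alpha>)"
proof -
  let ?s = "real DIM('a) + \<alpha>"
  let ?F = "\<lambda>z h::'a. \<bar>second_diff (bump 2) z h\<bar> * norm h powr - ?s"
  have s: "0 < ?s" using \<alpha> by (simp add: add_nonneg_pos)
  define g where "g h = 54 * (indicator {h::'a. norm h < 1} h * (norm h powr 2 * norm h powr - ?s))
      + 2 * (indicator {h. 1 \<le> norm h} h * norm h powr - ?s)" for h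
  have g: "integrable lborel g"
    unfolding g_def[abs_def] using \<alpha>
    by (intro Bochner_Integration.integrable_add integrable_mult_right
        integrable_singular_kernel_near integrable_norm_powr_outside)
  define A where "A = (LBINT h. g h)"
  have A: "0 \<le> A" unfolding A_def by (rule Bochner_Integration.integral_nonneg) (simp add: g_def)
  have bi: "integrable lborel (bump 2 :: 'a \<Rightarrow> real)"
    by (rule integrable_continuous_compact_support[where r=1]) (auto simp: bump_eq_0 continuous_bump)
  have bm [measurable]: "(bump 2 :: 'a \<Rightarrow> real) \<in> borel_measurable borel"
    by (rule borel_measurable_continuous_onI[OF continuous_bump])
  define J where "J = (\<integral>z. bump 2 z \<partial>(lborel :: 'a measure))"
  have J: "0 \<le> J" unfolding J_def by (rule Bochner_Integration.integral_nonneg) (rule bump_nonneg)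
  have Fm: "?F z \<in> borel_measurable lborel" for z
    using borel_measurable_second_diff[OF continuous_bump, of 2 z] by simp
  have "integrable lborel (?F z) \<and> (LBINT h. ?F z h) \<le> 3 powr ?s * (A + 2 * J) * (1 + norm z) powr - ?s" for z
  proof (cases "norm z < 2")
    case True
    have le: "?F z h \<le> g h" for h
    proof (cases "norm h < 1")
      case h: True
      have "\<bar>second_diff (bump 2) z h\<bar> \<le> 54 * norm h powr 2"
        using bump_second_diff_bound[of z h] True h by (simp add: powr_numeral)
      from mult_right_mono[OF this, of "norm h powr - ?s"] show ?thesis
        using h by (simp add: g_def mult.assoc)
    next
      case h: False
      then show ?thesis using mult_right_mono[OF bump_second_diff_le_2[of 2 z h], of "norm h powr - ?s"]
        by (simp add: g_def)
    qed
    have int: "integrable lborel (?F z)"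
    proof (rule Bochner_Integration.integrable_bound[OF g Fm], rule AE_I2)
      show "norm (?F z h) \<le> norm (g h)" for h
        using order_trans[OF le[of h] abs_ge_self] by simp
    qed
    have "(LBINT h. ?F z h) \<le> A"
      unfolding A_def by (rule integral_mono[OF int g le])
    also have "A \<le> A * (3 powr ?s * (1 + norm z) powr - ?s)"
    proof -
      have "3 powr - ?s \<le> (1 + norm z) powr - ?s"
        using True s by (intro powr_mono2') (auto intro: add_pos_nonneg)
      then have "3 powr ?s * 3 powr - ?s \<le> 3 powr ?s * (1 + norm z) powr - ?s"
        by (intro mult_left_mono) auto
      then have "1 \<le> 3 powr ?s * (1 + norm z) powr - ?s"
        unfolding powr_add[symmetric] by simp
      from mult_left_mono[OF this A] show ?thesis by simp
    qed
    also have "\<dots> \<le> (A + 2 * J) * (3 powr ?s * (1 + norm z) powr - ?s)"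
      using J by (intro mult_right_mono) auto
    finally have "(LBINT h. ?F z h) \<le> (A + 2 * J) * (3 powr ?s * (1 + norm z) powr - ?s)" .
    with int show ?thesis by (simp add: mult_ac)
  next
    case False
    let ?c = "3 powr ?s * (1 + norm z) powr - ?s"
    have far: "norm h powr - ?s \<le> ?c" if "norm z - 1 \<le> norm h" for h :: 'a
    proof -
      have "(1 + norm z) / 3 \<le> norm h" using that False by simp
      then have "norm h powr - ?s \<le> ((1 + norm z) / 3) powr - ?s"
        using s by (intro powr_mono2') (auto intro: add_pos_nonneg)
      also have "\<dots> = (1 + norm z) powr - ?s / 3 powr - ?s"
        by (rule powr_divide)
      also have "\<dots> = ?c" by (simp only: powr_minus_divide powr_minus divide_inverse inverse_inverse_eq mult.commute mult_1 inverse_eq_divide[symmetric])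
      finally show ?thesis .
    qed
    have le: "?F z h \<le> ?c * (bump 2 (z + h) + bump 2 (z - h))" for h
    proof -
      have "bump 2 z = 0" using False by (intro bump_eq_0) auto
      then have abs: "\<bar>second_diff (bump 2) z h\<bar> = bump 2 (z + h) + bump 2 (z - h)"
        using bump_nonneg[of 2 "z + h"] bump_nonneg[of 2 "z - h"] by (simp add: second_diff_def)
      show ?thesis
      proof (cases "norm z - 1 \<le> norm h")
        case True
        from mult_left_mono[OF far[OF True], of "bump 2 (z + h) + bump 2 (z - h)"] show ?thesis
          unfolding abs using bump_nonneg[of 2 "z + h"] bump_nonneg[of 2 "z - h"] by (simp add: mult_ac)
      next
        case F: False
        have "1 \<le> norm (z + h)" "1 \<le> norm (z - h)"
          using F norm_triangle_ineq4[of "z + h" h] norm_triangle_ineq[of "z - h" h] by auto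
        then show ?thesis unfolding abs by (simp add: bump_eq_0)
      qed
    qed
    have gi: "integrable lborel (\<lambda>h. ?c * (bump 2 (z + h) + bump 2 (z - h)))"
      using integrable_lborel_shift_iff[OF bm, of z] integrable_lborel_reflect_iff[OF bm, of z] bi
      by (intro integrable_mult_right Bochner_Integration.integrable_add) auto
    have int: "integrable lborel (?F z)"
    proof (rule Bochner_Integration.integrable_bound[OF gi Fm], rule AE_I2)
      show "norm (?F z h) \<le> norm (?c * (bump 2 (z + h) + bump 2 (z - h)))" for h
        using order_trans[OF le[of h] abs_ge_self] by simp
    qed
    have "(LBINT h. ?F z h) \<le> (LBINT h. ?c * (bump 2 (z + h) + bump 2 (z - h)))"
      by (rule integral_mono[OF int gi le])
    also have "\<dots> = ?c * (2 * J)"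
      using integrable_lborel_shift_iff[OF bm, of z] integrable_lborel_reflect_iff[OF bm, of z] bi
      by (simp add: integral_lborel_shift[OF bm] integral_lborel_reflect[OF bm] J_def)
    also have "\<dots> \<le> ?c * (A + 2 * J)"
      using A by (intro mult_left_mono) auto
    finally show ?thesis using int by (simp add: mult_ac)
  qed
  then show ?thesis using A J by (intro exI[of _ "3 powr ?s * (A + 2 * J)"]) auto
qed

text \<open>Supplies the absolute integrability on products that Fubini's theorem demands. The
  regularity of u controls small h; the weighted integral of u, transported to x by Peetre's
  inequality, controls large h.\<close>

lemma second_diff_kernel_locally_bounded:
  fixes u :: "'a::euclidean_space \<Rightarrow> real" and \<alpha> :: real
  defines "s \<equiv> real DIM('a) + \<alpha>"
  assumes \<alpha>: "0 < \<alpha>" and u: "continuous_on UNIV u" "integrable lborel (\<lambda>y. \<bar>u y\<bar> * (1 + norm y) powr - s)"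
    and sd: "second_diff_loc \<beta> u" "\<alpha> < \<beta>"
    and int: "\<And>x. integrable lborel (\<lambda>h. second_diff u x h * norm h powr - s)"
  shows "\<exists>B. \<forall>x. norm x \<le> r \<longrightarrow> (LBINT h. \<bar>second_diff u x h * norm h powr - s\<bar>) \<le> B"
proof -
  have s: "0 < s" using \<alpha> by (simp add: s_def add_nonneg_pos)
  have um [measurable]: "u \<in> borel_measurable borel" using u(1) by (rule borel_measurable_continuous_onI)
  obtain C where C: "0 \<le> C" "\<And>x h. norm x \<le> r \<Longrightarrow> norm h \<le> 1 \<Longrightarrow> \<bar>second_diff u x h\<bar> \<le> C * norm h powr \<beta>"
    using sd(1) unfolding second_diff_loc_def by metis
  obtain B where B: "0 \<le> B" "\<And>x. norm x \<le> r \<Longrightarrow> \<bar>u x\<bar> \<le> B"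
    using continuous_bounded_cball[OF u(1)] by metis
  let ?w = "\<lambda>h::'a. (1 + norm h) powr - s"
  have wc: "continuous_on UNIV ?w"
    by (intro continuous_intros) (auto simp: add_nonneg_eq_0_iff)
  note fi = far_integrable[of "\<lambda>y. \<bar>u y\<bar>" s ?w 1, simplified, OF u(2) less_imp_le[OF s] wc]
  define I where "I = (LBINT h. indicator {h::'a. norm h < 1} h * (norm h powr \<beta> * norm h powr - s))"
  define J where "J = (\<integral>h. ?w h \<partial>(lborel :: 'a measure))"
  define W where "W = (1 + r) powr s * (LBINT y. \<bar>u y\<bar> * ?w y)"
  have Ii: "integrable lborel (\<lambda>h::'a. indicator {h. norm h < 1} h * (norm h powr \<beta> * norm h powr - s))"
    unfolding s_def by (rule integrable_singular_kernel_near[OF sd(2)])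
  have Ji: "integrable lborel ?w" unfolding s_def by (rule integrable_weight[OF \<alpha>])
  have "(LBINT h. \<bar>second_diff u x h * norm h powr - s\<bar>) \<le> C * I + 2 powr s * (2 * B * J + (W + W))" if x: "norm x \<le> r" for x
  proof -
    let ?G = "\<lambda>h. C * (indicator {h. norm h < 1} h * (norm h powr \<beta> * norm h powr - s))
       + 2 powr s * (2 * B * ?w h + (\<bar>u (x + h)\<bar> * ?w h + \<bar>u (x - h)\<bar> * ?w h))"
    have m: "(\<lambda>y. \<bar>u y\<bar> * ?w (x - y)) \<in> borel_measurable borel" by measurable
    have p: "integrable lborel (\<lambda>h. \<bar>u (x + h)\<bar> * ?w h)" "(LBINT h. \<bar>u (x + h)\<bar> * ?w h) = (LBINT y. \<bar>u y\<bar> * ?w (x - y))"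
      using integrable_lborel_shift_iff[OF m, of x] integral_lborel_shift[OF m, of x] fi(1)[of x] by simp_all
    have q: "integrable lborel (\<lambda>h. \<bar>u (x - h)\<bar> * ?w h)" "(LBINT h. \<bar>u (x - h)\<bar> * ?w h) = (LBINT y. \<bar>u y\<bar> * ?w (x - y))"
      using integrable_lborel_reflect_iff[OF m, of x] integral_lborel_reflect[OF m, of x] fi(1)[of x] by simp_all
    have W: "(LBINT y. \<bar>u y\<bar> * ?w (x - y)) \<le> W"
    proof -
      have "(LBINT y. \<bar>u y\<bar> * ?w (x - y)) \<le> (LBINT y. (1 + r) powr s * (\<bar>u y\<bar> * ?w y))"
        using fi(2)[OF x] by (intro integral_mono fi(1) integrable_mult_right u(2)) (simp add: abs_mult)
      then show ?thesis by (simp add: W_def)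
    qed
    have G: "integrable lborel ?G"
      by (intro Bochner_Integration.integrable_add integrable_mult_right Ii Ji p q)
    have "(LBINT h. \<bar>second_diff u x h * norm h powr - s\<bar>) \<le> (LBINT h. ?G h)"
    proof (rule integral_mono[OF integrable_abs[OF int] G])
      fix h :: 'a
      show "\<bar>second_diff u x h * norm h powr - s\<bar> \<le> ?G h"
      proof (cases "norm h < 1")
        case True
        have "\<bar>second_diff u x h\<bar> * norm h powr - s \<le> C * norm h powr \<beta> * norm h powr - s"
          using C(2)[OF x, of h] True by (intro mult_right_mono) auto
        moreover have "0 \<le> 2 powr s * (2 * B * ?w h + (\<bar>u (x + h)\<bar> * ?w h + \<bar>u (x - h)\<bar> * ?w h))"
          using B(1) by simp
        ultimately show ?thesis using True by (simp add: abs_mult mult.assoc)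
      next
        case False
        then have k: "norm h powr - s \<le> 2 powr s * ?w h"
          using powr_minus_le_weight[of 1 h s] s by simp
        have "\<bar>second_diff u x h\<bar> \<le> 2 * B + (\<bar>u (x + h)\<bar> + \<bar>u (x - h)\<bar>)"
          using B(2)[OF x] unfolding second_diff_def by linarith
        then have "\<bar>second_diff u x h\<bar> * norm h powr - s \<le> (2 * B + (\<bar>u (x + h)\<bar> + \<bar>u (x - h)\<bar>)) * (2 powr s * ?w h)"
          using B(1) by (intro mult_mono k) auto
        then show ?thesis using False by (simp add: abs_mult algebra_simps)
      qed
    qed
    also have "(LBINT h. ?G h) = C * I + 2 powr s * (2 * B * J + ((LBINT y. \<bar>u y\<bar> * ?w (x - y)) + (LBINT y. \<bar>u y\<bar> * ?w (x - y))))"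
      using Ii Ji p q by (simp add: I_def J_def)
    also have "\<dots> \<le> C * I + 2 powr s * (2 * B * J + (W + W))"
      using W by (intro add_left_mono mult_left_mono add_mono) auto
    finally show ?thesis .
  qed
  then show ?thesis by blast
qed

text \<open>For a fixed h nothing is singular: translation invariance moves each shift from U to the
  weight, and h and -h trade places.\<close>

lemma integral_bump_second_diff_swap:
  fixes U :: "'a::euclidean_space \<Rightarrow> real"
  assumes U: "continuous_on UNIV U"
  shows "(LBINT z. bump 2 z * second_diff U z h) = (LBINT z. U z * second_diff (bump 2) z h)"
proof -
  have Um [measurable]: "U \<in> borel_measurable borel" using U by (rule borel_measurable_continuous_onI)
  have bm [measurable]: "(bump 2 :: 'a \<Rightarrow> real) \<in> borel_measurable borel"
    by (rule borel_measurable_continuous_onI[OF continuous_bump])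
  have i: "integrable lborel (\<lambda>z. bump 2 z * U (z + c))" for c
    using continuous_affine_compose[OF U, of c 1]
    by (intro integrable_continuous_compact_support[where r=1] continuous_on_mult continuous_bump)
       (auto simp: bump_eq_0 add.commute)
  have sh: "integrable lborel (\<lambda>z. U z * bump 2 (z + c))" "(LBINT z. U z * bump 2 (z + c)) = (LBINT z. bump 2 z * U (z + (- c)))" for c
  proof -
    have m: "(\<lambda>z. bump 2 z * U (z + (- c))) \<in> borel_measurable borel" by measurable
    show "integrable lborel (\<lambda>z. U z * bump 2 (z + c))"
      using i[of "- c"] integrable_lborel_shift_iff[OF m, of c] by (simp add: algebra_simps)
    show "(LBINT z. U z * bump 2 (z + c)) = (LBINT z. bump 2 z * U (z + (- c)))"
      using integral_lborel_shift[OF m, of c] by (simp add: algebra_simps)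
  qed
  have "(LBINT z. bump 2 z * second_diff U z h)
      = (LBINT z. 2 * (bump 2 z * U (z + 0)) - bump 2 z * U (z + h) - bump 2 z * U (z + (- h)))"
    by (intro Bochner_Integration.integral_cong refl) (simp add: second_diff_def algebra_simps)
  also have "\<dots> = 2 * (LBINT z. bump 2 z * U (z + 0)) - (LBINT z. bump 2 z * U (z + h)) - (LBINT z. bump 2 z * U (z + (- h)))"
    using i by (simp only: Bochner_Integration.integral_diff Bochner_Integration.integrable_diff integrable_mult_right integral_mult_right_zero)
  also have "\<dots> = 2 * (LBINT z. U z * bump 2 (z + 0)) - (LBINT z. U z * bump 2 (z + h)) - (LBINT z. U z * bump 2 (z + (- h)))"
    by (simp only: sh(2) minus_minus minus_zero)
  also have "\<dots> = (LBINT z. 2 * (U z * bump 2 (z + 0)) - U z * bump 2 (z + h) - U z * bump 2 (z + (- h)))"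
    using sh(1) by (simp only: Bochner_Integration.integral_diff Bochner_Integration.integrable_diff integrable_mult_right integral_mult_right_zero)
  also have "\<dots> = (LBINT z. U z * second_diff (bump 2) z h)"
    by (intro Bochner_Integration.integral_cong refl) (simp add: second_diff_def algebra_simps)
  finally show ?thesis .
qed

text \<open>No integrability is assumed: a non-integrable function has integral 0 by
  convention.\<close>

lemma ennreal_abs_integral_le: "ennreal \<bar>\<integral>x. f x \<partial>M\<bar> \<le> (\<integral>\<^sup>+x. ennreal \<bar>f x\<bar> \<partial>M)"
proof (cases "integrable M f")
  case True
  then show ?thesis using integral_norm_bound_ennreal[OF True] by simp
qed (simp add: not_integrable_integral_eq)

text \<open>The operator is moved from U to the weight in three moves: Fubini brings the integral in
  h outside, the second difference is swapped at fixed h, and after taking absolute values Tonelli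
  brings the integral in z outside again. The bound B only justifies the first exchange and does not
  enter the estimate, which therefore scales well.\<close>

lemma bump_duality_bound:
  fixes U :: "'a::euclidean_space \<Rightarrow> real" and \<alpha> :: real
  defines "s \<equiv> real DIM('a) + \<alpha>"
  assumes U: "continuous_on UNIV U" "integrable lborel (\<lambda>y. \<bar>U y\<bar> * (1 + norm y) powr - s)"
    and int: "\<And>x. integrable lborel (\<lambda>h. second_diff U x h * norm h powr - s)"
    and B: "\<And>x. norm x \<le> 1 \<Longrightarrow> (LBINT h. \<bar>second_diff U x h * norm h powr - s\<bar>) \<le> B"
    and C: "0 \<le> C" "\<And>z::'a. integrable lborel (\<lambda>h. \<bar>second_diff (bump 2) z h\<bar> * norm h powr - s)"
      "\<And>z::'a. (LBINT h. \<bar>second_diff (bump 2) z h\<bar> * norm h powr - s) \<le> C * (1 + norm z) powr - s"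
  shows "\<bar>LBINT z. bump 2 z * (LBINT h. second_diff U z h * norm h powr - s)\<bar>
    \<le> C * (LBINT z. \<bar>U z\<bar> * (1 + norm z) powr - s)"
proof -
  let ?k = "\<lambda>h::'a. norm h powr - s"
  have Um [measurable]: "U \<in> borel_measurable borel" using U(1) by (rule borel_measurable_continuous_onI)
  have bm [measurable]: "(bump 2 :: 'a \<Rightarrow> real) \<in> borel_measurable borel"
    by (rule borel_measurable_continuous_onI[OF continuous_bump])
  define F where "F z h = bump 2 z * (second_diff U z h * ?k h)" for z h
  have Fm [measurable]: "case_prod F \<in> borel_measurable (lborel \<Otimes>\<^sub>M lborel)"
    unfolding F_def[abs_def] second_diff_def by measurable
  have absF: "(LBINT h. norm (F z h)) = bump 2 z * (LBINT h. \<bar>second_diff U z h * ?k h\<bar>)" for z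
    using bump_nonneg[of 2 z] by (simp add: F_def abs_mult)
  have "integrable (lborel \<Otimes>\<^sub>M lborel) (case_prod F)"
  proof (rule lborel_pair.Fubini_integrable)
    show "integrable lborel (\<lambda>z. LBINT h. norm (case_prod F (z, h)))"
    proof (rule Bochner_Integration.integrable_bound)
      show "integrable lborel (\<lambda>z. B * indicator (cball (0::'a) 1) z)"
        by (intro integrable_mult_right integrable_real_indicator)
           (use emeasure_bounded_finite[OF bounded_cball] in simp_all)
      show "(\<lambda>z. LBINT h. norm (case_prod F (z, h))) \<in> borel_measurable lborel"
        by measurable
      have "norm (LBINT h. norm (F z h)) \<le> norm (B * indicator (cball 0 1) z)" for z
      proof (cases "norm z \<le> 1")
        case True
        have I: "0 \<le> (LBINT h. \<bar>second_diff U z h * ?k h\<bar>)"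
          by (rule Bochner_Integration.integral_nonneg) simp
        have "bump 2 z * (LBINT h. \<bar>second_diff U z h * ?k h\<bar>) \<le> 1 * B"
          using bump_nonneg bump_le_1 B[OF True] I by (intro mult_mono) auto
        then show ?thesis unfolding absF using True bump_nonneg[of 2 z] I by (simp add: abs_mult)
      next
        case False
        then show ?thesis unfolding absF by (simp add: bump_eq_0)
      qed
      then show "AE z in lborel. norm (LBINT h. norm (case_prod F (z, h))) \<le> norm (B * indicator (cball 0 1) z)"
        by simp
    qed
    show "AE z in lborel. integrable lborel (\<lambda>h. case_prod F (z, h))"
      using int by (simp add: F_def)
  qed simp
  then have Fub: "(LBINT h. (LBINT z. F z h)) = (LBINT z. (LBINT h. F z h))"
    by (rule lborel_pair.Fubini_integral)
  define P where "P z h = \<bar>U z\<bar> * (\<bar>second_diff (bump 2) z h\<bar> * ?k h)" for z h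
  have Pm [measurable]: "case_prod P \<in> borel_measurable (lborel \<Otimes>\<^sub>M lborel)"
    unfolding P_def[abs_def] second_diff_def by measurable
  have inner: "ennreal \<bar>LBINT z. F z h\<bar> \<le> (\<integral>\<^sup>+z. ennreal (P z h) \<partial>lborel)" for h
  proof -
    have "(LBINT z. F z h) = (LBINT z. bump 2 z * second_diff U z h) * ?k h"
      by (simp add: F_def flip: mult.assoc)
    also have "\<dots> = (LBINT z. (U z * second_diff (bump 2) z h) * ?k h)"
      unfolding integral_bump_second_diff_swap[OF U(1)] by simp
    finally have eq: "(LBINT z. F z h) = (LBINT z. (U z * second_diff (bump 2) z h) * ?k h)" .
    show ?thesis
      unfolding eq by (rule order_trans[OF ennreal_abs_integral_le]) (simp add: P_def abs_mult mult.assoc)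
  qed
  have "ennreal \<bar>LBINT z. (LBINT h. F z h)\<bar> \<le> (\<integral>\<^sup>+h. ennreal \<bar>LBINT z. F z h\<bar> \<partial>lborel)"
    unfolding Fub[symmetric] by (rule ennreal_abs_integral_le)
  also have "\<dots> \<le> (\<integral>\<^sup>+h. (\<integral>\<^sup>+z. ennreal (P z h) \<partial>lborel) \<partial>lborel)"
    by (intro nn_integral_mono inner)
  also have "\<dots> = (\<integral>\<^sup>+z. (\<integral>\<^sup>+h. ennreal (P z h) \<partial>lborel) \<partial>lborel)"
    by (rule lborel_pair.Fubini') measurable
  also have "\<dots> \<le> (\<integral>\<^sup>+z. ennreal (C * (\<bar>U z\<bar> * (1 + norm z) powr - s)) \<partial>lborel)"
  proof (rule nn_integral_mono)
    fix z :: 'a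
    have "(\<integral>\<^sup>+h. ennreal (P z h) \<partial>lborel) = ennreal (LBINT h. P z h)"
      by (rule nn_integral_eq_integral) (auto simp: P_def intro!: integrable_mult_right C(2))
    also have "(LBINT h. P z h) \<le> \<bar>U z\<bar> * (C * (1 + norm z) powr - s)"
      using C(3)[of z] by (simp add: P_def mult_left_mono)
    finally show "(\<integral>\<^sup>+h. ennreal (P z h) \<partial>lborel) \<le> ennreal (C * (\<bar>U z\<bar> * (1 + norm z) powr - s))"
      by (simp add: mult_ac ennreal_leI)
  qed
  also have "\<dots> = ennreal (LBINT z. C * (\<bar>U z\<bar> * (1 + norm z) powr - s))"
    using C(1) by (intro nn_integral_eq_integral integrable_mult_right U(2)) auto
  finally have "\<bar>LBINT z. (LBINT h. F z h)\<bar> \<le> (LBINT z. C * (\<bar>U z\<bar> * (1 + norm z) powr - s))"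
    using C(1) by (subst (asm) ennreal_le_iff) (auto intro!: Bochner_Integration.integral_nonneg)
  then show ?thesis by (simp add: F_def)
qed

lemma bump_mean_fractional_decay:
  fixes u :: "'a::euclidean_space \<Rightarrow> real" and \<alpha> :: real
  defines "s \<equiv> real DIM('a) + \<alpha>"
  defines "v \<equiv> (\<lambda>x. LBINT h. second_diff u x h * norm h powr - s)"
  assumes \<alpha>: "0 < \<alpha>" "\<alpha> < 2" and u: "continuous_on UNIV u" "integrable lborel (\<lambda>y. \<bar>u y\<bar> * (1 + norm y) powr - s)"
    and sd: "second_diff_loc \<beta> u" "\<alpha> < \<beta>"
    and int: "\<And>x. integrable lborel (\<lambda>h. second_diff u x h * norm h powr - s)"
  shows "(bump_mean 2 v x \<longlongrightarrow> 0) at_top"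
proof -
  have s: "0 < s" using \<alpha> by (simp add: s_def add_nonneg_pos)
  have um [measurable]: "u \<in> borel_measurable borel" using u(1) by (rule borel_measurable_continuous_onI)
  obtain C where C: "0 \<le> C" "\<And>z::'a. integrable lborel (\<lambda>h. \<bar>second_diff (bump 2) z h\<bar> * norm h powr - s)"
      "\<And>z::'a. (LBINT h. \<bar>second_diff (bump 2) z h\<bar> * norm h powr - s) \<le> C * (1 + norm z) powr - s"
    using bump_second_diff_kernel_bound[OF \<alpha>, where 'a='a] unfolding s_def by blast
  let ?w = "\<lambda>h::'a. (1 + norm h) powr - s"
  have wc: "continuous_on UNIV ?w"
    by (intro continuous_intros) (auto simp: add_nonneg_eq_0_iff)
  note fi = far_integrable[of "\<lambda>y. \<bar>u y\<bar>" s ?w 1, simplified, OF u(2) less_imp_le[OF s] wc]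
  define T where "T R = (LBINT y. \<bar>u y\<bar> * (R + norm (x - y)) powr - s)" for R :: real
  have le_w: "(R + norm (x - y)) powr - s \<le> ?w (x - y)" if "1 \<le> R" for R and y :: 'a
    using that s by (intro powr_mono2') (auto intro: add_pos_nonneg)
  have bound: "\<bar>bump_mean 2 v x R\<bar> \<le> C * T R" if R: "1 \<le> R" for R
  proof -
    \<comment> \<open>Rescaling by R about x reduces the estimate to the unit ball, where the
      duality bound has a constant independent of R.\<close>
    define U where "U z = u (x + R *\<^sub>R z)" for z
    have R0: "R \<noteq> 0" "0 < R" using R by auto
    have Uc: "continuous_on UNIV U" unfolding U_def by (rule continuous_affine_compose[OF u(1)])
    have mT: "(\<lambda>y. \<bar>u y\<bar> * (R + norm (x - y)) powr - s) \<in> borel_measurable borel" by measurable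
    have intT: "integrable lborel (\<lambda>y. \<bar>u y\<bar> * (R + norm (x - y)) powr - s)"
      by (rule Bochner_Integration.integrable_bound[OF fi(1)[of x]])
         (use le_w[OF R] in \<open>auto simp: abs_mult intro!: mult_left_mono\<close>)
    have scale: "\<bar>u (x + R *\<^sub>R z)\<bar> * (R + norm (x - (x + R *\<^sub>R z))) powr - s = R powr - s * (\<bar>U z\<bar> * ?w z)" for z
    proof -
      have "R + norm (x - (x + R *\<^sub>R z)) = R * (1 + norm z)" using R0 by (simp add: algebra_simps)
      then show ?thesis using R0 by (simp add: U_def powr_mult)
    qed
    have Ui: "integrable lborel (\<lambda>z. \<bar>U z\<bar> * ?w z)"
      using integrable_lborel_affine_iff[OF mT R0(1), of x] intT R0 unfolding scale by simp
    have TU: "T R = R ^ DIM('a) * (R powr - s * (LBINT z. \<bar>U z\<bar> * ?w z))"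
      unfolding T_def using integral_lborel_affine[OF mT R0(1), of x] R0 unfolding scale by simp
    have km: "(\<lambda>h. second_diff u y h * norm h powr - s) \<in> borel_measurable borel" for y
      using borel_measurable_integrable[OF int] by simp
    have sdU: "second_diff u (x + R *\<^sub>R z) (0 + R *\<^sub>R h) * norm (0 + R *\<^sub>R h) powr - s
        = R powr - s * (second_diff U z h * norm h powr - s)" for z h
      using R0 by (simp add: second_diff_def U_def powr_mult algebra_simps)
    have Uint: "integrable lborel (\<lambda>h. second_diff U z h * norm h powr - s)" for z
      using integrable_lborel_affine_iff[OF km R0(1), of "x + R *\<^sub>R z" 0] int R0 unfolding sdU by simp
    have vU: "v (x + R *\<^sub>R z) = R ^ DIM('a) * (R powr - s * (LBINT h. second_diff U z h * norm h powr - s))" for z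
      unfolding v_def using integral_lborel_affine[OF km R0(1), of "x + R *\<^sub>R z" 0] R0 unfolding sdU by simp
    have vUabs: "(LBINT h. \<bar>second_diff u (x + R *\<^sub>R z) h * norm h powr - s\<bar>)
       = R ^ DIM('a) * (R powr - s * (LBINT h. \<bar>second_diff U z h * norm h powr - s\<bar>))" for z
    proof -
      have m: "(\<lambda>h. \<bar>second_diff u (x + R *\<^sub>R z) h * norm h powr - s\<bar>) \<in> borel_measurable borel"
        using km by (rule borel_measurable_abs)
      show ?thesis
        using integral_lborel_affine[OF m R0(1), of 0] R0 unfolding sdU by (simp add: abs_mult)
    qed
    obtain B where B: "\<And>y. norm y \<le> norm x + R \<Longrightarrow> (LBINT h. \<bar>second_diff u y h * norm h powr - s\<bar>) \<le> B"
      using second_diff_kernel_locally_bounded[OF \<alpha>(1) u(1) u(2)[unfolded s_def] sd int[unfolded s_def]]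
      unfolding s_def by blast
    \<comment> \<open>The same factor R^n R^(-s) arises when v and when T are expressed through U,
      so it cancels and no power of R is left in the bound.\<close>
    define c where "c = R ^ DIM('a) * R powr - s"
    have c: "0 < c" using R0 by (simp add: c_def)
    have "\<bar>LBINT z. bump 2 z * (LBINT h. second_diff U z h * norm h powr - s)\<bar> \<le> C * (LBINT z. \<bar>U z\<bar> * ?w z)"
      unfolding s_def
    proof (rule bump_duality_bound[OF Uc _ _ _ C[unfolded s_def]])
      show "integrable lborel (\<lambda>y. \<bar>U y\<bar> * (1 + norm y) powr - (real DIM('a) + \<alpha>))" using Ui by (simp only: s_def)
      show "integrable lborel (\<lambda>h. second_diff U z h * norm h powr - (real DIM('a) + \<alpha>))" for z using Uint by (simp only: s_def)
      show "(LBINT h. \<bar>second_diff U z h * norm h powr - (real DIM('a) + \<alpha>)\<bar>) \<le> B / c" if z: "norm z \<le> 1" for z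
      proof -
        have "R * norm z \<le> R * 1" using z R0 by (intro mult_left_mono) auto
        moreover have "norm (R *\<^sub>R z) = R * norm z" using R0 by simp
        ultimately have "norm (x + R *\<^sub>R z) \<le> norm x + R"
          using norm_triangle_ineq[of x "R *\<^sub>R z"] by linarith
        from B[OF this] have "c * (LBINT h. \<bar>second_diff U z h * norm h powr - s\<bar>) \<le> B"
          unfolding vUabs c_def by (simp only: mult.assoc)
        then show ?thesis using c by (simp add: field_simps s_def)
      qed
    qed
    moreover have "bump_mean 2 v x R = c * (LBINT z. bump 2 z * (LBINT h. second_diff U z h * norm h powr - s))"
    proof -
      have "bump_mean 2 v x R = (LBINT z. c * (bump 2 z * (LBINT h. second_diff U z h * norm h powr - s)))"
        unfolding bump_mean_def vU c_def by (simp only: mult_ac)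
      then show ?thesis by simp
    qed
    ultimately have "\<bar>bump_mean 2 v x R\<bar> \<le> c * (C * (LBINT z. \<bar>U z\<bar> * ?w z))"
      using c by (simp add: abs_mult mult_left_mono)
    also have "\<dots> = C * T R" unfolding TU c_def by (simp only: mult_ac)
    finally show ?thesis .
  qed
  \<comment> \<open>The weight (R + |x - y|)^(-s) tends to 0 for every y, and for R \<ge> 1 it is
    dominated by its value at R = 1.\<close>
  have "(T \<longlongrightarrow> (\<integral>y. 0 \<partial>(lborel :: 'a measure))) at_top"
    unfolding T_def[abs_def]
  proof (rule integral_dominated_convergence_at_top[where w="\<lambda>y. \<bar>u y\<bar> * ?w (x - y)"])
    show "integrable lborel (\<lambda>y. \<bar>u y\<bar> * ?w (x - y))" by (rule fi(1))
    show "AE y in lborel. ((\<lambda>R. \<bar>u y\<bar> * (R + norm (x - y)) powr - s) \<longlongrightarrow> 0) at_top"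
    proof (rule AE_I2)
      fix y :: 'a
      have "((\<lambda>R. (R + norm (x - y)) powr - s) \<longlongrightarrow> 0) at_top"
      proof (rule tendsto_neg_powr)
        have "filterlim (\<lambda>R. norm (x - y) + R) at_top at_top"
          by (rule filterlim_tendsto_add_at_top[OF tendsto_const filterlim_ident])
        then show "filterlim (\<lambda>R. R + norm (x - y)) at_top at_top" by (simp only: add.commute)
      qed (use s in simp)
      from tendsto_mult_right_zero[OF this]
      show "((\<lambda>R. \<bar>u y\<bar> * (R + norm (x - y)) powr - s) \<longlongrightarrow> 0) at_top" .
    qed
    show "\<forall>\<^sub>F R in at_top. AE y in lborel. norm (\<bar>u y\<bar> * (R + norm (x - y)) powr - s) \<le> \<bar>u y\<bar> * ?w (x - y)"
      using eventually_ge_at_top[of 1]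
    proof eventually_elim
      case (elim R)
      show ?case
      proof (rule AE_I2)
        show "norm (\<bar>u y\<bar> * (R + norm (x - y)) powr - s) \<le> \<bar>u y\<bar> * ?w (x - y)" for y
          using mult_left_mono[OF le_w[OF elim, of y] abs_ge_zero[of "u y"]] by (simp add: abs_mult)
      qed
    qed
  qed measurable
  then have "((\<lambda>R. C * T R) \<longlongrightarrow> C * 0) at_top"
    by (intro tendsto_mult_left) simp
  then have T0: "((\<lambda>R. C * T R) \<longlongrightarrow> 0) at_top" by simp
  have "\<forall>\<^sub>F R in at_top. norm (bump_mean 2 v x R) \<le> C * T R"
    using eventually_ge_at_top[of 1] by eventually_elim (simp add: bound)
  then show ?thesis by (rule Lim_null_comparison[OF _ T0])
qed

section \<open>A Harnack inequality for the fractional Laplacian\<close>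

text \<open>\<open>has_bochner_integral\<close> makes integrability part of the equation, so the
  value 0 is never a mere convention. The equation involves second differences only, hence it
  survives subtracting a constant such as the infimum.\<close>

definition nonneg_harmonic :: "real \<Rightarrow> ('a::euclidean_space \<Rightarrow> real) \<Rightarrow> bool" where
  "nonneg_harmonic \<alpha> u \<longleftrightarrow> continuous_on UNIV u \<and> (\<forall>x. 0 \<le> u x) \<and>
     (\<forall>x. has_bochner_integral lborel (\<lambda>h. second_diff u x h * norm h powr - (real DIM('a) + \<alpha>)) 0)"

section \<open>Scaling of the kernel integrals and integrability of tails\<close>

lemma has_bochner_integral_outer_kernel:
  fixes \<alpha> R :: real
  assumes "0 < \<alpha>" "0 < R"
  shows "has_bochner_integral lborel
     (\<lambda>h::'a::euclidean_space. indicator {h. R \<le> norm h} h * norm h powr - (real DIM('a) + \<alpha>))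
     (R powr - \<alpha> * (integral\<^sup>L lborel (\<lambda>h::'a. indicator {h. 1 \<le> norm h} h * norm h powr - (real DIM('a) + \<alpha>))))"
proof -
  let ?s = "real DIM('a) + \<alpha>"
  let ?f = "\<lambda>h::'a. indicator {h. R \<le> norm h} h * norm h powr - ?s"
  have m: "?f \<in> borel_measurable borel" by measurable
  have sc: "?f (0 + R *\<^sub>R h) = R powr - ?s * (indicator {h. 1 \<le> norm h} h * norm h powr - ?s)" for h
    using assms by (simp add: indicator_def powr_mult)
  have R: "R \<noteq> 0" using assms by simp
  have "integrable lborel ?f"
    using integrable_lborel_affine_iff[OF m R, of 0] integrable_norm_powr_outside[OF assms(1), where 'a='a]
    unfolding sc by (auto intro: integrable_mult_right)
  moreover have "R ^ DIM('a) * R powr - ?s = R powr - \<alpha>"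
    using assms by (simp add: powr_realpow[symmetric] flip: powr_add)
  moreover have "integral\<^sup>L lborel ?f = R ^ DIM('a) * (R powr - ?s * integral\<^sup>L lborel (\<lambda>h::'a. indicator {h. 1 \<le> norm h} h * norm h powr - ?s))"
    using integral_lborel_affine[OF m R, of 0] assms(2)
    unfolding sc integral_mult_right_zero by (simp only: abs_of_pos)
  ultimately show ?thesis
    unfolding has_bochner_integral_iff by (simp only: mult.assoc[symmetric] simp_thms)
qed

lemma has_bochner_integral_inner_kernel:
  fixes \<alpha> R :: real
  assumes "\<alpha> < 2" "0 < R"
  shows "has_bochner_integral lborel
     (\<lambda>h::'a::euclidean_space. indicator {h. norm h < R} h * (norm h ^ 2 * norm h powr - (real DIM('a) + \<alpha>)))
     (R powr (2 - \<alpha>) * (integral\<^sup>L lborel (\<lambda>h::'a. indicator {h. norm h < 1} h * (norm h ^ 2 * norm h powr - (real DIM('a) + \<alpha>)))))"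
proof -
  let ?s = "real DIM('a) + \<alpha>"
  let ?f = "\<lambda>h::'a. indicator {h. norm h < R} h * (norm h ^ 2 * norm h powr - ?s)"
  have m: "?f \<in> borel_measurable borel" by measurable
  have sc: "?f (0 + R *\<^sub>R h) = R ^ 2 * R powr - ?s * (indicator {h. norm h < 1} h * (norm h ^ 2 * norm h powr - ?s))" for h
    using assms by (simp add: indicator_def powr_mult power_mult_distrib)
  have R: "R \<noteq> 0" using assms by simp
  have eq: "norm h ^ 2 = norm h powr 2" for h :: 'a by (cases "h = 0") (simp_all add: powr_numeral)
  have "integrable lborel (\<lambda>h::'a. indicator {h. norm h < 1} h * (norm h ^ 2 * norm h powr - ?s))"
    unfolding eq by (rule integrable_singular_kernel_near[OF assms(1)])
  then have "integrable lborel ?f"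
    using integrable_lborel_affine_iff[OF m R, of 0] unfolding sc by (auto intro: integrable_mult_right)
  moreover have "R ^ DIM('a) * (R ^ 2 * R powr - ?s) = R powr (2 - \<alpha>)"
  proof -
    have "R ^ DIM('a) * (R ^ 2 * R powr - ?s) = R powr (real DIM('a)) * (R powr 2 * R powr - ?s)"
      using assms by (simp add: powr_realpow powr_numeral)
    then show ?thesis by (simp flip: powr_add)
  qed
  moreover have "integral\<^sup>L lborel ?f = R ^ DIM('a) * (R ^ 2 * R powr - ?s * integral\<^sup>L lborel (\<lambda>h::'a. indicator {h. norm h < 1} h * (norm h ^ 2 * norm h powr - ?s)))"
    using integral_lborel_affine[OF m R, of 0] assms(2)
    unfolding sc integral_mult_right_zero by (simp only: abs_of_pos)
  ultimately show ?thesis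
    unfolding has_bochner_integral_iff by (simp only: mult.assoc[symmetric] simp_thms)
qed

text \<open>The shell between the radii 1 and 2 has positive volume. The Harnack argument divides by
  this constant: it is the coefficient with which the value at the touching point enters the
  equation.\<close>

lemma outer_kernel_integral_pos:
  fixes \<alpha> :: real
  assumes "0 < \<alpha>"
  shows "0 < (integral\<^sup>L lborel (\<lambda>h::'a::euclidean_space. indicator {h. 1 \<le> norm h} h * norm h powr - (real DIM('a) + \<alpha>)))"
proof -
  let ?s = "real DIM('a) + \<alpha>"
  let ?A = "ball 0 2 - ball (0::'a) 1"
  let ?f = "\<lambda>h::'a. indicator {h. 1 \<le> norm h} h * norm h powr - ?s"
  have s: "0 < ?s" using assms by (simp add: add_nonneg_pos)
  have A: "?A \<in> sets lborel" by simp
  have fin: "emeasure lborel (ball (0::'a) r) \<noteq> \<infinity>" for r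
    using emeasure_bounded_finite[OF bounded_ball, of "0::'a" r] by simp
  have "measure lborel ?A = unit_ball_vol (real DIM('a)) * (2 ^ DIM('a) - 1)"
    using fin by (subst measure_Diff) (auto simp: content_ball algebra_simps)
  moreover have "1 < (2::real) ^ DIM('a)" by (rule one_less_power) auto
  ultimately have pos: "0 < measure lborel ?A" by simp
  have Ai: "integrable lborel (indicator ?A :: 'a \<Rightarrow> real)"
    by (rule integrable_real_indicator[OF A])
       (rule le_less_trans[OF emeasure_mono emeasure_bounded_finite[OF bounded_ball, of "0::'a" 2]]; auto)
  have "0 < 2 powr - ?s * measure lborel ?A" using pos by simp
  also have "\<dots> = (LBINT h. 2 powr - ?s * indicator ?A h)" by simp
  also have "\<dots> \<le> (LBINT h. ?f h)"
  proof (rule integral_mono)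
    fix h :: 'a
    show "2 powr - ?s * indicator ?A h \<le> ?f h"
    proof (cases "h \<in> ?A")
      case True
      then have "2 powr - ?s \<le> norm h powr - ?s" using s by (intro powr_mono2') auto
      then show ?thesis using True by simp
    qed auto
  qed (use integrable_norm_powr_outside[OF assms] Ai in \<open>auto intro: integrable_mult_right\<close>)
  finally show ?thesis .
qed

text \<open>Away from h = 0 the kernel itself is integrable, so the term 2 u z can be removed from
  the second difference. What remains is u (z + h) + u (z - h), and since u is nonnegative each
  summand is dominated by the sum.\<close>

lemma nonneg_harmonic_tail_integrable:
  fixes u :: "'a::euclidean_space \<Rightarrow> real"
  assumes u: "nonneg_harmonic \<alpha> u" and \<alpha>: "0 < \<alpha>" and r: "0 < r"
  shows "integrable lborel (\<lambda>h. indicator {h. r \<le> norm h} h * (u (z + h) * norm h powr - (real DIM('a) + \<alpha>)))" (is ?I)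
    and "integrable lborel (\<lambda>h. indicator {h. r \<le> norm h} h * (u (z - h) * norm h powr - (real DIM('a) + \<alpha>)))" (is ?J)
    and "(LBINT h. indicator {h. r \<le> norm h} h * (u (z - h) * norm h powr - (real DIM('a) + \<alpha>)))
       = (LBINT h. indicator {h. r \<le> norm h} h * (u (z + h) * norm h powr - (real DIM('a) + \<alpha>)))"
proof -
  let ?s = "real DIM('a) + \<alpha>"
  have [measurable]: "u \<in> borel_measurable borel"
    using u borel_measurable_continuous_onI by (auto simp: nonneg_harmonic_def)
  have nn: "0 \<le> u x" for x using u by (simp add: nonneg_harmonic_def)
  have S: "integrable lborel (\<lambda>h. second_diff u z h * norm h powr - ?s)"
    using u by (auto simp: nonneg_harmonic_def has_bochner_integral_iff)
  let ?g = "\<lambda>h. 2 * u z * (indicator {h. r \<le> norm h} h * norm h powr - ?s)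
      - indicator {h. r \<le> norm h} h * (second_diff u z h * norm h powr - ?s)"
  have "integrable lborel (\<lambda>h. indicator {h. r \<le> norm h} h * (second_diff u z h * norm h powr - ?s))"
    using integrable_mult_indicator[of "{h. r \<le> norm h}" lborel, OF _ S] by simp
  then have g: "integrable lborel ?g"
    using has_bochner_integral_outer_kernel[OF \<alpha> r, where 'a='a]
    by (intro Bochner_Integration.integrable_diff integrable_mult_right) (auto simp: has_bochner_integral_iff)
  have geq: "?g h = indicator {h. r \<le> norm h} h * ((u (z + h) + u (z - h)) * norm h powr - ?s)" for h
    by (simp add: second_diff_def indicator_def algebra_simps)
  show ?I
  proof (rule Bochner_Integration.integrable_bound[OF g _ AE_I2])
    show "norm (indicator {h. r \<le> norm h} h * (u (z + h) * norm h powr - ?s)) \<le> norm (?g h)" for h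
      unfolding geq by (auto simp: indicator_def nn abs_mult intro!: mult_right_mono)
  qed simp
  have m: "(\<lambda>h. indicator {h. r \<le> norm h} h * (u (z + h) * norm h powr - ?s)) \<in> borel_measurable borel"
    by measurable
  show ?J
    using integrable_lborel_reflect_iff[OF m, of 0] \<open>?I\<close> by (simp add: indicator_def)
  show "(LBINT h. indicator {h. r \<le> norm h} h * (u (z - h) * norm h powr - ?s))
       = (LBINT h. indicator {h. r \<le> norm h} h * (u (z + h) * norm h powr - ?s))"
    using integral_lborel_reflect[OF m, of 0] by (simp add: indicator_def)
qed

text \<open>The comparison point is a global minimum of \<open>u\<close> plus a small paraboloid; the equation at that
  point bounds all of the mass of \<open>u\<close>.\<close>

lemma nonneg_harmonic_mass_bound:
  fixes \<alpha> :: real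
  assumes \<alpha>: "0 < \<alpha>" "\<alpha> < 2"
  shows "\<exists>C\<ge>0. \<forall>(u :: 'a::euclidean_space \<Rightarrow> real) x1 \<delta> R.
    nonneg_harmonic \<alpha> u \<longrightarrow> u x1 \<le> \<delta> \<longrightarrow> 0 < \<delta> \<longrightarrow> 0 < R \<longrightarrow>
    (\<exists>x2. norm (x2 - x1) \<le> R \<and>
      integrable lborel (\<lambda>h. indicator {h. norm h < R} h * u (x2 + h)) \<and>
      (LBINT h. indicator {h. norm h < R} h * u (x2 + h)) \<le> C * \<delta> * R ^ DIM('a) \<and>
      (LBINT h. indicator {h. R \<le> norm h} h * (u (x2 + h) * norm h powr - (real DIM('a) + \<alpha>))) \<le> C * \<delta> * R powr - \<alpha>)"
proof -
  let ?s = "real DIM('a) + \<alpha>"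
  have s: "0 < ?s" using \<alpha> by (simp add: add_nonneg_pos)
  define J0 where "J0 = (integral\<^sup>L lborel (\<lambda>h::'a. indicator {h. 1 \<le> norm h} h * norm h powr - ?s))"
  define J2 where "J2 = (integral\<^sup>L lborel (\<lambda>h::'a. indicator {h. norm h < 1} h * (norm h ^ 2 * norm h powr - ?s)))"
  define \<omega> where "\<omega> = unit_ball_vol (real DIM('a))"
  have J0: "0 \<le> J0" unfolding J0_def by (rule Bochner_Integration.integral_nonneg) simp
  have J2: "0 \<le> J2" unfolding J2_def by (rule Bochner_Integration.integral_nonneg) simp
  have \<omega>: "0 \<le> \<omega>" by (simp add: \<omega>_def less_imp_le)
  \<comment> \<open>4 J2 comes from the second moment of the kernel against the paraboloid, 2 J0
    from the mass of the kernel outside the ball against 2 u(x2).\<close>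
  define D where "D = 4 * J2 + 2 * J0"
  have D: "0 \<le> D" using J0 J2 by (simp add: D_def)
  have "\<exists>x2. norm (x2 - x1) \<le> R \<and>
      integrable lborel (\<lambda>h. indicator {h. norm h < R} h * u (x2 + h)) \<and>
      (LBINT h. indicator {h. norm h < R} h * u (x2 + h)) \<le> (D + 2 * \<omega>) * \<delta> * R ^ DIM('a) \<and>
      (LBINT h. indicator {h. R \<le> norm h} h * (u (x2 + h) * norm h powr - ?s)) \<le> (D + 2 * \<omega>) * \<delta> * R powr - \<alpha>"
    if u: "nonneg_harmonic \<alpha> u" and x1: "u x1 \<le> \<delta>" and \<delta>: "0 < \<delta>" and R: "0 < R"
    for u :: "'a \<Rightarrow> real" and x1 \<delta> R
  proof -
    have uc: "continuous_on UNIV u" and nn: "\<And>x. 0 \<le> u x"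
      using u by (auto simp: nonneg_harmonic_def)
    have [measurable]: "u \<in> borel_measurable borel" using uc by (rule borel_measurable_continuous_onI)
    \<comment> \<open>The coefficient is such that w is at most \<delta> at x1 and at least 2
      \<delta> outside the ball of radius R, so the minimum over the ball is a global
      minimum.\<close>
    define w where "w y = u y + 2 * \<delta> / R ^ 2 * ((y - x1) \<bullet> (y - x1))" for y
    have "continuous_on (cball x1 R) w"
      unfolding w_def[abs_def] by (intro continuous_intros continuous_on_subset[OF uc]) auto
    then obtain x2 where x2: "x2 \<in> cball x1 R" "\<And>y. y \<in> cball x1 R \<Longrightarrow> w x2 \<le> w y"
      using continuous_attains_inf[of "cball x1 R" w] R by auto
    have "w x2 \<le> w x1" using x2(2)[of x1] R by simp
    then have wx2: "w x2 \<le> \<delta>" using x1 by (simp add: w_def)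
    have min: "w x2 \<le> w y" for y
    proof (cases "y \<in> cball x1 R")
      case False
      then have "R ^ 2 \<le> norm (y - x1) ^ 2" using R by (intro power_mono) (auto simp: dist_norm norm_minus_commute)
      then have "R ^ 2 \<le> (y - x1) \<bullet> (y - x1)" by (simp add: power2_norm_eq_inner)
      then have "2 * \<delta> / R ^ 2 * R ^ 2 \<le> 2 * \<delta> / R ^ 2 * ((y - x1) \<bullet> (y - x1))"
        using \<delta> by (intro mult_left_mono) auto
      then have "2 * \<delta> \<le> w y" using R nn[of y] by (simp add: w_def)
      then show ?thesis using wx2 \<delta> by simp
    qed (rule x2(2))
    have ux2: "u x2 \<le> \<delta>"
      using wx2 \<delta> by (simp add: w_def) (smt (verit) divide_nonneg_nonneg inner_ge_zero mult_nonneg_nonneg zero_le_power2)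
    define Q where "Q h = u (x2 + h) + u (x2 - h) - 2 * u x2 + 4 * \<delta> / R ^ 2 * norm h ^ 2" for h
    have Q0: "0 \<le> Q h" for h
    proof -
      have "w (x2 + h) + w (x2 - h) - 2 * w x2 = Q h"
        by (simp add: w_def Q_def power2_norm_eq_inner inner_add inner_diff inner_commute algebra_simps add_divide_distrib diff_divide_distrib)
      then show ?thesis using min[of "x2 + h"] min[of "x2 - h"] by simp
    qed
    have Qzero: "Q 0 = 0" by (simp add: Q_def)
    let ?k = "\<lambda>h::'a. norm h powr - ?s"
    \<comment> \<open>P corrects the integrand of the equation so that it becomes nonnegative: the
      paraboloid is added inside the ball and the term with u(x2) is removed outside. Its integral
      consists of the corrections alone.\<close>
    define P where "P h = - (second_diff u x2 h * ?k h)
        + 4 * \<delta> / R ^ 2 * (indicator {h. norm h < R} h * (norm h ^ 2 * ?k h))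
        + 2 * u x2 * (indicator {h. R \<le> norm h} h * ?k h)" for h
    have P: "has_bochner_integral lborel P (- 0 + 4 * \<delta> / R ^ 2 * (R powr (2 - \<alpha>) * J2) + 2 * u x2 * (R powr - \<alpha> * J0))"
      unfolding P_def[abs_def] J0_def J2_def using u
      by (intro has_bochner_integral_add has_bochner_integral_minus has_bochner_integral_mult_right
          has_bochner_integral_inner_kernel has_bochner_integral_outer_kernel \<alpha> R) (auto simp: nonneg_harmonic_def)
    have Peq: "P h = indicator {h. norm h < R} h * (Q h * ?k h)
        + indicator {h. R \<le> norm h} h * ((u (x2 + h) + u (x2 - h)) * ?k h)" for h
      by (cases "norm h < R") (auto simp: P_def Q_def second_diff_def algebra_simps)
    have Pi: "integrable lborel P" using P by (simp add: has_bochner_integral_iff)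
    have "R powr (2 - \<alpha>) = R ^ 2 * R powr - \<alpha>"
      using R powr_add[of R 2 "- \<alpha>"] by (simp add: powr_numeral)
    then have "(LBINT h. P h) = 4 * \<delta> * R powr - \<alpha> * J2 + 2 * u x2 * (R powr - \<alpha> * J0)"
      using P R by (simp add: has_bochner_integral_iff)
    also have "\<dots> \<le> 4 * \<delta> * R powr - \<alpha> * J2 + 2 * \<delta> * (R powr - \<alpha> * J0)"
      using ux2 J0 by (intro add_left_mono mult_right_mono mult_left_mono) auto
    finally have Pint: "(LBINT h. P h) \<le> D * \<delta> * R powr - \<alpha>"
      by (simp add: D_def algebra_simps)
    have Bi: "integrable lborel (\<lambda>h::'a. indicator {h. norm h < R} h :: real)"
      and Bm: "(integral\<^sup>L lborel (\<lambda>h::'a. indicator {h. norm h < R} h)) = \<omega> * R ^ DIM('a)"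
    proof -
      have eq: "{h. norm h < R} = ball (0::'a) R" by auto
      show "integrable lborel (\<lambda>h::'a. indicator {h. norm h < R} h :: real)"
        unfolding eq by (rule integrable_real_indicator) (use emeasure_bounded_finite[OF bounded_ball] in simp_all)
      show "(integral\<^sup>L lborel (\<lambda>h::'a. indicator {h. norm h < R} h)) = \<omega> * R ^ DIM('a)"
        unfolding eq using R by (simp add: content_ball \<omega>_def)
    qed
    have Rs: "0 < R powr - ?s" using R by simp
    let ?A = "\<lambda>h. indicator {h. norm h < R} h * u (x2 + h)"
    \<comment> \<open>Inside the ball the kernel is at least R^(-s), and u (x2 + h) exceeds Q h by
      at most 2 u(x2) \<le> 2 \<delta>, because the other terms of Q are nonnegative.\<close>
    have Abound: "R powr - ?s * ?A h \<le> P h + R powr - ?s * (2 * \<delta>) * indicator {h. norm h < R} h" for h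
    proof (cases "norm h < R")
      case True
      have "u (x2 + h) \<le> Q h + 2 * \<delta>"
        using nn[of "x2 - h"] ux2 \<delta> zero_le_power2[of "norm h"] zero_le_power2[of R]
          divide_nonneg_nonneg[of "4 * \<delta>" "R ^ 2"] mult_nonneg_nonneg[of "4 * \<delta> / R ^ 2" "norm h ^ 2"]
        unfolding Q_def by linarith
      then have "R powr - ?s * u (x2 + h) \<le> R powr - ?s * (Q h + 2 * \<delta>)"
        using Rs by (intro mult_left_mono) auto
      moreover have "R powr - ?s * Q h \<le> Q h * ?k h"
      \<comment> \<open>At h = 0 the kernel has the value 0 by the convention for
        \<open>powr\<close>, so it is not bounded below by R^(-s); the inequality holds there
        because Q vanishes.\<close>
      proof (cases "h = 0")
        case False
        then have "R powr - ?s \<le> ?k h" using True s by (intro powr_mono2') auto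
        then show ?thesis using Q0[of h] by (simp add: mult.commute mult_left_mono)
      qed (simp add: Qzero)
      ultimately show ?thesis using True by (simp add: Peq algebra_simps)
    next
      case False
      then show ?thesis using nn by (simp add: Peq)
    qed
    have Gi: "integrable lborel (\<lambda>h. P h + R powr - ?s * (2 * \<delta>) * indicator {h. norm h < R} h)"
      by (intro Bochner_Integration.integrable_add Pi integrable_mult_right Bi)
    have RAi: "integrable lborel (\<lambda>h. R powr - ?s * ?A h)"
    proof (rule Bochner_Integration.integrable_bound[OF Gi _ AE_I2])
      show "norm (R powr - ?s * ?A h) \<le> norm (P h + R powr - ?s * (2 * \<delta>) * indicator {h. norm h < R} h)" for h
        using order_trans[OF Abound[of h] abs_ge_self] nn by (simp add: abs_mult)
    qed simp
    have "(LBINT h. R powr - ?s * ?A h) \<le> (LBINT h. P h + R powr - ?s * (2 * \<delta>) * indicator {h. norm h < R} h)"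
      by (rule integral_mono[OF RAi Gi Abound])
    also have "\<dots> = (LBINT h. P h) + R powr - ?s * (2 * \<delta>) * (\<omega> * R ^ DIM('a))"
      by (simp only: Bochner_Integration.integral_add[OF Pi integrable_mult_right[OF Bi]] integral_mult_right_zero Bm)
    also have "R powr - ?s * R ^ DIM('a) = R powr - \<alpha>"
      using R by (simp add: powr_realpow[symmetric] flip: powr_add)
    then have "R powr - ?s * (2 * \<delta>) * (\<omega> * R ^ DIM('a)) = 2 * \<omega> * \<delta> * R powr - \<alpha>"
      by (metis (no_types, opaque_lifting) mult.assoc mult.commute)
    finally have "R powr - ?s * (LBINT h. ?A h) \<le> (LBINT h. P h) + 2 * \<omega> * \<delta> * R powr - \<alpha>"
      unfolding integral_mult_right_zero .
    then have "R powr - ?s * (LBINT h. ?A h) \<le> (D + 2 * \<omega>) * \<delta> * R powr - \<alpha>"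
      using Pint unfolding distrib_right by linarith
    then have "R powr ?s * (R powr - ?s * (LBINT h. ?A h)) \<le> R powr ?s * ((D + 2 * \<omega>) * \<delta> * R powr - \<alpha>)"
      by (intro mult_left_mono) auto
    moreover have "R powr ?s * R powr - ?s = 1" "R powr ?s * R powr - \<alpha> = R ^ DIM('a)"
      using R by (simp_all add: powr_realpow[symmetric] flip: powr_add)
    moreover have "R powr ?s * (R powr - ?s * (LBINT h. ?A h)) = (R powr ?s * R powr - ?s) * (LBINT h. ?A h)"
      "R powr ?s * ((D + 2 * \<omega>) * \<delta> * R powr - \<alpha>) = (D + 2 * \<omega>) * \<delta> * (R powr ?s * R powr - \<alpha>)"
      by (simp_all only: mult_ac)
    ultimately have A: "(LBINT h. ?A h) \<le> (D + 2 * \<omega>) * \<delta> * R ^ DIM('a)"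
      by (simp only: mult_1)
    have Ai: "integrable lborel ?A"
      using integrable_mult_right[OF RAi, of "R powr ?s"] \<open>R powr ?s * R powr - ?s = 1\<close>
      by (simp add: mult.assoc[symmetric])
    have "(LBINT h. indicator {h. R \<le> norm h} h * (u (x2 + h) * ?k h)) \<le> (LBINT h. P h)"
    proof (rule integral_mono[OF nonneg_harmonic_tail_integrable(1)[OF u \<alpha>(1) R] Pi])
      fix h
      show "indicator {h. R \<le> norm h} h * (u (x2 + h) * ?k h) \<le> P h"
        using nn Q0 by (auto simp: Peq indicator_def intro!: mult_right_mono)
    qed
    also note Pint
    also have "D * \<delta> * R powr - \<alpha> \<le> (D + 2 * \<omega>) * \<delta> * R powr - \<alpha>"
      using \<omega> \<delta> by (intro mult_right_mono) auto
    finally show ?thesis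
      using A Ai x2(1) by (intro exI[of _ x2]) (auto simp: dist_norm norm_minus_commute)
  qed
  then show ?thesis using D \<omega> by (intro exI[of _ "D + 2 * \<omega>"]) auto
qed

text \<open>Moves the mass bound from the touching point x2 to any nearby z. If z + h lies within R
  of x2, the kernel is at most r^(-s) and the mass in that ball is used. Otherwise |z + h - x2|
  \<le> 3 R + |h| \<le> (4 R / r) |h|, so the kernel at z is at most (4 R / r)^s times the kernel at
  x2. Both parts are of order r^(-s) R^n.\<close>

lemma nonneg_harmonic_tail_bound:
  fixes \<alpha> :: real
  assumes \<alpha>: "0 < \<alpha>" "\<alpha> < 2"
  shows "\<exists>C\<ge>0. \<forall>(u :: 'a::euclidean_space \<Rightarrow> real) x1 z \<delta> r R.
    nonneg_harmonic \<alpha> u \<longrightarrow> u x1 \<le> \<delta> \<longrightarrow> 0 < \<delta> \<longrightarrow> 0 < r \<longrightarrow> r \<le> R \<longrightarrow> norm (z - x1) \<le> 2 * R \<longrightarrow>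
    (LBINT h. indicator {h. r \<le> norm h} h * (u (z + h) * norm h powr - (real DIM('a) + \<alpha>)))
      \<le> C * \<delta> * r powr - (real DIM('a) + \<alpha>) * R ^ DIM('a)"
proof -
  let ?s = "real DIM('a) + \<alpha>"
  have s: "0 < ?s" using \<alpha> by (simp add: add_nonneg_pos)
  obtain C where C_mass: "0 \<le> C \<and> (\<forall>(u :: 'a \<Rightarrow> real) x1 \<delta> R.
    nonneg_harmonic \<alpha> u \<longrightarrow> u x1 \<le> \<delta> \<longrightarrow> 0 < \<delta> \<longrightarrow> 0 < R \<longrightarrow>
    (\<exists>x2. norm (x2 - x1) \<le> R \<and>
      integrable lborel (\<lambda>h. indicator {h. norm h < R} h * u (x2 + h)) \<and>
      (LBINT h. indicator {h. norm h < R} h * u (x2 + h)) \<le> C * \<delta> * R ^ DIM('a) \<and>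
      (LBINT h. indicator {h. R \<le> norm h} h * (u (x2 + h) * norm h powr - ?s)) \<le> C * \<delta> * R powr - \<alpha>))"
    using nonneg_harmonic_mass_bound[OF \<alpha>, where 'a='a] by (rule exE)
  note C = conjunct1[OF C_mass] and mass = conjunct2[OF C_mass, rule_format]
  have "(LBINT h. indicator {h. r \<le> norm h} h * (u (z + h) * norm h powr - ?s))
      \<le> (C + 4 powr ?s * C) * \<delta> * r powr - ?s * R ^ DIM('a)"
    if u: "nonneg_harmonic \<alpha> u" and x1: "u x1 \<le> \<delta>" and \<delta>: "0 < \<delta>" and r: "0 < r" "r \<le> R"
      and z: "norm (z - x1) \<le> 2 * R"
    for u :: "'a \<Rightarrow> real" and x1 z \<delta> r R
  proof -
    have R: "0 < R" using r by simp
    have uc: "continuous_on UNIV u" and nn: "\<And>x. 0 \<le> u x"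
      using u by (auto simp: nonneg_harmonic_def)
    have [measurable]: "u \<in> borel_measurable borel" using uc by (rule borel_measurable_continuous_onI)
    obtain x2 where x2: "norm (x2 - x1) \<le> R"
      and Ai: "integrable lborel (\<lambda>h. indicator {h. norm h < R} h * u (x2 + h))"
      and A: "(LBINT h. indicator {h. norm h < R} h * u (x2 + h)) \<le> C * \<delta> * R ^ DIM('a)"
      and B: "(LBINT h. indicator {h. R \<le> norm h} h * (u (x2 + h) * norm h powr - ?s)) \<le> C * \<delta> * R powr - \<alpha>"
      using mass[OF u x1 \<delta> R] by blast
    have zx2: "norm (z - x2) \<le> 3 * R"
      using norm_triangle_ineq4[of "z - x1" "x2 - x1"] x2 z by simp
    let ?A = "\<lambda>h. indicator {h. norm h < R} h * u (x2 + h)"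
    let ?B = "\<lambda>h. indicator {h. R \<le> norm h} h * (u (x2 + h) * norm h powr - ?s)"
    have Am: "?A \<in> borel_measurable borel" and Bm: "?B \<in> borel_measurable borel" by measurable
    note Bi = nonneg_harmonic_tail_integrable(1)[OF u \<alpha>(1) R, of x2]
    have iA: "integrable lborel (\<lambda>h. ?A ((z - x2) + h))" "(LBINT h. ?A ((z - x2) + h)) = (LBINT h. ?A h)"
      using integrable_lborel_shift_iff[OF Am, of "z - x2"] integral_lborel_shift[OF Am, of "z - x2"] Ai by blast+
    have iB: "integrable lborel (\<lambda>h. ?B ((z - x2) + h))" "(LBINT h. ?B ((z - x2) + h)) = (LBINT h. ?B h)"
      using integrable_lborel_shift_iff[OF Bm, of "z - x2"] integral_lborel_shift[OF Bm, of "z - x2"] Bi by blast+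
    let ?c = "(4 * R / r) powr ?s"
    have le: "indicator {h. r \<le> norm h} h * (u (z + h) * norm h powr - ?s)
        \<le> r powr - ?s * ?A ((z - x2) + h) + ?c * ?B ((z - x2) + h)" for h
    proof (cases "r \<le> norm h")
      case h: True
      let ?g = "(z - x2) + h"
      have zg: "x2 + ?g = z + h" by simp
      show ?thesis
      proof (cases "norm ?g < R")
        case True
        have "norm h powr - ?s \<le> r powr - ?s" using h r s by (intro powr_mono2') auto
        then have "u (z + h) * norm h powr - ?s \<le> u (z + h) * r powr - ?s" using nn by (intro mult_left_mono) auto
        then show ?thesis unfolding zg using h True by (simp add: mult.commute)
      next
        case False
        have "norm ?g \<le> 3 * R + norm h" using norm_triangle_ineq[of "z - x2" h] zx2 by linarith
        moreover have "3 * R \<le> 3 * (R / r * norm h)" using h r R by (simp add: field_simps)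
        moreover have "norm h \<le> R / r * norm h" using r by (simp add: field_simps mult_right_mono)
        ultimately have "norm ?g \<le> 4 * (R / r * norm h)" by linarith
        then have "norm ?g \<le> (4 * R / r) * norm h" by simp
        then have "((4 * R / r) * norm h) powr - ?s \<le> norm ?g powr - ?s"
          using False R s by (intro powr_mono2') auto
        then have "(4 * R / r) powr - ?s * norm h powr - ?s \<le> norm ?g powr - ?s"
          by (simp only: powr_mult)
        then have "?c * ((4 * R / r) powr - ?s * norm h powr - ?s) \<le> ?c * norm ?g powr - ?s"
          by (intro mult_left_mono) auto
        moreover have "?c * (4 * R / r) powr - ?s = 1" using r R by (simp flip: powr_add)
        ultimately have "norm h powr - ?s \<le> ?c * norm ?g powr - ?s" by (simp flip: mult.assoc)
        then have "u (z + h) * norm h powr - ?s \<le> u (z + h) * (?c * norm ?g powr - ?s)"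
          using nn by (intro mult_left_mono) auto
        then show ?thesis unfolding zg using h False by (simp add: mult_ac)
      qed
    qed (use nn in \<open>auto intro!: add_nonneg_nonneg mult_nonneg_nonneg\<close>)
    have "(LBINT h. indicator {h. r \<le> norm h} h * (u (z + h) * norm h powr - ?s))
        \<le> (LBINT h. r powr - ?s * ?A ((z - x2) + h) + ?c * ?B ((z - x2) + h))"
      by (rule integral_mono[OF nonneg_harmonic_tail_integrable(1)[OF u \<alpha>(1) r(1)] _ le])
         (intro Bochner_Integration.integrable_add integrable_mult_right iA iB)
    also have "\<dots> = r powr - ?s * (LBINT h. ?A ((z - x2) + h)) + ?c * (LBINT h. ?B ((z - x2) + h))"
      using integrable_mult_right[OF iA(1)] integrable_mult_right[OF iB(1)]
      by (simp only: Bochner_Integration.integral_add integral_mult_right_zero)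
    also have "\<dots> \<le> r powr - ?s * (C * \<delta> * R ^ DIM('a)) + ?c * (C * \<delta> * R powr - \<alpha>)"
      unfolding iA(2) iB(2) by (intro add_mono mult_left_mono A B) auto
    also have "?c * R powr - \<alpha> = 4 powr ?s * (r powr - ?s * R ^ DIM('a))"
    proof -
      have "?c = 4 powr ?s * R powr ?s * r powr - ?s"
        by (simp only: powr_divide powr_mult powr_minus) (simp only: divide_inverse)
      moreover have "R powr ?s * R powr - \<alpha> = R ^ DIM('a)"
        using R by (simp add: powr_realpow[symmetric] flip: powr_add)
      then have "R ^ DIM('a) = R powr ?s * R powr - \<alpha>" ..
      ultimately show ?thesis by (simp only: mult_ac)
    qed
    then have "C * \<delta> * (?c * R powr - \<alpha>) = C * \<delta> * (4 powr ?s * (r powr - ?s * R ^ DIM('a)))"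
      by (simp only:)
    then have "?c * (C * \<delta> * R powr - \<alpha>) = C * \<delta> * (4 powr ?s * (r powr - ?s * R ^ DIM('a)))"
      by (simp only: mult_ac)
    finally show ?thesis by (simp add: algebra_simps)
  qed
  then show ?thesis using C by (intro exI[of _ "C + 4 powr ?s * C"]) auto
qed

text \<open>The interval is 1 plus or minus 9/16, where 9/16 = 1/2 + 1/16 bounds the relative change
  of the weight in the application. The induction rests on y = 1 + t + t^2 y for y = 1 / (1 - t),
  with y \<le> 3 on the interval.\<close>

lemma inverse_power_taylor_upper:
  "\<exists>K\<ge>0. \<forall>x::real. 7/16 \<le> x \<longrightarrow> x \<le> 25/16 \<longrightarrow> inverse x ^ n \<le> 1 + real n * (1 - x) + K * (1 - x) ^ 2"
proof (induction n)
  case 0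
  then show ?case by (intro exI[of _ 0]) simp
next
  case (Suc n)
  then obtain K where K: "0 \<le> K" "\<And>x. 7/16 \<le> x \<Longrightarrow> x \<le> 25/16 \<Longrightarrow> inverse x ^ n \<le> 1 + real n * (1 - x) + K * (1 - x) ^ 2"
    by blast
  let ?K = "real n + 3 * (1 + real n) + 3 * K"
  have "inverse x ^ Suc n \<le> 1 + real (Suc n) * (1 - x) + ?K * (1 - x) ^ 2" if x: "7/16 \<le> x" "x \<le> 25/16" for x :: real
  proof -
    define t where "t = 1 - x"
    define y where "y = inverse x"
    have y: "0 < y" "y \<le> 3" using x by (auto simp: y_def field_simps)
    have t: "\<bar>t\<bar> \<le> 1" using x by (auto simp: t_def)
    have yt: "y = 1 + t + t ^ 2 * y" using x by (simp add: y_def t_def field_simps power2_eq_square)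
    have "y ^ Suc n \<le> y * (1 + real n * t + K * t ^ 2)"
      using mult_left_mono[OF K(2)[OF x], of y] y by (simp add: y_def t_def)
    also have "\<dots> = y * (1 + real n * t) + K * y * t ^ 2" by (simp add: algebra_simps)
    also have "y * (1 + real n * t) = (1 + t + t ^ 2 * y) * (1 + real n * t)" using yt by simp
    also have "\<dots> = 1 + real (Suc n) * t + real n * t ^ 2 + (y * (1 + real n * t)) * t ^ 2"
      by (simp add: algebra_simps power2_eq_square)
    finally have "y ^ Suc n \<le> 1 + real (Suc n) * t + real n * t ^ 2 + (y * (1 + real n * t)) * t ^ 2 + K * y * t ^ 2" .
    moreover have "(y * (1 + real n * t)) * t ^ 2 \<le> 3 * (1 + real n) * t ^ 2"
    proof (rule mult_right_mono)
      have "1 + real n * t \<le> 1 + real n" using t mult_left_mono[of t 1 "real n"] by simp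
      then have "y * (1 + real n * t) \<le> y * (1 + real n)" using y by (intro mult_left_mono) auto
      also have "\<dots> \<le> 3 * (1 + real n)" using y by (intro mult_right_mono) auto
      finally show "y * (1 + real n * t) \<le> 3 * (1 + real n)" .
    qed simp
    moreover have "K * y * t ^ 2 \<le> K * 3 * t ^ 2"
      using y K(1) by (intro mult_right_mono mult_left_mono) auto
    ultimately have "y ^ Suc n \<le> 1 + real (Suc n) * t + real n * t ^ 2 + 3 * (1 + real n) * t ^ 2 + K * 3 * t ^ 2"
      by linarith
    then show ?thesis by (simp add: y_def t_def algebra_simps)
  qed
  then show ?case using K(1) by (intro exI[of _ ?K]) auto
qed

text \<open>At an interior maximum \<open>z\<close> of \<open>(R\<^sup>2 - |y - x0|\<^sup>2)\<^sup>n u(y)\<close>, the function \<open>u\<close> is touched from above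
  by \<open>u(z)\<close> times a quotient of the weights, whose second differences are controlled as follows.\<close>

lemma weight_quotient_second_diff:
  "\<exists>K\<ge>0. \<forall>(a :: 'a::euclidean_space) h R. norm a < R \<longrightarrow> norm h \<le> (R - norm a) / 4 \<longrightarrow>
     (let w = (\<lambda>y. R ^ 2 - norm y ^ 2) in
       0 < w (a + h) \<and> 0 < w (a - h) \<and>
       (w a / w (a + h)) ^ n + (w a / w (a - h)) ^ n - 2 \<le> K * (norm h / (R - norm a)) ^ 2)"
proof -
  obtain K where K: "0 \<le> K" "\<And>x. 7/16 \<le> x \<Longrightarrow> x \<le> 25/16 \<Longrightarrow> inverse x ^ n \<le> 1 + real n * (1 - x) + K * (1 - x) ^ 2"
    using inverse_power_taylor_upper by blast
  let ?K = "2 * real n + 18 * K"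
  have "0 < R ^ 2 - norm (a + h) ^ 2 \<and> 0 < R ^ 2 - norm (a - h) ^ 2 \<and>
     ((R ^ 2 - norm a ^ 2) / (R ^ 2 - norm (a + h) ^ 2)) ^ n + ((R ^ 2 - norm a ^ 2) / (R ^ 2 - norm (a - h) ^ 2)) ^ n - 2
       \<le> ?K * (norm h / (R - norm a)) ^ 2"
    if aR: "norm a < R" and h: "norm h \<le> (R - norm a) / 4" for a h :: 'a and R
  proof -
    define d where "d = R - norm a"
    define w where "w = R ^ 2 - norm a ^ 2"
    define q where "q = norm h / d"
    have d: "0 < d" "d \<le> R" using aR by (auto simp: d_def)
    have R: "0 < R" using aR norm_ge_zero[of a] by linarith
    have wd: "w = d * (R + norm a)" by (simp add: w_def d_def power2_eq_square algebra_simps)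
    have wR: "d * R \<le> w" unfolding wd using d by (intro mult_left_mono) auto
    have w: "0 < w" using mult_pos_pos[OF d(1) R] wR by linarith
    have q: "0 \<le> q" "q \<le> 1 / 4" using h d by (auto simp: q_def d_def field_simps)
    \<comment> \<open>The weight at a + h and a - h is w (1 - \<tau> - \<epsilon>) and w (1 + \<tau>
      - \<epsilon>). The odd part \<tau> is of order q and cancels to first order in the sum of the
      two quotients; \<epsilon> and \<tau>^2 are of order q^2.\<close>
    define \<tau> where "\<tau> = 2 * (a \<bullet> h) / w"
    define \<epsilon> where "\<epsilon> = norm h ^ 2 / w"
    have "\<bar>2 * (a \<bullet> h)\<bar> \<le> 2 * q * (d * R)"
    proof -
      have "\<bar>a \<bullet> h\<bar> \<le> norm a * norm h" by (rule Cauchy_Schwarz_ineq2)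
      also have "\<dots> \<le> R * norm h" using aR by (intro mult_right_mono) auto
      finally show ?thesis using d by (simp add: q_def mult_ac abs_mult)
    qed
    also have "\<dots> \<le> 2 * q * w" using wR q by (intro mult_left_mono) auto
    finally have \<tau>: "\<bar>\<tau>\<bar> \<le> 2 * q" using w by (simp add: \<tau>_def abs_mult field_simps)
    have "norm h ^ 2 = q ^ 2 * (d * d)" using d by (simp add: q_def power2_eq_square)
    also have "\<dots> \<le> q ^ 2 * w"
    proof (rule mult_left_mono)
      have "d * d \<le> d * R" using d by (intro mult_left_mono) auto
      then show "d * d \<le> w" using wR by (rule order_trans)
    qed simp
    finally have \<epsilon>: "0 \<le> \<epsilon>" "\<epsilon> \<le> q ^ 2" using w by (simp_all add: \<epsilon>_def field_simps)
    have q2: "q ^ 2 \<le> q / 4" using q mult_left_mono[of q "1/4" q] by (simp add: power2_eq_square)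
    have wp: "R ^ 2 - norm (a + h) ^ 2 = w * (1 - \<tau> - \<epsilon>)" and wm: "R ^ 2 - norm (a - h) ^ 2 = w * (1 + \<tau> - \<epsilon>)"
      using w by (simp_all add: w_def[symmetric] \<tau>_def \<epsilon>_def right_diff_distrib distrib_left)
        (simp_all add: w_def power2_norm_eq_inner inner_add inner_diff inner_commute algebra_simps)
    have r: "7/16 \<le> 1 - \<tau> - \<epsilon>" "1 - \<tau> - \<epsilon> \<le> 25/16" "7/16 \<le> 1 + \<tau> - \<epsilon>" "1 + \<tau> - \<epsilon> \<le> 25/16"
      using \<tau> \<epsilon> q q2 by linarith+
    have pos: "0 < R ^ 2 - norm (a + h) ^ 2" "0 < R ^ 2 - norm (a - h) ^ 2"
      unfolding wp wm using w r by (intro mult_pos_pos; linarith)+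
    have quot: "w / (w * c) = inverse c" for c using w by (simp add: field_simps)
    have sq: "(\<tau> + \<epsilon>) ^ 2 \<le> 9 * q ^ 2" "(\<epsilon> - \<tau>) ^ 2 \<le> 9 * q ^ 2"
    proof -
      have "\<bar>\<tau> + \<epsilon>\<bar> \<le> 3 * q" "\<bar>\<epsilon> - \<tau>\<bar> \<le> 3 * q" using \<tau> \<epsilon> q q2 by linarith+
      then have "\<bar>\<tau> + \<epsilon>\<bar> ^ 2 \<le> (3 * q) ^ 2" "\<bar>\<epsilon> - \<tau>\<bar> ^ 2 \<le> (3 * q) ^ 2"
        by (intro power_mono; simp)+
      then show "(\<tau> + \<epsilon>) ^ 2 \<le> 9 * q ^ 2" "(\<epsilon> - \<tau>) ^ 2 \<le> 9 * q ^ 2"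
        by (simp_all add: power_mult_distrib)
    qed
    have "inverse (1 - \<tau> - \<epsilon>) ^ n \<le> 1 + real n * (\<tau> + \<epsilon>) + K * (\<tau> + \<epsilon>) ^ 2"
      using K(2)[OF r(1,2)] by simp
    moreover have "inverse (1 + \<tau> - \<epsilon>) ^ n \<le> 1 + real n * (\<epsilon> - \<tau>) + K * (\<epsilon> - \<tau>) ^ 2"
      using K(2)[OF r(3,4)] by simp
    moreover have "K * (\<tau> + \<epsilon>) ^ 2 \<le> K * (9 * q ^ 2)" "K * (\<epsilon> - \<tau>) ^ 2 \<le> K * (9 * q ^ 2)"
      using sq K(1) by (auto intro: mult_left_mono)
    moreover have "real n * \<epsilon> \<le> real n * q ^ 2" using \<epsilon> by (intro mult_left_mono) auto
    moreover have "real n * (\<tau> + \<epsilon>) = real n * \<tau> + real n * \<epsilon>" "real n * (\<epsilon> - \<tau>) = real n * \<epsilon> - real n * \<tau>"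
      by (simp_all add: algebra_simps)
    moreover have "?K * q ^ 2 = 2 * (real n * q ^ 2) + 2 * (K * (9 * q ^ 2))"
      by (simp add: algebra_simps)
    ultimately have "inverse (1 - \<tau> - \<epsilon>) ^ n + inverse (1 + \<tau> - \<epsilon>) ^ n - 2 \<le> ?K * q ^ 2"
      by linarith
    then show ?thesis using pos unfolding w_def[symmetric] wp wm quot q_def[symmetric] d_def[symmetric] by blast
  qed
  then show ?thesis using K(1) unfolding Let_def by (intro exI[of _ ?K]) auto
qed

text \<open>At a maximum z of the weighted function, u is touched from above at distance d from the
  boundary of the ball. The equation over radius r = \<theta> d bounds u(z) r^(-\<alpha>) by the
  tail of u at z, hence by \<delta> r^(-s) R^n, so that u(z) d^n is at most a multiple of \<delta>
  R^n. The weight is raised to the power n precisely to absorb d^n, and comparing with the centre x0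
  removes R as well.\<close>

lemma nonneg_harmonic_Harnack:
  fixes \<alpha> :: real
  assumes \<alpha>: "0 < \<alpha>" "\<alpha> < 2"
  shows "\<exists>C\<ge>0. \<forall>(u :: 'a::euclidean_space \<Rightarrow> real) x0 x1 \<delta>.
    nonneg_harmonic \<alpha> u \<longrightarrow> u x1 \<le> \<delta> \<longrightarrow> 0 < \<delta> \<longrightarrow> u x0 \<le> C * \<delta>"
proof -
  let ?n = "DIM('a)"
  let ?s = "real DIM('a) + \<alpha>"
  have s: "0 < ?s" using \<alpha> by (simp add: add_nonneg_pos)
  obtain T where T_tail: "0 \<le> T \<and> (\<forall>(u :: 'a \<Rightarrow> real) x1 z \<delta> r R.
    nonneg_harmonic \<alpha> u \<longrightarrow> u x1 \<le> \<delta> \<longrightarrow> 0 < \<delta> \<longrightarrow> 0 < r \<longrightarrow> r \<le> R \<longrightarrow> norm (z - x1) \<le> 2 * R \<longrightarrow>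
    (LBINT h. indicator {h. r \<le> norm h} h * (u (z + h) * norm h powr - ?s))
      \<le> T * \<delta> * r powr - ?s * R ^ ?n)"
    using nonneg_harmonic_tail_bound[OF \<alpha>, where 'a='a] by (rule exE)
  note T = conjunct1[OF T_tail] and tail = conjunct2[OF T_tail, rule_format]
  obtain K where K_quot: "0 \<le> K \<and> (\<forall>(a :: 'a) h R. norm a < R \<longrightarrow> norm h \<le> (R - norm a) / 4 \<longrightarrow>
     (let w = (\<lambda>y. R ^ 2 - norm y ^ 2) in
       0 < w (a + h) \<and> 0 < w (a - h) \<and>
       (w a / w (a + h)) ^ ?n + (w a / w (a - h)) ^ ?n - 2 \<le> K * (norm h / (R - norm a)) ^ 2))"
    using weight_quotient_second_diff[of "DIM('a)", where 'a='a] by (rule exE)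
  note K = conjunct1[OF K_quot] and quot = conjunct2[OF K_quot, rule_format, unfolded Let_def]
  define J0 where "J0 = integral\<^sup>L lborel (\<lambda>h::'a. indicator {h. 1 \<le> norm h} h * norm h powr - ?s)"
  define J2 where "J2 = integral\<^sup>L lborel (\<lambda>h::'a. indicator {h. norm h < 1} h * (norm h ^ 2 * norm h powr - ?s))"
  have J0: "0 < J0" unfolding J0_def by (rule outer_kernel_integral_pos[OF \<alpha>(1)])
  have J2: "0 \<le> J2" unfolding J2_def by (rule Bochner_Integration.integral_nonneg) simp
  \<comment> \<open>The bound 1/4 keeps h in the range of the quotient estimate. The other bound,
    with \<theta>^2 \<le> \<theta>, gives K J2 \<theta>^2 \<le> J0, so the paraboloid absorbs at
    most half of the term 2 u(z) r^(-\<alpha>) J0.\<close>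
  define \<theta> where "\<theta> = min (1 / 4) (J0 / (K * J2 + 1))"
  have KJ: "0 \<le> K * J2" using K J2 by simp
  have \<theta>: "0 < \<theta>" "\<theta> \<le> 1 / 4"
    unfolding \<theta>_def using J0 KJ by (simp_all only: min.cobounded1) (simp add: add_nonneg_pos)
  have \<theta>J: "K * J2 * \<theta> ^ 2 \<le> J0"
  proof -
    have "\<theta> ^ 2 \<le> \<theta>" using \<theta> mult_left_mono[of \<theta> 1 \<theta>] by (simp add: power2_eq_square)
    then have "K * J2 * \<theta> ^ 2 \<le> K * J2 * \<theta>" using KJ by (intro mult_left_mono) auto
    also have "\<dots> \<le> (K * J2 + 1) * \<theta>" using \<theta> by (intro mult_right_mono) auto
    also have "\<dots> \<le> (K * J2 + 1) * (J0 / (K * J2 + 1))"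
      using KJ by (intro mult_left_mono) (auto simp: \<theta>_def)
    also have "\<dots> = J0" using KJ by simp
    finally show ?thesis .
  qed
  \<comment> \<open>2^n stems from w a = d (R + |a|) \<le> 2 R d, 2 T / J0 from the equation at z,
    and \<theta>^n from r = \<theta> d.\<close>
  define C where "C = 2 ^ ?n * (2 * T / J0) / \<theta> ^ ?n"
  have C: "0 \<le> C" using T J0 \<theta> by (simp add: C_def)
  have "u x0 \<le> C * \<delta>" if u: "nonneg_harmonic \<alpha> u" and x1: "u x1 \<le> \<delta>" and \<delta>: "0 < \<delta>"
    for u :: "'a \<Rightarrow> real" and x0 x1 \<delta>
  proof (cases "u x0 = 0")
    case True
    then show ?thesis using C \<delta> by simp
  next
    case False
    have uc: "continuous_on UNIV u" and nn: "\<And>x. 0 \<le> u x"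
      using u by (auto simp: nonneg_harmonic_def)
    have ux0: "0 < u x0" using False nn[of x0] by simp
    \<comment> \<open>The ball about x0 must reach far enough that each of its points lies within 2
      R of x1, as the tail bound requires; adding 1 keeps R positive when x0 = x1.\<close>
    define R where "R = norm (x0 - x1) + 1"
    have R: "0 < R" by (simp add: R_def add_nonneg_pos)
    define w where "w y = R ^ 2 - norm y ^ 2" for y :: 'a
    have "continuous_on (cball x0 R) (\<lambda>y. w (y - x0) ^ ?n * u y)"
      unfolding w_def by (intro continuous_intros continuous_on_subset[OF uc]) auto
    then obtain z where z: "z \<in> cball x0 R" "\<And>y. y \<in> cball x0 R \<Longrightarrow> w (y - x0) ^ ?n * u y \<le> w (z - x0) ^ ?n * u z"
      using continuous_attains_sup[of "cball x0 R" "\<lambda>y. w (y - x0) ^ ?n * u y"] R by auto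
    define a where "a = z - x0"
    define d where "d = R - norm a"
    have max0: "(R ^ 2) ^ ?n * u x0 \<le> w a ^ ?n * u z"
      using z(2)[of x0] R by (simp add: w_def a_def)
    moreover have "0 < (R ^ 2) ^ ?n * u x0" using R ux0 by simp
    ultimately have prod: "0 < w a ^ ?n * u z" by linarith
    have aR: "norm a \<le> R" using z(1) by (simp add: a_def dist_norm norm_minus_commute)
    have "norm a \<noteq> R"
    proof
      assume "norm a = R"
      then have "w a = 0" by (simp add: w_def)
      with prod show False by (simp add: zero_power)
    qed
    with aR have aR: "norm a < R" by simp
    have d: "0 < d" "d \<le> R" using aR by (auto simp: d_def)
    have wa: "w a = d * (R + norm a)" by (simp add: w_def d_def power2_eq_square algebra_simps)
    have wpos: "0 < w a" unfolding wa using d R by (intro mult_pos_pos) (auto intro: add_pos_nonneg)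
    have uz: "0 < u z" using prod wpos nn[of z] by (simp add: zero_less_mult_iff)
    define r where "r = \<theta> * d"
    have r: "0 < r" "r \<le> d / 4" using \<theta> d mult_right_mono[OF \<theta>(2), of d] by (auto simp: r_def)
    have rR: "r \<le> R" using r d by linarith
    have touch: "u (z + h) + u (z - h) - 2 * u z \<le> K * u z / d ^ 2 * norm h ^ 2" if h: "norm h < r" for h
    proof -
      have hd: "norm h \<le> (R - norm a) / 4" using h r by (simp add: d_def)
      note q = quot[OF aR hd]
      have le: "u y \<le> u z * (w a / w (y - x0)) ^ ?n" if "0 < w (y - x0)" for y
      proof -
        have "norm (y - x0) < R"
          using that R by (simp add: w_def power2_less_imp_less)
        then have "w (y - x0) ^ ?n * u y \<le> w a ^ ?n * u z"
          unfolding a_def by (intro z(2)) (simp add: dist_norm norm_minus_commute)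
        moreover have "0 < w (y - x0) ^ ?n" using that by simp
        ultimately show ?thesis by (simp add: power_divide field_simps)
      qed
      have e: "z + h - x0 = a + h" "z - h - x0 = a - h" by (simp_all add: a_def)
      have "u (z + h) \<le> u z * (w a / w (a + h)) ^ ?n" "u (z - h) \<le> u z * (w a / w (a - h)) ^ ?n"
        using le[of "z + h"] le[of "z - h"] q unfolding e w_def by blast+
      then have "u (z + h) + u (z - h) - 2 * u z \<le> u z * ((w a / w (a + h)) ^ ?n + (w a / w (a - h)) ^ ?n - 2)"
        by (simp add: algebra_simps)
      also have "\<dots> \<le> u z * (K * (norm h / (R - norm a)) ^ 2)"
        using q nn[of z] unfolding w_def by (intro mult_left_mono) auto
      finally show ?thesis by (simp add: d_def power_divide mult_ac)
    qed
    let ?k = "\<lambda>h::'a. norm h powr - ?s"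
    let ?U = "\<lambda>h. indicator {h. r \<le> norm h} h * (u (z + h) * ?k h)"
    let ?V = "\<lambda>h. indicator {h. r \<le> norm h} h * (u (z - h) * ?k h)"
    define I where "I = (LBINT h. ?U h)"
    have U: "has_bochner_integral lborel ?U I" and V: "has_bochner_integral lborel ?V I"
      using nonneg_harmonic_tail_integrable[OF u \<alpha>(1) r(1), of z] by (simp_all only: has_bochner_integral_iff I_def simp_thms)
    have S: "has_bochner_integral lborel (\<lambda>h. second_diff u z h * ?k h) 0"
      using u by (simp add: nonneg_harmonic_def)
    \<comment> \<open>P is a minorant of the integrand of the equation: exact outside the radius r,
      and given by the touching paraboloid inside. Its integral is therefore at most 0.\<close>
    define P where "P h = 2 * u z * (indicator {h. r \<le> norm h} h * ?k h) - (?U h + ?V h)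
       - K * u z / d ^ 2 * (indicator {h. norm h < r} h * (norm h ^ 2 * ?k h))" for h
    have P: "has_bochner_integral lborel P (2 * u z * (r powr - \<alpha> * J0) - (I + I) - K * u z / d ^ 2 * (r powr (2 - \<alpha>) * J2))"
      unfolding P_def[abs_def] J0_def J2_def
      by (intro has_bochner_integral_diff has_bochner_integral_add has_bochner_integral_mult_right
          has_bochner_integral_inner_kernel has_bochner_integral_outer_kernel U V \<alpha> r)
    have "P h \<le> second_diff u z h * ?k h" for h
    proof (cases "norm h < r")
      case True
      have "- (K * u z / d ^ 2 * norm h ^ 2) \<le> second_diff u z h"
        using touch[OF True] by (simp add: second_diff_def)
      from mult_right_mono[OF this, of "?k h"] show ?thesis using True by (simp add: P_def mult_ac)
    next
      case False
      then show ?thesis by (simp add: P_def second_diff_def algebra_simps)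
    qed
    then have "2 * u z * (r powr - \<alpha> * J0) - (I + I) - K * u z / d ^ 2 * (r powr (2 - \<alpha>) * J2) \<le> 0"
      using integral_mono[of lborel P "\<lambda>h. second_diff u z h * ?k h"] P S
      by (simp add: has_bochner_integral_iff)
    moreover have "K * u z / d ^ 2 * (r powr (2 - \<alpha>) * J2) \<le> u z * r powr - \<alpha> * J0"
    proof -
      have "r powr (2 - \<alpha>) = r ^ 2 * r powr - \<alpha>"
        using r powr_add[of r 2 "- \<alpha>"] by (simp add: powr_numeral)
      then have "K * u z / d ^ 2 * (r powr (2 - \<alpha>) * J2) = u z * r powr - \<alpha> * (K * J2 * \<theta> ^ 2)"
        using d by (simp add: r_def power_mult_distrib)
      also have "\<dots> \<le> u z * r powr - \<alpha> * J0"
        using \<theta>J nn[of z] by (intro mult_left_mono) auto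
      finally show ?thesis .
    qed
    moreover have "I \<le> T * \<delta> * r powr - ?s * R ^ ?n"
      unfolding I_def
    proof (rule tail[OF u x1 \<delta> r(1) rR])
      show "norm (z - x1) \<le> 2 * R"
        using norm_triangle_ineq[of a "x0 - x1"] aR by (simp add: a_def R_def)
    qed
    ultimately have main: "u z * r powr - \<alpha> * J0 \<le> 2 * (T * \<delta> * r powr - ?s * R ^ ?n)"
      by (simp add: mult.assoc)
    have "r powr - ?s * r powr ?s = 1" "r powr - \<alpha> * r powr ?s = r ^ ?n"
      using r by (simp_all add: powr_realpow[symmetric] flip: powr_add)
    then have "(u z * J0) * r ^ ?n = (u z * r powr - \<alpha> * J0) * r powr ?s"
      and "2 * T * \<delta> * R ^ ?n = 2 * (T * \<delta> * r powr - ?s * R ^ ?n) * r powr ?s"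
      by (simp_all add: mult_ac)
    then have "(u z * J0) * r ^ ?n \<le> 2 * T * \<delta> * R ^ ?n"
      using mult_right_mono[OF main powr_ge_zero[of r ?s]] by (simp only:)
    then have uzd: "u z * d ^ ?n \<le> 2 * T / J0 / \<theta> ^ ?n * \<delta> * R ^ ?n"
      using J0 \<theta> by (simp add: r_def power_mult_distrib field_simps)
    have "(R ^ 2) ^ ?n * u x0 \<le> w a ^ ?n * u z" by (rule max0)
    also have "\<dots> \<le> (d * (2 * R)) ^ ?n * u z"
      unfolding wa using d aR R nn[of z] by (intro mult_right_mono power_mono mult_left_mono) auto
    also have "\<dots> = (2 * R) ^ ?n * (u z * d ^ ?n)" by (simp add: power_mult_distrib)
    also have "\<dots> \<le> (2 * R) ^ ?n * (2 * T / J0 / \<theta> ^ ?n * \<delta> * R ^ ?n)"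
      using R by (intro mult_left_mono uzd) auto
    also have "\<dots> = (R ^ 2) ^ ?n * (C * \<delta>)"
      by (simp add: C_def power_mult_distrib power2_eq_square)
    finally show ?thesis using R by simp
  qed
  then show ?thesis using C by (intro exI[of _ C]) auto
qed

lemma nonneg_harmonic_constant:
  fixes u :: "'a::euclidean_space \<Rightarrow> real"
  assumes \<alpha>: "0 < \<alpha>" "\<alpha> < 2" and u: "nonneg_harmonic \<alpha> u"
  shows "u x = u y"
proof -
  obtain C where C_Harnack: "0 \<le> C \<and> (\<forall>(u :: 'a \<Rightarrow> real) x0 x1 \<delta>.
    nonneg_harmonic \<alpha> u \<longrightarrow> u x1 \<le> \<delta> \<longrightarrow> 0 < \<delta> \<longrightarrow> u x0 \<le> C * \<delta>)"
    using nonneg_harmonic_Harnack[OF \<alpha>, where 'a='a] by (rule exE)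
  note C = conjunct1[OF C_Harnack] and Harnack = conjunct2[OF C_Harnack, rule_format]
  define i where "i = (INF x. u x)"
  have bdd: "bdd_below (range u)" using u by (auto simp: nonneg_harmonic_def bdd_below_def)
  have i: "i \<le> u x" for x unfolding i_def by (rule cINF_lower[OF bdd]) simp
  have sd: "second_diff (\<lambda>x. u x - i) = second_diff u" by (intro ext) (simp add: second_diff_def)
  have v: "nonneg_harmonic \<alpha> (\<lambda>x. u x - i)"
    using u i unfolding nonneg_harmonic_def sd by (auto intro: continuous_intros)
  have "u x = i" for x
  proof (rule ccontr)
    assume "u x \<noteq> i"
    then have p: "0 < u x - i" using i[of x] by simp
    \<comment> \<open>With this choice the Harnack bound C \<delta> is at most half of u x - i, a
      contradiction; C + 1 in place of C avoids dividing by zero.\<close>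
    define \<delta> where "\<delta> = (u x - i) / (2 * (C + 1))"
    have \<delta>: "0 < \<delta>" using p C by (simp add: \<delta>_def)
    have "(INF x. u x) < i + \<delta>" using \<delta> by (simp add: i_def)
    then obtain x1 where "u x1 < i + \<delta>"
      using cINF_less_iff[OF _ bdd] by auto
    then have "u x - i \<le> C * \<delta>" using Harnack[OF v, of x1 \<delta> x] \<delta> by simp
    also have "\<dots> \<le> (C + 1) * \<delta>" using \<delta> by (intro mult_right_mono) auto
    also have "\<dots> = (u x - i) / 2"
    proof -
      have "c * (t / (2 * c)) = t / 2" if "c \<noteq> 0" for c t :: real using that by simp
      then show ?thesis unfolding \<delta>_def by this (use C in simp)
    qed
    finally show False using p by simp
  qed
  then show ?thesis by simp
qed

text \<open>\<open>Gamma\<close> has the value 0 at its poles, so the denominator could vanish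
  there; -\<alpha>/2 lies strictly between -1 and 0 and is not a pole.\<close>

lemma frac_lap_const_nonzero:
  assumes "0 < \<alpha>" "\<alpha> < 2"
  shows "frac_lap_const n \<alpha> \<noteq> 0"
proof -
  have "- \<alpha> / 2 \<notin> \<int>\<^sub>\<le>\<^sub>0"
  proof
    assume "- \<alpha> / 2 \<in> \<int>\<^sub>\<le>\<^sub>0"
    then obtain k where "- \<alpha> / 2 = - real k" by (auto elim: nonpos_Ints_cases')
    then have "0 < real k" "real k < 1" using assms by auto
    then show False by simp
  qed
  then have "Gamma (- \<alpha> / 2) \<noteq> 0" by (simp add: Gamma_eq_zero_iff)
  moreover have "0 < Gamma ((real n + \<alpha>) / 2)"
    using assms by (intro Gamma_real_pos) (simp add: add_nonneg_pos)
  ultimately show ?thesis by (simp add: frac_lap_const_def)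
qed

theorem theorem1p3:
  fixes u :: "'a::euclidean_space \<Rightarrow> real" and m :: nat and \<alpha> \<epsilon> :: real
  assumes "DIM('a) \<ge> 2"
    and "m \<ge> 1"
    and "0 < \<alpha>" and "\<alpha> < 2"
    and "0 < \<epsilon>"
    and "C_k_holder_loc (2 * m + nat \<lfloor>\<alpha>\<rfloor>) (frac \<alpha> + \<epsilon>) u"
    and "u \<in> L_space \<alpha>"
    and "\<And>x. u x \<ge> 0"
    and "\<And>x. higher_frac_laplacian m \<alpha> u x = 0"
  shows "\<exists>C\<ge>0. \<forall>x. u x = C"
proof -
  let ?s = "real DIM('a) + \<alpha>"
  note \<alpha> = assms(3,4)
  note frac = C_k_frac_laplacian[OF \<alpha> assms(5,6,7)]
  have uc: "continuous_on UNIV u"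
    using assms(6) C_k_continuous by (auto simp: C_k_holder_loc_def)
  obtain \<beta> where \<beta>: "\<alpha> < \<beta>" "second_diff_loc \<beta> u"
    using C_k_holder_imp_second_diff_loc[OF assms(6) \<alpha> assms(5)] by blast
  let ?v = "\<lambda>x. LBINT h. second_diff u x h * norm h powr - ?s"
  define c where "c = frac_lap_const DIM('a) \<alpha> * (1 / 2)"
  have c: "c \<noteq> 0" using frac_lap_const_nonzero[OF \<alpha>] by (simp add: c_def)
  have lap: "frac_laplacian \<alpha> u = (\<lambda>x. c * ?v x)"
    by (rule ext) (simp add: frac(3) c_def)
  have "frac_laplacian \<alpha> u x = 0" for x
  \<comment> \<open>Pizzetti's formula works for every positive exponent of the weight. The exponent
    2 is the smallest whose second differences are of order |h|^2; with exponent 1 the weight has a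
    kink on the unit sphere.\<close>
  proof (rule polyharmonic_eq_0[OF frac(1), of 2])
    show "(neg_laplacian ^^ m) (frac_laplacian \<alpha> u) x = 0" for x
      using assms(9) by (simp add: higher_frac_laplacian_def)
    have "(bump_mean 2 ?v x \<longlongrightarrow> 0) at_top"
      by (rule bump_mean_fractional_decay[OF \<alpha> uc L_space_integrable_weight[OF assms(7) uc \<alpha>(1)] \<beta>(2,1) frac(2)])
    from tendsto_mult_right_zero[OF this, of c]
    show "(bump_mean 2 (frac_laplacian \<alpha> u) x \<longlongrightarrow> 0) at_top"
      unfolding lap bump_mean_def by (simp add: mult.left_commute)
  qed simp
  then have "?v x = 0" for x using c by (simp add: lap)
  then have "nonneg_harmonic \<alpha> u"
    unfolding nonneg_harmonic_def using uc assms(8) frac(2)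
    by (simp add: has_bochner_integral_iff)
  from nonneg_harmonic_constant[OF \<alpha> this, of _ 0] assms(8)[of 0]
  show ?thesis by blast
qed

end
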